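(* Let $\mathbf b=(b_1,\dots,b_K)$ be an ordered $K$-partition of $N$ ($b_i\in\mathbb{Z}_{\ge0}$, $\sum_ib_i=N$). The (suitably scaled) harmonic metric $h_{\mathbf b}$ on the good filtered Higgs bundle $(\mathcal{E}_{\mathbf b},\varphi_{\mathbf b})$ is, in the basis of canonical sections $e_1,\dots,e_K$, $$h_{\mathbf b}=\operatorname{diag}\bigl(|z|^{-2\alpha_1}e^{u_1},\dots,|z|^{-2\alpha_K}e^{u_K}\bigr),$$ where $u_i(z)=u_i(|z|)$ and the functions $u_i:\mathbb{R}^{>0}\to\mathbb{R}$ solve (indices mod $K$) $$\frac14\left(\frac{d^2}{d|z|^2}+\frac{1}{|z|}\frac{d}{d|z|}\right)u_i=|z|^{\frac{2N}{K}}\left(e^{u_i-u_{i+1}}-e^{u_{i-1}-u_i}\right)$$ with the following boundary conditions: (1) $u_i\to0$ as $|z|\to\infty$; (2) near $0$, $u_i\sim2\alpha_i\log|z|$ (in the sense that $u_i-2\alpha_i\log|z|$ stays bounded as $|z|\to0$). Additionally, for every $i$, $$\lim_{|z|\to0}|z|^{\frac{2(K+N)}{K}}\left(e^{u_i-u_{i+1}}-1\right)=0,\qquad\lim_{|z|\to0}|z|\frac{du_i}{d|z|}=2\alpha_i,$$ $$\lim_{|z|\to\infty}|z|^{\frac{2(K+N)}{K}}\sum_{i=1}^K\left(e^{u_i-u_{i+1}}-1\right)=0,\qquad\lim_{|z|\to\infty}|z|\frac{du_i}{d|z|}=0.$$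
   Context: $K\ge 2$ and $N\ge 1$ are coprime integers; $z$ is the standard coordinate on $\mathbb{C}\subset\mathbb{CP}^1$. A filtered rank $K$ bundle on $(\mathbb{CP}^1,\{\infty\})$ is a locally free $\mathcal{O}_{\mathbb{CP}^1}( *\{\infty\})$-module $\mathcal{E}$ of rank $K$ (where $\mathcal{O}_{\mathbb{CP}^1}( *\{\infty\})$ is the sheaf of meromorphic functions with poles only at $\infty$) with an increasing filtration by locally free $\mathcal{O}_{\mathbb{CP}^1}$-submodules $\mathcal{P}_\alpha\mathcal{E}$, $\alpha\in\mathbb{R}$, such that $\mathcal{P}_\alpha\mathcal{E}|_{\mathbb{C}}=\mathcal{E}|_{\mathbb{C}}$, $\mathcal{P}_\alpha\mathcal{E}=\bigcap_{\beta>\alpha}\mathcal{P}_\beta\mathcal{E}$, and near $\infty$, with $x=1/z$, $\mathcal{P}_{\alpha-1}\mathcal{E}=x\,\mathcal{P}_\alpha\mathcal{E}$. For a section $s$ near $\infty$, $\nu_\infty(s)=\inf\{\alpha: s\in\mathcal{P}_\alpha\mathcal{E}\}$. For $\alpha\in\mathbb{R}$, $\mathcal{O}(\alpha)$ is the filtered line bundle with underlying module $\mathcal{O}_{\mathbb{CP}^1}( *\{\infty\})$ and filtration by pole order at $\infty$ shifted by $-\alpha$; its canonical section $e$ (the element $1$) trivializes it on $\mathbb{C}$ and has $\nu_\infty(e)=-\alpha$. Direct sums carry $\mathcal{P}_\alpha(\mathcal{E}\oplus\mathcal{E}')=\mathcal{P}_\alpha\mathcal{E}\oplus\mathcal{P}_\alpha\mathcal{E}'$.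 The Higgs bundle $(\mathcal{E}_{\mathbf b},\varphi_{\mathbf b})$: let $\alpha_1,\dots,\alpha_K$ be determined by $b_i-\frac NK=\alpha_i-\alpha_{i+1}$ (indices mod $K$) and $\sum_i\alpha_i=0$. Put $\mathcal{E}_{\mathbf b}=\bigoplus_{i=1}^K\mathcal{O}(\alpha_i)$ with canonical sections $e_i$, and $\varphi_{\mathbf b}(e_{i+1})=z^{b_i}\,e_i\,dz$ (indices mod $K$). A Hermitian metric $h$ on $\mathcal{E}|_{\mathbb{C}}$ is adapted to the filtration if near $\infty$, $\mathcal{P}_\alpha\mathcal{E}=\{s:\|s\|_h=O(|x|^{-(\alpha+\epsilon)})\text{ for all }\epsilon>0\}$ for all $\alpha\in\mathbb{R}$. A harmonic metric on $(\mathcal{E},\varphi)$ is an adapted Hermitian metric (smooth on $\mathcal{E}|_{\mathbb{C}}$) with $F_{D(\mathcal{E},h)}+[\varphi,\varphi^{\dagger_h}]=0$ on $\mathbb{C}$, where $D(\mathcal{E},h)$ is the Chern connection, $\varphi^{\dagger_h}$ is the $h$-adjoint and $[\varphi,\varphi^{\dagger_h}]=\varphi\wedge\varphi^{\dagger_h}+\varphi^{\dagger_h}\wedge\varphi$. It is known that $(\mathcal{E}_{\mathbf b},\varphi_{\mathbf b})$ has a harmonic metric, unique up to a positive scalar; the scale is fixed here by $\|e_1\wedge\cdots\wedge e_K\|_h=1$. *)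

theory Defs
  imports
    "HOL-Complex_Analysis.Complex_Analysis"
    "Jordan_Normal_Form.Determinant"
begin

hide_const (open)
  Finite_Cartesian_Product.vec Finite_Cartesian_Product.mat Determinants.det

section \<open>Filtered bundles on the projective line with pole at infinity\<close>

text \<open>
  The underlying module is the free module of rank \<open>K\<close> over the sheaf of meromorphic functions
  with poles only at infinity, with frame \<open>e\<^sub>0, \<dots>, e\<^sub>K\<^sub>-\<^sub>1\<close> (indices are \<open>0, \<dots>, K - 1\<close>, cyclic
  modulo \<open>K\<close>). A section near infinity is given by its components \<open>s i :: complex \<Rightarrow> complex\<close>,
  \<open>i < K\<close>, as functions of the affine coordinate \<open>z\<close>, where only the values for large \<open>\<bar>z\<bar>\<close> matter.
  A filtration is given by its pieces near infinity, as it is trivial on the affine line.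
\<close>

type_synonym section_inf = "nat \<Rightarrow> complex \<Rightarrow> complex"

text \<open>In the coordinate \<open>x = 1/z\<close>, near \<open>x = 0\<close>: \<open>f = x\<^sup>-\<^sup>n g\<close> with \<open>g\<close> holomorphic.\<close>

definition pole_order_le :: "(complex \<Rightarrow> complex) \<Rightarrow> int \<Rightarrow> bool" where
  "pole_order_le f n \<longleftrightarrow>
     (\<exists>r>0. \<exists>g. g holomorphic_on ball 0 r \<and>
        (\<forall>x\<in>ball 0 r - {0}. f (1 / x) = x powi (- n) * g x))"

definition sections_inf :: "nat \<Rightarrow> section_inf set" where
  "sections_inf K = {s. \<forall>i<K. \<exists>n. pole_order_le (s i) n}"

text \<open>The piece of index \<open>\<beta>\<close> of the filtered line bundle \<open>O(\<alpha>)\<close>; the section \<open>1\<close> has order \<open>-\<alpha>\<close>.\<close>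

definition filt_line :: "real \<Rightarrow> real \<Rightarrow> (complex \<Rightarrow> complex) set" where
  "filt_line \<alpha> \<beta> = {f. \<exists>n. pole_order_le f n \<and> real_of_int n - \<alpha> \<le> \<beta>}"

definition filt_sum :: "nat \<Rightarrow> (nat \<Rightarrow> real) \<Rightarrow> real \<Rightarrow> section_inf set" where
  "filt_sum K \<alpha> \<beta> = {s. \<forall>i<K. s i \<in> filt_line (\<alpha> i) \<beta>}"

section \<open>Smooth functions and Wirtinger derivatives\<close>

primrec C_k :: "nat \<Rightarrow> (complex \<Rightarrow> complex) \<Rightarrow> bool" where
  "C_k 0 f \<longleftrightarrow> continuous_on UNIV f"
| "C_k (Suc k) f \<longleftrightarrow>
     (\<forall>z. f differentiable (at z)) \<and> (\<forall>v. C_k k (\<lambda>z. frechet_derivative f (at z) v))"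

definition smooth_mat :: "nat \<Rightarrow> (complex \<Rightarrow> complex Matrix.mat) \<Rightarrow> bool" where
  "smooth_mat K M \<longleftrightarrow>
     (\<forall>z. M z \<in> carrier_mat K K) \<and> (\<forall>i<K. \<forall>j<K. \<forall>k. C_k k (\<lambda>z. M z $$ (i, j)))"

definition d_z :: "(complex \<Rightarrow> complex) \<Rightarrow> complex \<Rightarrow> complex" where
  "d_z f z = (frechet_derivative f (at z) 1 - \<i> * frechet_derivative f (at z) \<i>) / 2"

definition d_zbar :: "(complex \<Rightarrow> complex) \<Rightarrow> complex \<Rightarrow> complex" where
  "d_zbar f z = (frechet_derivative f (at z) 1 + \<i> * frechet_derivative f (at z) \<i>) / 2"

definition mat_d_z :: "nat \<Rightarrow> (complex \<Rightarrow> complex Matrix.mat) \<Rightarrow> complex \<Rightarrow> complex Matrix.mat" where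
  "mat_d_z K M z = Matrix.mat K K (\<lambda>(i, j). d_z (\<lambda>w. M w $$ (i, j)) z)"

definition mat_d_zbar :: "nat \<Rightarrow> (complex \<Rightarrow> complex Matrix.mat) \<Rightarrow> complex \<Rightarrow> complex Matrix.mat" where
  "mat_d_zbar K M z = Matrix.mat K K (\<lambda>(i, j). d_zbar (\<lambda>w. M w $$ (i, j)) z)"

section \<open>Hermitian metrics, Chern connection, harmonic metrics\<close>

text \<open>
  A metric is given by its Gram matrices \<open>G z\<close> in the frame \<open>e\<^sub>i\<close>, with the convention
  \<open>h(s, t) = t\<^sup>* G s\<close> (linear in \<open>s\<close>, antilinear in \<open>t\<close>), so that \<open>G $$ (i, j) = h(e\<^sub>j, e\<^sub>i)\<close>.
\<close>

definition herm_form :: "complex Matrix.mat \<Rightarrow> complex Matrix.vec \<Rightarrow> complex Matrix.vec \<Rightarrow> complex" where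
  "herm_form G s t = (G *\<^sub>v s) \<bullet>c t"

definition hermitian_metric :: "nat \<Rightarrow> (complex \<Rightarrow> complex Matrix.mat) \<Rightarrow> bool" where
  "hermitian_metric K G \<longleftrightarrow> smooth_mat K G \<and>
     (\<forall>z. (\<forall>s\<in>carrier_vec K. \<forall>t\<in>carrier_vec K. herm_form (G z) s t = cnj (herm_form (G z) t s)) \<and>
          (\<forall>s\<in>carrier_vec K. s \<noteq> 0\<^sub>v K \<longrightarrow> Re (herm_form (G z) s s) > 0))"

definition section_norm :: "nat \<Rightarrow> (complex \<Rightarrow> complex Matrix.mat) \<Rightarrow> section_inf \<Rightarrow> complex \<Rightarrow> real" where
  "section_norm K G s z =
     sqrt (Re (herm_form (G z) (Matrix.vec K (\<lambda>i. s i z)) (Matrix.vec K (\<lambda>i. s i z))))"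

definition adapted ::
  "nat \<Rightarrow> (real \<Rightarrow> section_inf set) \<Rightarrow> (complex \<Rightarrow> complex Matrix.mat) \<Rightarrow> bool" where
  "adapted K P G \<longleftrightarrow>
     (\<forall>\<beta>. P \<beta> = {s \<in> sections_inf K. \<forall>\<epsilon>>0.
        section_norm K G s \<in> O[at_infinity](\<lambda>z. norm (1 / z) powr (- (\<beta> + \<epsilon>)))})"

text \<open>
  \<open>A dz + B dz\<^sup>-\<close> is the connection form in the holomorphic frame \<open>e\<^sub>i\<close>, acting on column vectors:
  \<open>D e\<^sub>j = \<Sum>\<^sub>i (A\<^sub>i\<^sub>j dz + B\<^sub>i\<^sub>j dz\<^sup>-) e\<^sub>i\<close>. The Chern connection is the one whose \<open>(0,1)\<close>-part is the
  holomorphic structure (\<open>B = 0\<close>) and which is unitary. The two last equations are the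
  \<open>dz\<close>- and \<open>dz\<^sup>-\<close>-components of \<open>d h(e\<^sub>j, e\<^sub>i) = h(D e\<^sub>j, e\<^sub>i) + h(e\<^sub>j, D e\<^sub>i)\<close>.
\<close>

definition chern_connection ::
  "nat \<Rightarrow> (complex \<Rightarrow> complex Matrix.mat) \<Rightarrow> (complex \<Rightarrow> complex Matrix.mat) \<Rightarrow>
   (complex \<Rightarrow> complex Matrix.mat) \<Rightarrow> bool" where
  "chern_connection K G A B \<longleftrightarrow> smooth_mat K A \<and> smooth_mat K B \<and>
     (\<forall>z. B z = 0\<^sub>m K K) \<and>
     (\<forall>z. \<forall>i<K. \<forall>j<K.
        d_z (\<lambda>w. G w $$ (i, j)) z =
          herm_form (G z) (col (A z) j) (unit_vec K i) + herm_form (G z) (unit_vec K j) (col (B z) i) \<and>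
        d_zbar (\<lambda>w. G w $$ (i, j)) z =
          herm_form (G z) (col (B z) j) (unit_vec K i) + herm_form (G z) (unit_vec K j) (col (A z) i))"

text \<open>The coefficient of \<open>dz \<and> dz\<^sup>-\<close> in \<open>d\<omega> + \<omega> \<and> \<omega>\<close> for \<open>\<omega> = A dz + B dz\<^sup>-\<close>.\<close>

definition curvature ::
  "nat \<Rightarrow> (complex \<Rightarrow> complex Matrix.mat) \<Rightarrow> (complex \<Rightarrow> complex Matrix.mat) \<Rightarrow>
   complex \<Rightarrow> complex Matrix.mat" where
  "curvature K A B z = mat_d_z K B z - mat_d_zbar K A z + (A z * B z - B z * A z)"

definition is_adjoint ::
  "nat \<Rightarrow> complex Matrix.mat \<Rightarrow> complex Matrix.mat \<Rightarrow> complex Matrix.mat \<Rightarrow> bool" where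
  "is_adjoint K G \<Phi> \<Psi> \<longleftrightarrow> \<Psi> \<in> carrier_mat K K \<and>
     (\<forall>s\<in>carrier_vec K. \<forall>t\<in>carrier_vec K. herm_form G (\<Phi> *\<^sub>v s) t = herm_form G s (\<Psi> *\<^sub>v t))"

text \<open>
  For the Higgs field \<open>\<Phi> dz\<close> the adjoint is \<open>\<Psi> dz\<^sup>-\<close> with \<open>\<Psi>\<close> the pointwise adjoint of \<open>\<Phi>\<close>, and
  \<open>\<phi> \<and> \<phi>\<^sup>\<dagger> + \<phi>\<^sup>\<dagger> \<and> \<phi> = (\<Phi> \<Psi> - \<Psi> \<Phi>) dz \<and> dz\<^sup>-\<close>. The connection \<open>(A, B)\<close> and the adjoint \<open>\<Psi>\<close> are
  uniquely determined by the metric, so the existential quantifiers only name them.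
\<close>

definition harmonic_metric ::
  "nat \<Rightarrow> (real \<Rightarrow> section_inf set) \<Rightarrow> (complex \<Rightarrow> complex Matrix.mat) \<Rightarrow>
   (complex \<Rightarrow> complex Matrix.mat) \<Rightarrow> bool" where
  "harmonic_metric K P \<Phi> G \<longleftrightarrow> hermitian_metric K G \<and> adapted K P G \<and>
     (\<exists>A B \<Psi>. chern_connection K G A B \<and> (\<forall>z. is_adjoint K (G z) (\<Phi> z) (\<Psi> z)) \<and>
        (\<forall>z. curvature K A B z + (\<Phi> z * \<Psi> z - \<Psi> z * \<Phi> z) = 0\<^sub>m K K))"

section \<open>The Higgs field of an ordered partition\<close>

text \<open>Matrix of \<open>e\<^sub>i\<^sub>+\<^sub>1 \<mapsto> z\<^bsup>b i\<^esup> e\<^sub>i\<close>: column \<open>i + 1 mod K\<close> is \<open>z\<^bsup>b i\<^esup>\<close> times the \<open>i\<close>-th unit vector.\<close>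

definition higgs_field :: "nat \<Rightarrow> (nat \<Rightarrow> nat) \<Rightarrow> complex \<Rightarrow> complex Matrix.mat" where
  "higgs_field K b z = Matrix.mat K K (\<lambda>(i, j). if j = (i + 1) mod K then z ^ b i else 0)"

end

theory Submission
  imports Defs "HOL-Library.Function_Algebras" "HOL-Real_Asymp.Real_Asymp"
begin

text \<open>
The proof rests on one rigidity statement. Let \<open>G\<close>, \<open>G'\<close> be Gram matrices of two harmonic metrics
for the same Higgs field \<open>\<Phi> dz\<close>, with Chern connection forms \<open>A dz\<close>, \<open>A' dz\<close>, and put
\<open>s = G\<^sup>-\<^sup>1 G'\<close>, \<open>\<tau> = tr s\<close>. Computing the Laplacian of \<open>\<tau>\<close> gives a sum of two squares, one built from
\<open>A' - A\<close> and one from \<open>\<Phi> s - s \<Phi>\<close>, and by Cauchy-Schwarz already \<open>ln \<tau>\<close> is subharmonic. Two metrics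
adapted to the same filtration need not be mutually bounded, but they agree up to
factors \<open>|z|\<^sup>\<epsilon>\<close> for every \<open>\<epsilon> > 0\<close>, so \<open>ln \<tau>\<close> is eventually below \<open>\<epsilon> ln |z|\<close> for each \<open>\<epsilon>\<close>. A subharmonic function on the
plane with this growth is constant (\<open>sublogarithmic_subharmonic_constant\<close>). Hence both squares
vanish: \<open>s\<close> is holomorphic and commutes with \<open>\<Phi>\<close> (\<open>rigidity\<close>).

For the cyclic Higgs field of an ordered partition, commuting with \<open>\<Phi>\<close> links the entries of \<open>s\<close> along
each orbit of \<open>(i, j) \<mapsto> (i + 1, j + 1)\<close>. An entry grows at most like
\<open>|z|\<close> to the power \<open>\<alpha>\<^sub>i - \<alpha>\<^sub>j + \<epsilon>\<close>; along an off-diagonal orbit these differences sum to zero, and none of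
them is zero because \<open>N\<close> and \<open>K\<close> are coprime. So one of them is negative, that entry vanishes by
Liouville, and with it the whole orbit. Thus \<open>s\<close> is a constant scalar (\<open>commutant_scalar\<close>,
\<open>solutions_proportional\<close>). Rotating \<open>z\<close> and conjugating with a suitable diagonal unitary matrix maps
\<open>\<Phi>\<close> to a unimodular multiple of itself, hence harmonic metrics to harmonic metrics, and the scalar is
\<open>1\<close>, as one sees at the origin (\<open>symmetry\<close>). Taking the trivial rotation and \<open>K\<close>-th roots of unity forces
the metric to be diagonal; taking all rotations makes its diagonal entries radial.

For a diagonal radial metric Hitchin's equation is the Toda system of the statement. The behaviour at
the origin is smoothness of the metric there. At infinity, put \<open>t = ln r\<close>. The filtration gives
\<open>u\<^sub>i = o(t)\<close>, and the normalisation of the determinant gives \<open>\<Sum> u\<^sub>i = 0\<close>. The energy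
\<open>f = \<Sum> u\<^sub>i\<^sup>2\<close> then satisfies \<open>f'' \<ge> m\<^sup>2 f\<close> for every \<open>m\<close> and all large \<open>t\<close>, and such a function either
grows exponentially, which the growth bound excludes, or decays faster than
\<open>e\<^sup>-\<^sup>m\<^sup>t\<close>. So \<open>u\<^sub>i\<close> decays faster than any power of \<open>r\<close> (\<open>toda_decay\<close>), which gives every limit at infinity.
\<close>

section \<open>Subharmonic functions of sublogarithmic growth\<close>

lemma second_derivative_at_local_max:
  fixes g g' :: "real \<Rightarrow> real"
  assumes "d > 0" and max: "\<And>t. \<bar>t\<bar> < d \<Longrightarrow> g t \<le> g 0"
    and g: "\<And>t. \<bar>t\<bar> < d \<Longrightarrow> (g has_real_derivative g' t) (at t)"
    and g': "(g' has_real_derivative c) (at 0)"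
  shows "c \<le> 0"
proof (rule ccontr)
  assume "\<not> c \<le> 0"
  hence "c > 0" by simp
  have g0: "g' 0 = 0"
    using DERIV_local_max[OF g[of 0], of d] \<open>d > 0\<close> max by simp
  obtain e where e: "e > 0" "\<And>h. 0 < h \<Longrightarrow> h < e \<Longrightarrow> g' 0 < g' (0 + h)"
    using DERIV_pos_inc_right[OF g' \<open>c > 0\<close>] by auto
  define h where "h = min d e / 2"
  have h: "0 < h" "h < d" "h < e"
    using \<open>d > 0\<close> e(1) by (auto simp: h_def)
  obtain z where z: "0 < z" "z < h" "g h - g 0 = (h - 0) * g' z"
    using MVT2[of 0 h g g'] g h by force
  have "g' z > 0" using e(2)[of z] z h g0 by simp
  hence "(h - 0) * g' z > 0" using h by simp
  hence "g h > g 0" using z by linarith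
  thus False using max[of h] h by simp
qed

text \<open>
The Laplacian of \<open>ln |z|\<close> is zero away from the origin: the two second derivatives are opposite.
This makes \<open>ln |z - p|\<close> a harmonic barrier on annuli around \<open>p\<close>.
\<close>

lemma ln_cmod_derivatives:
  fixes q :: complex
  assumes "q \<noteq> 0"
  shows "((\<lambda>t. ln (norm (q + of_real t))) has_real_derivative Re q / (norm q)\<^sup>2) (at 0)"
    and "((\<lambda>t. ln (norm (q + \<i> * of_real t))) has_real_derivative Im q / (norm q)\<^sup>2) (at 0)"
    and "((\<lambda>t. Re (q + of_real t) / (norm (q + of_real t))\<^sup>2) has_real_derivative
           ((Im q)\<^sup>2 - (Re q)\<^sup>2) / (norm q) ^ 4) (at 0)"
    and "((\<lambda>t. Im (q + \<i> * of_real t) / (norm (q + \<i> * of_real t))\<^sup>2) has_real_derivative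
           ((Re q)\<^sup>2 - (Im q)\<^sup>2) / (norm q) ^ 4) (at 0)"
proof -
  have pos: "(Re q)\<^sup>2 + (Im q)\<^sup>2 > 0"
    using assms by (simp add: complex_eq_iff sum_power2_gt_zero_iff)
  have n4: "norm q ^ 4 = ((Re q)\<^sup>2 + (Im q)\<^sup>2)\<^sup>2"
    by (simp add: cmod_def power4_eq_xxxx power2_eq_square)
  show "((\<lambda>t. ln (norm (q + of_real t))) has_real_derivative Re q / (norm q)\<^sup>2) (at 0)"
    unfolding cmod_def using pos
    by (auto intro!: derivative_eq_intros simp: divide_simps power2_eq_square)
  show "((\<lambda>t. ln (norm (q + \<i> * of_real t))) has_real_derivative Im q / (norm q)\<^sup>2) (at 0)"
    unfolding cmod_def using pos
    by (auto intro!: derivative_eq_intros simp: divide_simps power2_eq_square)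
  show "((\<lambda>t. Re (q + of_real t) / (norm (q + of_real t))\<^sup>2) has_real_derivative
           ((Im q)\<^sup>2 - (Re q)\<^sup>2) / (norm q) ^ 4) (at 0)"
    unfolding cmod_power2 n4 using pos
    by (auto intro!: derivative_eq_intros simp: divide_simps power2_eq_square)
  show "((\<lambda>t. Im (q + \<i> * of_real t) / (norm (q + \<i> * of_real t))\<^sup>2) has_real_derivative
           ((Re q)\<^sup>2 - (Im q)\<^sup>2) / (norm q) ^ 4) (at 0)"
    unfolding cmod_power2 n4 using pos
    by (auto intro!: derivative_eq_intros simp: divide_simps power2_eq_square)
qed

lemma second_directional_derivative_at_max:
  fixes w w1 :: "complex \<Rightarrow> real"
  assumes "open U" "p \<in> U" and max: "\<And>z. z \<in> U \<Longrightarrow> w z \<le> w p"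
    and w: "\<And>z. z \<in> U \<Longrightarrow> ((\<lambda>t. w (z + d * of_real t)) has_real_derivative w1 z) (at 0)"
    and w1: "((\<lambda>t. w1 (p + d * of_real t)) has_real_derivative c) (at 0)"
  shows "c \<le> 0"
proof -
  have "open ((\<lambda>t::real. p + d * of_real t) -` U)"
    by (intro open_vimage continuous_intros assms)
  moreover have "0 \<in> (\<lambda>t::real. p + d * of_real t) -` U" using \<open>p \<in> U\<close> by simp
  ultimately obtain e where e: "e > 0" "ball 0 e \<subseteq> (\<lambda>t::real. p + d * of_real t) -` U"
    using open_contains_ball by blast
  have inU: "p + d * of_real t \<in> U" if "\<bar>t\<bar> < e" for t :: real
    using e(2) that by (auto simp: dist_real_def)
  show ?thesis
  proof (rule second_derivative_at_local_max[OF e(1) _ _ w1, of "\<lambda>t. w (p + d * of_real t)"])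
    fix t :: real assume t: "\<bar>t\<bar> < e"
    show "w (p + d * of_real t) \<le> w (p + d * of_real 0)" using max[OF inU[OF t]] by simp
    have "((\<lambda>s. w (p + d * of_real t + d * of_real s)) has_real_derivative w1 (p + d * of_real t)) (at 0)"
      by (rule w[OF inU[OF t]])
    thus "((\<lambda>s. w (p + d * of_real s)) has_real_derivative w1 (p + d * of_real t)) (at t)"
      using DERIV_shift[of "\<lambda>s. w (p + d * of_real s)" _ 0 t] by (simp add: algebra_simps)
  qed
qed

text \<open>
The weak maximum principle with barriers. Subtracting \<open>\<epsilon> ln |z - p|\<close> does not change the Laplacian, and adding
\<open>\<delta> |z - p|\<^sup>2\<close> makes it strictly positive, so that the maximum over the closed annulus cannot be interior,
where both pure second derivatives would be at most zero.
\<close>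

lemma annulus_maximum:
  fixes v v1 v2 :: "complex \<Rightarrow> real"
  assumes cont: "continuous_on UNIV v"
    and v1: "\<And>z. ((\<lambda>t. v (z + of_real t)) has_real_derivative v1 z) (at 0)"
    and v2: "\<And>z. ((\<lambda>t. v (z + \<i> * of_real t)) has_real_derivative v2 z) (at 0)"
    and v11: "\<And>z. ((\<lambda>t. v1 (z + of_real t)) has_real_derivative v11 z) (at 0)"
    and v22: "\<And>z. ((\<lambda>t. v2 (z + \<i> * of_real t)) has_real_derivative v22 z) (at 0)"
    and lap: "\<And>z. v11 z + v22 z \<ge> 0"
    and "0 < \<rho>" "0 < \<delta>"
    and inner: "\<And>z. norm (z - p) = \<rho> \<Longrightarrow> v z \<le> M + \<epsilon> * ln \<rho>"
    and outer: "\<And>z. norm (z - p) = R \<Longrightarrow> v z \<le> M + \<epsilon> * ln R"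
    and z: "\<rho> \<le> norm (z - p)" "norm (z - p) \<le> R"
  shows "v z \<le> M + \<epsilon> * ln (norm (z - p)) + \<delta> * (R\<^sup>2 - (norm (z - p))\<^sup>2)"
proof -
  define w where "w = (\<lambda>z. v z - \<epsilon> * ln (norm (z - p)) + \<delta> * (norm (z - p))\<^sup>2)"
  define S where "S = {z. \<rho> \<le> norm (z - p) \<and> norm (z - p) \<le> R}"
  define U where "U = {z. \<rho> < norm (z - p) \<and> norm (z - p) < R}"
  have SR: "S = cball p R - ball p \<rho>"
    by (auto simp: S_def dist_norm norm_minus_commute)
  have "compact S" unfolding SR by (simp add: compact_diff)
  moreover have "S \<noteq> {}" using z by (auto simp: S_def)
  moreover have "continuous_on S w"
    unfolding w_def using \<open>0 < \<rho>\<close>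
    by (intro continuous_intros continuous_on_subset[OF cont]) (auto simp: S_def)
  ultimately obtain q where q: "q \<in> S" "\<And>y. y \<in> S \<Longrightarrow> w y \<le> w q"
    using continuous_attains_sup by metis
  have "open U" unfolding U_def by (intro open_Collect_conj open_Collect_less continuous_intros)
  have "q \<notin> U"
  proof
    assume "q \<in> U"
    hence q0: "q - p \<noteq> 0" using \<open>0 < \<rho>\<close> by (auto simp: U_def)
    have nz: "z - p \<noteq> 0" if "z \<in> U" for z using that \<open>0 < \<rho>\<close> by (auto simp: U_def)
    have shift: "z + x - p = z - p + x" for z x :: complex by simp
    define w1 where "w1 = (\<lambda>z. v1 z - \<epsilon> * (Re (z - p) / (norm (z - p))\<^sup>2) + \<delta> * (2 * Re (z - p)))"
    define w2 where "w2 = (\<lambda>z. v2 z - \<epsilon> * (Im (z - p) / (norm (z - p))\<^sup>2) + \<delta> * (2 * Im (z - p)))"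
    have 1: "v11 q - \<epsilon> * (((Im (q - p))\<^sup>2 - (Re (q - p))\<^sup>2) / (norm (q - p)) ^ 4) + \<delta> * 2 \<le> 0"
    proof (rule second_directional_derivative_at_max[OF \<open>open U\<close> \<open>q \<in> U\<close>, where d = 1 and w = w and ?w1.0 = w1])
      show "w z \<le> w q" if "z \<in> U" for z using q that by (auto simp: S_def U_def)
      show "((\<lambda>t. w (z + 1 * of_real t)) has_real_derivative w1 z) (at 0)" if "z \<in> U" for z
      proof -
        have "((\<lambda>t. (norm (z - p + of_real t))\<^sup>2) has_real_derivative 2 * Re (z - p)) (at 0)"
          unfolding cmod_power2 by (auto intro!: derivative_eq_intros)
        from DERIV_add[OF DERIV_diff[OF v1[of z] DERIV_cmult[OF ln_cmod_derivatives(1)[OF nz[OF that]]]] DERIV_cmult[OF this]]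
        show ?thesis unfolding w_def w1_def mult_1 shift .
      qed
      have "((\<lambda>t. 2 * Re (q - p + of_real t)) has_real_derivative 2) (at 0)"
        by (auto intro!: derivative_eq_intros)
      from DERIV_add[OF DERIV_diff[OF v11[of q] DERIV_cmult[OF ln_cmod_derivatives(3)[OF q0]]] DERIV_cmult[OF this]]
      show "((\<lambda>t. w1 (q + 1 * of_real t)) has_real_derivative
          v11 q - \<epsilon> * (((Im (q - p))\<^sup>2 - (Re (q - p))\<^sup>2) / (norm (q - p)) ^ 4) + \<delta> * 2) (at 0)"
        unfolding w1_def mult_1 shift .
    qed
    have 2: "v22 q - \<epsilon> * (((Re (q - p))\<^sup>2 - (Im (q - p))\<^sup>2) / (norm (q - p)) ^ 4) + \<delta> * 2 \<le> 0"
    proof (rule second_directional_derivative_at_max[OF \<open>open U\<close> \<open>q \<in> U\<close>, where d = "\<i>" and w = w and ?w1.0 = w2])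
      show "w z \<le> w q" if "z \<in> U" for z using q that by (auto simp: S_def U_def)
      show "((\<lambda>t. w (z + \<i> * of_real t)) has_real_derivative w2 z) (at 0)" if "z \<in> U" for z
      proof -
        have "((\<lambda>t. (norm (z - p + \<i> * of_real t))\<^sup>2) has_real_derivative 2 * Im (z - p)) (at 0)"
          unfolding cmod_power2 by (auto intro!: derivative_eq_intros)
        from DERIV_add[OF DERIV_diff[OF v2[of z] DERIV_cmult[OF ln_cmod_derivatives(2)[OF nz[OF that]]]] DERIV_cmult[OF this]]
        show ?thesis unfolding w_def w2_def mult_1 shift .
      qed
      have "((\<lambda>t. 2 * Im (q - p + \<i> * of_real t)) has_real_derivative 2) (at 0)"
        by (auto intro!: derivative_eq_intros)
      from DERIV_add[OF DERIV_diff[OF v22[of q] DERIV_cmult[OF ln_cmod_derivatives(4)[OF q0]]] DERIV_cmult[OF this]]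
      show "((\<lambda>t. w2 (q + \<i> * of_real t)) has_real_derivative
          v22 q - \<epsilon> * (((Re (q - p))\<^sup>2 - (Im (q - p))\<^sup>2) / (norm (q - p)) ^ 4) + \<delta> * 2) (at 0)"
        unfolding w2_def mult_1 shift .
    qed
    have "((Re (q - p))\<^sup>2 - (Im (q - p))\<^sup>2) / (norm (q - p)) ^ 4 = - (((Im (q - p))\<^sup>2 - (Re (q - p))\<^sup>2) / (norm (q - p)) ^ 4)"
      by (simp add: divide_simps)
    hence "\<epsilon> * (((Re (q - p))\<^sup>2 - (Im (q - p))\<^sup>2) / (norm (q - p)) ^ 4) = - (\<epsilon> * (((Im (q - p))\<^sup>2 - (Re (q - p))\<^sup>2) / (norm (q - p)) ^ 4))"
      by (metis mult_minus_right)
    with 1 2 lap[of q] \<open>0 < \<delta>\<close> show False by linarith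
  qed
  hence "norm (q - p) = \<rho> \<or> norm (q - p) = R" using q(1) by (auto simp: S_def U_def)
  hence "w q \<le> M + \<delta> * R\<^sup>2"
  proof
    assume "norm (q - p) = \<rho>"
    moreover have "\<delta> * \<rho>\<^sup>2 \<le> \<delta> * R\<^sup>2"
      using \<open>0 < \<delta>\<close> \<open>0 < \<rho>\<close> z by (intro mult_left_mono power_mono) auto
    ultimately show ?thesis using inner[of q] by (simp add: w_def)
  next
    assume "norm (q - p) = R"
    thus ?thesis using outer[of q] by (simp add: w_def)
  qed
  moreover have "w z \<le> w q" using q z by (simp add: S_def)
  ultimately show ?thesis by (simp add: w_def algebra_simps)
qed

text \<open>
Fix any centre \<open>p\<close>. On the annulus between a small circle of radius \<open>\<rho>\<close> and a large one, the barrier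
\<open>\<epsilon> ln |z - p|\<close> beats the function on the outer circle. Letting the outer radius grow and \<open>\<epsilon>\<close> shrink, the function
outside the small circle is bounded by its maximum on that circle. Letting \<open>\<rho>\<close> shrink
gives \<open>v z \<le> v p\<close>; as \<open>p\<close> is arbitrary, the roles can be exchanged.
\<close>

theorem sublogarithmic_subharmonic_constant:
  fixes v v1 v2 :: "complex \<Rightarrow> real"
  assumes cont: "continuous_on UNIV v"
    and v1: "\<And>z. ((\<lambda>t. v (z + of_real t)) has_real_derivative v1 z) (at 0)"
    and v2: "\<And>z. ((\<lambda>t. v (z + \<i> * of_real t)) has_real_derivative v2 z) (at 0)"
    and v11: "\<And>z. ((\<lambda>t. v1 (z + of_real t)) has_real_derivative v11 z) (at 0)"
    and v22: "\<And>z. ((\<lambda>t. v2 (z + \<i> * of_real t)) has_real_derivative v22 z) (at 0)"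
    and lap: "\<And>z. v11 z + v22 z \<ge> 0"
    and growth: "\<And>\<epsilon>. 0 < \<epsilon> \<Longrightarrow> eventually (\<lambda>z. v z \<le> \<epsilon> * ln (norm z)) at_infinity"
  shows "v z = v p"
proof -
  have *: "v z \<le> M" if "\<rho> > 0" and M: "\<And>z. norm (z - p) = \<rho> \<Longrightarrow> v z \<le> M" and z: "\<rho> \<le> norm (z - p)"
    for z p \<rho> M
  proof -
    have "v z \<le> M + \<epsilon> * (ln (norm (z - p)) - ln \<rho>)" if "\<epsilon> > 0" for \<epsilon>
    proof -
      obtain b where b: "\<And>z. norm z \<ge> b \<Longrightarrow> v z \<le> \<epsilon> / 2 * ln (norm z)"
        using growth[of "\<epsilon> / 2"] \<open>\<epsilon> > 0\<close> unfolding eventually_at_infinity by auto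
      have ev: "eventually (\<lambda>R. \<epsilon> / 2 * ln (2 * R) \<le> M - \<epsilon> * ln \<rho> + \<epsilon> * ln R) at_top"
        using \<open>\<epsilon> > 0\<close> by real_asymp
      obtain R where R: "R \<ge> norm (z - p)" "R \<ge> norm p + 1" "R \<ge> b + norm p"
        "\<epsilon> / 2 * ln (2 * R) \<le> M - \<epsilon> * ln \<rho> + \<epsilon> * ln R"
        using eventually_happens[OF eventually_conj[OF ev eventually_conj[OF eventually_ge_at_top[of "norm (z - p)"]
          eventually_conj[OF eventually_ge_at_top[of "norm p + 1"] eventually_ge_at_top[of "b + norm p"]]]]]
        by auto
      have out: "v y \<le> M - \<epsilon> * ln \<rho> + \<epsilon> * ln R" if y: "norm (y - p) = R" for y
      proof -
        have y1: "norm y \<ge> R - norm p" using norm_triangle_ineq4[of y p] y by simp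
        have y2: "norm y \<le> R + norm p" using norm_triangle_ineq[of "y - p" p] y by simp
        have "v y \<le> \<epsilon> / 2 * ln (norm y)" using b[of y] y1 R by simp
        also have "\<dots> \<le> \<epsilon> / 2 * ln (2 * R)"
          using y1 y2 R \<open>\<epsilon> > 0\<close> by (intro mult_left_mono) (auto intro!: ln_mono)
        finally show ?thesis using R by simp
      qed
      have "v z \<le> M - \<epsilon> * ln \<rho> + \<epsilon> * ln (norm (z - p)) + \<delta> * (R\<^sup>2 - (norm (z - p))\<^sup>2)" if "\<delta> > 0" for \<delta>
        using annulus_maximum[OF cont v1 v2 v11 v22 lap \<open>\<rho> > 0\<close> \<open>\<delta> > 0\<close>, where p = p and M = "M - \<epsilon> * ln \<rho>" and R = R and \<epsilon> = \<epsilon> and z = z]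
          M out z R by simp
      moreover have "((\<lambda>\<delta>. M - \<epsilon> * ln \<rho> + \<epsilon> * ln (norm (z - p)) + \<delta> * (R\<^sup>2 - (norm (z - p))\<^sup>2)) \<longlongrightarrow>
          M - \<epsilon> * ln \<rho> + \<epsilon> * ln (norm (z - p)) + 0 * (R\<^sup>2 - (norm (z - p))\<^sup>2)) (at_right 0)"
        by (intro tendsto_intros)
      ultimately have "v z \<le> M - \<epsilon> * ln \<rho> + \<epsilon> * ln (norm (z - p)) + 0 * (R\<^sup>2 - (norm (z - p))\<^sup>2)"
        by (intro tendsto_lowerbound) (auto simp: eventually_at_filter)
      thus ?thesis by (simp add: algebra_simps)
    qed
    moreover have "((\<lambda>\<epsilon>. M + \<epsilon> * (ln (norm (z - p)) - ln \<rho>)) \<longlongrightarrow> M + 0 * (ln (norm (z - p)) - ln \<rho>)) (at_right 0)"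
      by (intro tendsto_intros)
    ultimately have "v z \<le> M + 0 * (ln (norm (z - p)) - ln \<rho>)"
      by (intro tendsto_lowerbound) (auto simp: eventually_at_filter)
    thus ?thesis by simp
  qed
  have le: "v z \<le> v p" for z p
  proof (cases "z = p")
    case False
    show ?thesis
    proof (rule field_le_epsilon)
      fix e :: real assume "e > 0"
      have "isCont v p" using cont by (simp add: continuous_on_eq_continuous_at)
      then obtain d where d: "d > 0" "\<And>y. dist y p < d \<Longrightarrow> dist (v y) (v p) < e"
        using \<open>e > 0\<close> unfolding continuous_at_eps_delta by (metis dist_norm)
      define \<rho> where "\<rho> = min (d / 2) (norm (z - p))"
      have "\<rho> > 0" "\<rho> < d" "\<rho> \<le> norm (z - p)" using False d by (auto simp: \<rho>_def)
      moreover have "v y \<le> v p + e" if "norm (y - p) = \<rho>" for y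
      proof -
        have "\<bar>v y - v p\<bar> < e" using d(2)[of y] that \<open>\<rho> < d\<close> by (simp add: dist_norm)
        thus ?thesis by linarith
      qed
      ultimately show "v z \<le> v p + e" using *[where \<rho> = \<rho> and p = p and z = z and M = "v p + e"] by blast
    qed
  qed simp
  show ?thesis using le[of z p] le[of p z] by simp
qed

section \<open>Matrices as functions and positive definite forms\<close>

type_synonym cmat = "nat \<Rightarrow> nat \<Rightarrow> complex"

definition mm :: "nat \<Rightarrow> cmat \<Rightarrow> cmat \<Rightarrow> cmat" where
  "mm K X Y = (\<lambda>i j. \<Sum>k<K. X i k * Y k j)"

definition mtr :: "nat \<Rightarrow> cmat \<Rightarrow> complex" where
  "mtr K X = (\<Sum>i<K. X i i)"

definition ct :: "cmat \<Rightarrow> cmat" where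
  "ct X = (\<lambda>i j. cnj (X j i))"

definition ident_mat :: "nat \<Rightarrow> cmat" where
  "ident_mat K = (\<lambda>i j. if i = j \<and> i < K then 1 else 0)"

text \<open>
Matrices of size \<open>K\<close> are functions on all pairs of indices, where \<open>padded\<close> says that the entries outside the
block are zero. In this encoding associativity, distributivity and cyclicity of the trace hold without side
conditions, which suits the long trace computations below.
\<close>

definition padded :: "nat \<Rightarrow> cmat \<Rightarrow> bool" where
  "padded K X \<longleftrightarrow> (\<forall>i j. \<not> (i < K \<and> j < K) \<longrightarrow> X i j = 0)"

lemma mm_assoc: "mm K (mm K X Y) Z = mm K X (mm K Y Z)"
proof (intro ext)
  fix i j
  have "mm K (mm K X Y) Z i j = (\<Sum>k<K. \<Sum>l<K. X i l * (Y l k * Z k j))"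
    by (simp add: mm_def sum_distrib_right mult.assoc)
  also have "\<dots> = (\<Sum>l<K. \<Sum>k<K. X i l * (Y l k * Z k j))" by (rule sum.swap)
  finally show "mm K (mm K X Y) Z i j = mm K X (mm K Y Z) i j"
    by (simp add: mm_def sum_distrib_left)
qed

lemma mm_add_left: "mm K (X + Y) Z = mm K X Z + mm K Y Z"
  by (simp add: mm_def fun_eq_iff algebra_simps sum.distrib)

lemma mm_add_right: "mm K Z (X + Y) = mm K Z X + mm K Z Y"
  by (simp add: mm_def fun_eq_iff algebra_simps sum.distrib)

lemma mm_diff_left: "mm K (X - Y) Z = mm K X Z - mm K Y Z"
  by (simp add: mm_def fun_eq_iff algebra_simps sum_subtractf)

lemma mm_diff_right: "mm K Z (X - Y) = mm K Z X - mm K Z Y"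
  by (simp add: mm_def fun_eq_iff algebra_simps sum_subtractf)

lemma mm_uminus_left: "mm K (- X) Z = - mm K X Z"
  by (simp add: mm_def fun_eq_iff sum_negf)

lemmas mm_distribs = mm_add_left mm_add_right mm_diff_left mm_diff_right mm_uminus_left

lemma mtr_add: "mtr K (X + Y) = mtr K X + mtr K Y"
  by (simp add: mtr_def sum.distrib)

lemma mtr_diff: "mtr K (X - Y) = mtr K X - mtr K Y"
  by (simp add: mtr_def sum_subtractf)

lemma mtr_cyclic: "mtr K (mm K X Y) = mtr K (mm K Y X)"
  unfolding mtr_def mm_def by (subst sum.swap) (simp add: mult.commute)

lemma ct_ct [simp]: "ct (ct X) = X"
  by (simp add: ct_def)

lemma ct_mm: "ct (mm K X Y) = mm K (ct Y) (ct X)"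
  by (simp add: ct_def mm_def fun_eq_iff mult.commute)

lemma ct_diff: "ct (X - Y) = ct X - ct Y"
  by (simp add: ct_def fun_eq_iff)

lemma ct_one [simp]: "ct (ident_mat K) = ident_mat K"
  by (auto simp: ct_def ident_mat_def fun_eq_iff)

lemma mtr_ct: "mtr K (ct X) = cnj (mtr K X)"
  by (simp add: mtr_def ct_def)

lemma padded_ct [simp, intro]: "padded K X \<Longrightarrow> padded K (ct X)"
  unfolding padded_def ct_def by auto

lemma mm_one_left:
  assumes "padded K X"
  shows "mm K (ident_mat K) X = X"
proof (intro ext)
  fix i j
  show "mm K (ident_mat K) X i j = X i j"
  proof (cases "i < K")
    case True
    have "mm K (ident_mat K) X i j = (\<Sum>k<K. if k = i then X k j else 0)"
      unfolding mm_def ident_mat_def using True by (intro sum.cong) auto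
    thus ?thesis using True by simp
  next
    case False
    thus ?thesis using assms by (simp add: mm_def ident_mat_def padded_def)
  qed
qed

lemma mm_one_right: "padded K X \<Longrightarrow> mm K X (ident_mat K) = X"
  using mm_one_left[of K "ct X"] by (metis ct_ct ct_mm ct_one padded_ct)

lemma padded_mm [simp, intro]: "padded K X \<Longrightarrow> padded K Y \<Longrightarrow> padded K (mm K X Y)"
  unfolding padded_def mm_def by auto

lemma padded_diff [simp, intro]: "padded K X \<Longrightarrow> padded K Y \<Longrightarrow> padded K (X - Y)"
  unfolding padded_def by auto

lemma padded_one [simp, intro]: "padded K (ident_mat K)"
  unfolding padded_def ident_mat_def by auto

definition herm_pd :: "nat \<Rightarrow> cmat \<Rightarrow> bool" where
  "herm_pd K G \<longleftrightarrow> (\<forall>i<K. \<forall>j<K. G i j = cnj (G j i)) \<and>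
     (\<forall>x. (\<exists>i<K. x i \<noteq> 0) \<longrightarrow> 0 < Re (\<Sum>i<K. \<Sum>j<K. cnj (x i) * G i j * x j))"

lemma herm_pd_herm: "herm_pd K G \<Longrightarrow> i < K \<Longrightarrow> j < K \<Longrightarrow> G i j = cnj (G j i)"
  unfolding herm_pd_def by blast

lemma herm_pd_pos:
  "herm_pd K G \<Longrightarrow> i < K \<Longrightarrow> x i \<noteq> 0 \<Longrightarrow> 0 < Re (\<Sum>i<K. \<Sum>j<K. cnj (x i) * G i j * x j)"
  unfolding herm_pd_def by blast

lemma herm_pd_ct: "herm_pd K G \<Longrightarrow> padded K G \<Longrightarrow> ct G = G"
  unfolding herm_pd_def padded_def ct_def fun_eq_iff by (metis complex_cnj_zero)

lemma herm_pd_nonneg: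
  assumes "herm_pd K G"
  shows "0 \<le> Re (\<Sum>i<K. \<Sum>j<K. cnj (x i) * G i j * x j)"
proof (cases "\<exists>i<K. x i \<noteq> 0")
  case True
  then show ?thesis using herm_pd_pos[OF assms] by (meson less_imp_le)
next
  case False
  then show ?thesis by simp
qed

lemma herm_pd_diag:
  assumes "herm_pd K G" "i < K"
  shows "Re (G i i) > 0" "Im (G i i) = 0"
proof -
  define e where "e = (\<lambda>a. if a = i then 1 else 0 :: complex)"
  have "(\<Sum>c<K. cnj (e a) * G a c * e c) = (if a = i then G i i else 0)" for a
    using assms(2) by (simp add: e_def if_distrib[of "\<lambda>x. _ * x"] sum.delta cong: if_cong)
  hence "(\<Sum>a<K. \<Sum>c<K. cnj (e a) * G a c * e c) = G i i"
    using assms(2) by (simp add: sum.delta)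
  moreover have "e i \<noteq> 0" by (simp add: e_def)
  ultimately show "Re (G i i) > 0"
    using herm_pd_pos[OF assms, of e] by simp
  have "G i i = cnj (G i i)" using herm_pd_herm assms by blast
  hence "Im (G i i) = Im (cnj (G i i))" by (rule arg_cong)
  thus "Im (G i i) = 0" by simp
qed

text \<open>
Induction on the size, eliminating the last variable: the Schur complement
\<open>B\<^sub>i\<^sub>j - B\<^sub>i\<^sub>K B\<^sub>K\<^sub>j / B\<^sub>K\<^sub>K\<close> represents the form on the complement of the last basis vector that is orthogonal for the form.
\<close>

lemma cholesky:
  assumes "herm_pd K B"
  shows "\<exists>V. \<forall>i<K. \<forall>j<K. B i j = mm K V (ct V) i j"
  using assms
proof (induction K arbitrary: B)
  case 0
  then show ?case by simp
next
  case (Suc K)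
  define \<beta> where "\<beta> = Re (B K K)"
  have \<beta>: "\<beta> > 0" "B K K = of_real \<beta>"
    using herm_pd_diag[OF Suc.prems, of K] by (auto simp: \<beta>_def complex_eq_iff)
  have herm: "cnj (B i j) = B j i" if "i \<le> K" "j \<le> K" for i j
    by (rule herm_pd_herm[OF Suc.prems, symmetric]) (use that in auto)
  define B' where "B' = (\<lambda>i j. B i j - B i K * B K j / of_real \<beta>)"
  have "herm_pd K B'"
    unfolding herm_pd_def
  proof (intro conjI allI impI)
    fix i j assume "i < K" "j < K"
    thus "B' i j = cnj (B' j i)"
      unfolding B'_def by (simp add: herm mult.commute)
  next
    fix x :: "nat \<Rightarrow> complex" assume x: "\<exists>i<K. x i \<noteq> 0"
    define L where "L = (\<Sum>j<K. B K j * x j)"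
    \<comment> \<open>the value of the last variable that minimises the form when the others are given by \<open>x\<close>\<close>
    define y where "y = - L / of_real \<beta>"
    define x' where "x' = (\<lambda>j. if j < K then x j else y)"
    have L': "(\<Sum>i<K. cnj (x i) * B i K) = cnj L"
      unfolding L_def cnj_sum by (intro sum.cong) (auto simp: herm mult.commute)
    have "(\<Sum>i<Suc K. \<Sum>j<Suc K. cnj (x' i) * B i j * x' j) =
        (\<Sum>i<K. \<Sum>j<K. cnj (x i) * B i j * x j) + (\<Sum>i<K. cnj (x i) * B i K * y)
        + ((\<Sum>j<K. cnj y * B K j * x j) + cnj y * B K K * y)"
      by (simp add: x'_def sum.distrib)
    also have "(\<Sum>i<K. cnj (x i) * B i K * y) = cnj L * y"
      by (simp add: L'[symmetric] sum_distrib_right)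
    also have "(\<Sum>j<K. cnj y * B K j * x j) = cnj y * L"
      by (simp add: L_def sum_distrib_left mult.assoc)
    also have "(\<Sum>i<K. \<Sum>j<K. cnj (x i) * B i j * x j) + cnj L * y + (cnj y * L + cnj y * B K K * y)
        = (\<Sum>i<K. \<Sum>j<K. cnj (x i) * B i j * x j) - cnj L * L / of_real \<beta>"
      using \<beta> by (simp add: y_def field_simps)
    also have "cnj L * L = (\<Sum>i<K. cnj (x i) * B i K) * (\<Sum>j<K. B K j * x j)"
      by (simp only: L' L_def[symmetric])
    also have "\<dots> / of_real \<beta> = (\<Sum>i<K. \<Sum>j<K. (cnj (x i) * B i K) * (B K j * x j) / of_real \<beta>)"
      by (simp only: sum_product sum_divide_distrib)
    also have "(\<Sum>i<K. \<Sum>j<K. cnj (x i) * B i j * x j) - \<dots> = (\<Sum>i<K. \<Sum>j<K. cnj (x i) * B' i j * x j)"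
      unfolding B'_def sum_subtractf[symmetric]
      by (intro sum.cong refl) (simp add: right_diff_distrib left_diff_distrib mult.assoc)
    finally have "(\<Sum>i<K. \<Sum>j<K. cnj (x i) * B' i j * x j) = (\<Sum>i<Suc K. \<Sum>j<Suc K. cnj (x' i) * B i j * x' j)" by simp
    moreover obtain i where "i < Suc K" "x' i \<noteq> 0" using x unfolding x'_def by (metis less_SucI)
    ultimately show "0 < Re (\<Sum>i<K. \<Sum>j<K. cnj (x i) * B' i j * x j)"
      using herm_pd_pos[OF Suc.prems, of i x'] by simp
  qed
  from Suc.IH[OF this] obtain V where V: "\<And>i j. i < K \<Longrightarrow> j < K \<Longrightarrow> B' i j = mm K V (ct V) i j" by blast
  define W where "W = (\<lambda>i k. if k < K then (if i < K then V i k else 0) else B i K / of_real (sqrt \<beta>))"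
  have "B i j = mm (Suc K) W (ct W) i j" if "i < Suc K" "j < Suc K" for i j
  proof -
    have sq: "complex_of_real (sqrt \<beta>) * complex_of_real (sqrt \<beta>) = of_real \<beta>"
      using \<beta> by (simp flip: of_real_mult)
    have "mm (Suc K) W (ct W) i j = (\<Sum>k<K. W i k * cnj (W j k)) + W i K * cnj (W j K)"
      by (simp add: mm_def ct_def)
    also have "W i K * cnj (W j K) = B i K * B K j / of_real \<beta>"
      using that by (simp add: W_def herm sq)
    also have "(\<Sum>k<K. W i k * cnj (W j k)) = (if i < K \<and> j < K then B' i j else 0)"
    proof (cases "i < K \<and> j < K")
      case True
      thus ?thesis by (simp add: V W_def mm_def ct_def)
    next
      case False
      thus ?thesis by (auto simp: W_def)
    qed
    also have "(if i < K \<and> j < K then B' i j else 0) + B i K * B K j / of_real \<beta> = B i j"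
    proof (cases "i < K \<and> j < K")
      case False
      hence "i = K \<or> j = K" using that by auto
      thus ?thesis using False \<beta> by auto
    qed (simp add: B'_def)
    finally show ?thesis by simp
  qed
  thus ?case by blast
qed

lemma mtr_cong:
  assumes "\<And>i j. i < K \<Longrightarrow> j < K \<Longrightarrow> X i j = X' i j"
  shows "mtr K (mm K X Y) = mtr K (mm K X' Y)"
  unfolding mtr_def mm_def using assms by simp

text \<open>
With \<open>B = V V\<^sup>*\<close> the trace of \<open>B X\<^sup>* G X\<close> is the sum over the columns \<open>v\<close> of \<open>V\<close> of the numbers
\<open>(X v)\<^sup>* G (X v)\<close>. So \<open>(X, Y) \<mapsto> tr (B X\<^sup>* G Y)\<close> is an inner product on matrices when \<open>B\<close> is invertible.
\<close>

lemma trace_form: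
  assumes B: "herm_pd K B" and G: "herm_pd K G"
  shows "0 \<le> Re (mtr K (mm K B (mm K (ct X) (mm K G X))))"
    and "Re (mtr K (mm K B (mm K (ct X) (mm K G X)))) = 0 \<Longrightarrow> i < K \<Longrightarrow> j < K \<Longrightarrow> mm K X B i j = 0"
proof -
  from cholesky[OF B] obtain V where V: "\<And>i j. i < K \<Longrightarrow> j < K \<Longrightarrow> B i j = mm K V (ct V) i j" by blast
  define W where "W = mm K X V"
  define q where "q = (\<lambda>k. Re (\<Sum>i<K. \<Sum>j<K. cnj (W i k) * G i j * W j k))"
  have "mtr K (mm K B (mm K (ct X) (mm K G X))) = mtr K (mm K (mm K V (ct V)) (mm K (ct X) (mm K G X)))"
    by (rule mtr_cong) (rule V)
  also have "\<dots> = mtr K (mm K (ct W) (mm K G W))"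
    unfolding W_def ct_mm mm_assoc by (subst mtr_cyclic) (simp add: mm_assoc)
  finally have eq: "Re (mtr K (mm K B (mm K (ct X) (mm K G X)))) = (\<Sum>k<K. q k)"
    by (simp add: mtr_def mm_def q_def ct_def sum_distrib_left mult.assoc)
  have q0: "0 \<le> q k" for k
    unfolding q_def by (rule herm_pd_nonneg[OF G])
  show "0 \<le> Re (mtr K (mm K B (mm K (ct X) (mm K G X))))"
    unfolding eq by (intro sum_nonneg q0)
  assume "Re (mtr K (mm K B (mm K (ct X) (mm K G X)))) = 0" and ij: "i < K" "j < K"
  hence "(\<Sum>k<K. q k) = 0" using eq by simp
  hence qz: "q k = 0" if "k < K" for k
    using that sum_nonneg_eq_0_iff[of "{..<K}" q] q0 by auto
  have "W i k = 0" if "i < K" "k < K" for i k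
  proof (rule ccontr)
    assume W: "W i k \<noteq> 0"
    have "0 < q k" unfolding q_def by (rule herm_pd_pos[OF G that(1)]) (rule W)
    thus False using qz[OF that(2)] by simp
  qed
  moreover have "mm K X B i j = mm K W (ct V) i j"
  proof -
    have "mm K X B i j = mm K X (mm K V (ct V)) i j"
      unfolding mm_def[of K X] using V ij by simp
    thus ?thesis by (simp add: W_def mm_assoc)
  qed
  ultimately show "mm K X B i j = 0" using ij by (simp add: mm_def)
qed

text \<open>
The inverse \<open>B\<close> represents the same form on the dual side: \<open>x\<^sup>* B x = y\<^sup>* G y\<close> for \<open>y = B x\<close>.
\<close>

lemma herm_pd_inverse:
  assumes G: "herm_pd K G" and pad: "padded K G" "padded K B"
    and inv: "mm K B G = ident_mat K" "mm K G B = ident_mat K"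
  shows "herm_pd K B" "ct B = B"
proof -
  have ctG: "ct G = G" by (rule herm_pd_ct[OF G pad(1)])
  have "ct B = mm K (ct B) (mm K G B)"
    using pad by (simp add: inv mm_one_right)
  also have "\<dots> = mm K (ct (mm K G B)) B"
    by (simp add: ct_mm ctG mm_assoc)
  finally show ctB: "ct B = B" using pad by (simp add: inv mm_one_left)
  show "herm_pd K B"
    unfolding herm_pd_def
  proof (intro conjI allI impI)
    show "B i j = cnj (B j i)" for i j using fun_cong[OF fun_cong[OF ctB, of i], of j] by (simp add: ct_def)
    fix x :: "nat \<Rightarrow> complex" assume x: "\<exists>i<K. x i \<noteq> 0"
    define X where "X = (\<lambda>i j::nat. x i)"
    define Y where "Y = mm K B X"
    have Gy: "mm K G Y i 0 = x i" if "i < K" for i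
    proof -
      have "mm K G Y = mm K (ident_mat K) X" by (simp add: Y_def inv flip: mm_assoc)
      thus ?thesis using that by (simp add: X_def mm_def ident_mat_def if_distrib[of "\<lambda>x. x * _"] sum.delta cong: if_cong)
    qed
    have "\<exists>i<K. Y i 0 \<noteq> 0"
    proof (rule ccontr)
      assume "\<not> ?thesis"
      hence "mm K G Y i 0 = 0" for i by (simp add: mm_def)
      with Gy x show False by auto
    qed
    then obtain i where "i < K" "Y i 0 \<noteq> 0" by blast
    hence "0 < Re (\<Sum>i<K. \<Sum>j<K. cnj (Y i 0) * G i j * Y j 0)"
      using herm_pd_pos[OF G, of i "\<lambda>i. Y i 0"] by blast
    also have "(\<Sum>i<K. \<Sum>j<K. cnj (Y i 0) * G i j * Y j 0) = mm K (ct Y) (mm K G Y) 0 0"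
      by (simp add: mm_def ct_def sum_distrib_left mult.assoc)
    also have "\<dots> = mm K (ct Y) X 0 0"
      using Gy by (simp add: mm_def[of K "ct Y"] X_def)
    also have "\<dots> = mm K (ct X) (mm K B X) 0 0"
      by (simp add: Y_def ct_mm ctB mm_assoc)
    also have "\<dots> = (\<Sum>i<K. \<Sum>j<K. cnj (x i) * B i j * x j)"
      by (simp add: mm_def ct_def X_def sum_distrib_left mult.assoc)
    finally show "0 < Re (\<Sum>i<K. \<Sum>j<K. cnj (x i) * B i j * x j)" .
  qed
qed

section \<open>Rigidity of pairs of solutions of Hitchin's equation\<close>

text \<open>
The numbers \<open>a\<close> and \<open>b\<close> are the derivatives by \<open>z\<close> and by \<open>z\<^sup>-\<close>; stating both through the real derivative
gives uniqueness and the chain rule at once.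
\<close>

definition has_wirtinger :: "(complex \<Rightarrow> complex) \<Rightarrow> complex \<Rightarrow> complex \<Rightarrow> complex \<Rightarrow> bool" where
  "has_wirtinger f a b z \<longleftrightarrow> (f has_derivative (\<lambda>v. a * v + b * cnj v)) (at z)"

lemma has_wirtinger_const: "has_wirtinger (\<lambda>_. c) 0 0 z"
  by (simp add: has_wirtinger_def)

lemma has_wirtinger_mult:
  assumes "has_wirtinger f a b z" "has_wirtinger g c d z"
  shows "has_wirtinger (\<lambda>w. f w * g w) (a * g z + f z * c) (b * g z + f z * d) z"
  unfolding has_wirtinger_def
  by (rule has_derivative_eq_rhs[OF has_derivative_mult[OF assms[unfolded has_wirtinger_def]]])
     (simp add: algebra_simps)

lemma has_wirtinger_diff:
  assumes "has_wirtinger f a b z" "has_wirtinger g c d z"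
  shows "has_wirtinger (\<lambda>w. f w - g w) (a - c) (b - d) z"
  unfolding has_wirtinger_def
  by (rule has_derivative_eq_rhs[OF has_derivative_diff[OF assms[unfolded has_wirtinger_def]]])
     (simp add: algebra_simps)

lemma has_wirtinger_sum:
  assumes "\<And>k. k \<in> S \<Longrightarrow> has_wirtinger (f k) (a k) (b k) z"
  shows "has_wirtinger (\<lambda>w. \<Sum>k\<in>S. f k w) (\<Sum>k\<in>S. a k) (\<Sum>k\<in>S. b k) z"
  unfolding has_wirtinger_def
  by (rule has_derivative_eq_rhs[OF has_derivative_sum[OF assms[unfolded has_wirtinger_def]]])
     (simp_all add: sum_distrib_right sum.distrib)

lemma has_wirtinger_unique:
  assumes "has_wirtinger f a b z" "has_wirtinger f c d z"
  shows "a = c" "b = d"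
proof -
  have eq: "(\<lambda>v. a * v + b * cnj v) = (\<lambda>v. c * v + d * cnj v)"
    using assms unfolding has_wirtinger_def by (rule has_derivative_unique)
  have 1: "a + b = c + d" using fun_cong[OF eq, of 1] by simp
  have "a * \<i> - b * \<i> = c * \<i> - d * \<i>" using fun_cong[OF eq, of \<i>] by simp
  hence "(a - b) * \<i> = (c - d) * \<i>" by (simp add: algebra_simps)
  hence 2: "a - b = c - d" by simp
  have "2 * a = (a + b) + (a - b)" by simp
  also have "\<dots> = 2 * c" using 1 2 by simp
  finally show "a = c" by simp
  with 1 show "b = d" by simp
qed

lemma has_wirtinger_real_direction:
  assumes "has_wirtinger f a b z"
  shows "((\<lambda>t. Re (f (z + of_real t))) has_real_derivative Re (a + b)) (at 0)"
    and "((\<lambda>t. Im (f (z + of_real t))) has_real_derivative Im (a + b)) (at 0)"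
proof -
  have "((\<lambda>t::real. z + of_real t) has_derivative (\<lambda>t. of_real t)) (at 0)"
    by (auto intro!: derivative_eq_intros)
  hence *: "((\<lambda>t. f (z + of_real t)) has_derivative (\<lambda>t. a * of_real t + b * cnj (of_real t))) (at 0)"
    using has_derivative_compose[of "\<lambda>t::real. z + of_real t" of_real 0 UNIV f "\<lambda>v. a * v + b * cnj v"]
      assms unfolding has_wirtinger_def by simp
  show "((\<lambda>t. Re (f (z + of_real t))) has_real_derivative Re (a + b)) (at 0)"
    unfolding has_field_derivative_def
    by (rule has_derivative_eq_rhs[OF has_derivative_Re[OF *]]) (simp add: fun_eq_iff algebra_simps)
  show "((\<lambda>t. Im (f (z + of_real t))) has_real_derivative Im (a + b)) (at 0)"
    unfolding has_field_derivative_def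
    by (rule has_derivative_eq_rhs[OF has_derivative_Im[OF *]]) (simp add: fun_eq_iff algebra_simps)
qed

lemma has_wirtinger_imag_direction:
  assumes "has_wirtinger f a b z"
  shows "((\<lambda>t. Re (f (z + \<i> * of_real t))) has_real_derivative Im (b - a)) (at 0)"
    and "((\<lambda>t. Im (f (z + \<i> * of_real t))) has_real_derivative Re (a - b)) (at 0)"
proof -
  have "((\<lambda>t::real. z + \<i> * of_real t) has_derivative (\<lambda>t. \<i> * of_real t)) (at 0)"
    by (auto intro!: derivative_eq_intros)
  hence *: "((\<lambda>t. f (z + \<i> * of_real t)) has_derivative (\<lambda>t. a * (\<i> * of_real t) + b * cnj (\<i> * of_real t))) (at 0)"
    using has_derivative_compose[of "\<lambda>t::real. z + \<i> * of_real t" "\<lambda>t. \<i> * of_real t" 0 UNIV f "\<lambda>v. a * v + b * cnj v"]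
      assms unfolding has_wirtinger_def by simp
  show "((\<lambda>t. Re (f (z + \<i> * of_real t))) has_real_derivative Im (b - a)) (at 0)"
    unfolding has_field_derivative_def
    by (rule has_derivative_eq_rhs[OF has_derivative_Re[OF *]]) (simp add: fun_eq_iff algebra_simps)
  show "((\<lambda>t. Im (f (z + \<i> * of_real t))) has_real_derivative Re (a - b)) (at 0)"
    unfolding has_field_derivative_def
    by (rule has_derivative_eq_rhs[OF has_derivative_Im[OF *]]) (simp add: fun_eq_iff algebra_simps)
qed

definition has_mwirt :: "(complex \<Rightarrow> cmat) \<Rightarrow> cmat \<Rightarrow> cmat \<Rightarrow> complex \<Rightarrow> bool" where
  "has_mwirt M P Q z \<longleftrightarrow> (\<forall>i j. has_wirtinger (\<lambda>w. M w i j) (P i j) (Q i j) z)"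

lemma has_mwirt_mm:
  assumes "has_mwirt M P Q z" "has_mwirt M' P' Q' z"
  shows "has_mwirt (\<lambda>w. mm K (M w) (M' w)) (mm K P (M' z) + mm K (M z) P') (mm K Q (M' z) + mm K (M z) Q') z"
  unfolding has_mwirt_def
proof (intro allI)
  fix i j
  have "has_wirtinger (\<lambda>w. \<Sum>k<K. M w i k * M' w k j) (\<Sum>k<K. P i k * M' z k j + M z i k * P' k j)
      (\<Sum>k<K. Q i k * M' z k j + M z i k * Q' k j) z"
    using assms unfolding has_mwirt_def
    by (intro has_wirtinger_sum has_wirtinger_mult) auto
  thus "has_wirtinger (\<lambda>w. mm K (M w) (M' w) i j) ((mm K P (M' z) + mm K (M z) P') i j)
      ((mm K Q (M' z) + mm K (M z) Q') i j) z"
    by (simp add: mm_def sum.distrib)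
qed

lemma has_mwirt_diff:
  "has_mwirt M P Q z \<Longrightarrow> has_mwirt M' P' Q' z \<Longrightarrow> has_mwirt (\<lambda>w. M w - M' w) (P - P') (Q - Q') z"
  unfolding has_mwirt_def by (simp add: has_wirtinger_diff)

lemma has_wirtinger_mtr:
  "has_mwirt M P Q z \<Longrightarrow> has_wirtinger (\<lambda>w. mtr K (M w)) (mtr K P) (mtr K Q) z"
  unfolding has_mwirt_def mtr_def by (intro has_wirtinger_sum) auto

lemma has_mwirt_unique:
  assumes "has_mwirt M P Q z" "has_mwirt M P' Q' z"
  shows "P = P'" "Q = Q'"
  using assms has_wirtinger_unique unfolding has_mwirt_def by (auto simp: fun_eq_iff) blast+

lemma has_mwirt_padded:
  assumes "has_mwirt M P Q z" "\<And>w. padded K (M w)"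
  shows "padded K P" "padded K Q"
proof -
  have "P i j = 0 \<and> Q i j = 0" if "\<not> (i < K \<and> j < K)" for i j
  proof -
    have "(\<lambda>w. M w i j) = (\<lambda>_. 0)" using assms(2) that unfolding padded_def by blast
    hence "has_wirtinger (\<lambda>_. 0) (P i j) (Q i j) z"
      using assms(1) unfolding has_mwirt_def by metis
    thus ?thesis using has_wirtinger_unique[OF _ has_wirtinger_const] by blast
  qed
  thus "padded K P" "padded K Q" unfolding padded_def by blast+
qed

lemma has_mwirt_const: "has_mwirt (\<lambda>_. M) 0 0 z"
  by (simp add: has_mwirt_def has_wirtinger_const)

text \<open>
Hitchin's equation for the Higgs field \<open>\<Phi> dz\<close> in a holomorphic frame: \<open>G\<close> is the Gram matrix with inverse \<open>B\<close>,
\<open>A dz\<close> is the Chern connection form and \<open>\<Psi>\<close> is the \<open>G\<close>-adjoint of \<open>\<Phi>\<close>. Only first derivatives of \<open>G\<close>, \<open>B\<close> and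
\<open>A\<close> occur.
\<close>

locale hitchin_solution =
  fixes K :: nat and \<Phi> G B A \<Psi> :: "complex \<Rightarrow> cmat"
  assumes K_pos: "0 < K"
    and pad [simp]: "\<And>z. padded K (\<Phi> z)" "\<And>z. padded K (G z)" "\<And>z. padded K (B z)"
      "\<And>z. padded K (A z)" "\<And>z. padded K (\<Psi> z)"
    and pd: "\<And>z. herm_pd K (G z)"
    and inv: "\<And>z. mm K (B z) (G z) = ident_mat K" "\<And>z. mm K (G z) (B z) = ident_mat K"
    and dG: "\<And>z. has_mwirt G (mm K (G z) (A z)) (mm K (ct (A z)) (G z)) z"
    and dB_ex: "\<And>z. \<exists>P Q. has_mwirt B P Q z"
    and dA: "\<And>z. \<exists>P. has_mwirt A P (mm K (\<Phi> z) (\<Psi> z) - mm K (\<Psi> z) (\<Phi> z)) z"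
    and adj: "\<And>z. mm K (ct (\<Phi> z)) (G z) = mm K (G z) (\<Psi> z)"
begin

lemma ct_G [simp]: "ct (G z) = G z"
  by (rule herm_pd_ct[OF pd]) simp

lemma ct_B [simp]: "ct (B z) = B z"
  by (rule herm_pd_inverse(2)[OF pd _ _ inv]) simp_all

lemma pd_B: "herm_pd K (B z)"
  by (rule herm_pd_inverse(1)[OF pd _ _ inv]) simp_all

lemma cancel: "padded K X \<Longrightarrow> mm K (B z) (mm K (G z) X) = X"
   "padded K X \<Longrightarrow> mm K (G z) (mm K (B z) X) = X"
  by (simp_all add: inv mm_one_left flip: mm_assoc)

lemma Psi_eq: "\<Psi> z = mm K (B z) (mm K (ct (\<Phi> z)) (G z))"
  by (simp add: adj cancel)

lemma dB: "has_mwirt B (- mm K (A z) (B z)) (- mm K (B z) (ct (A z))) z"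
proof -
  obtain P Q where PQ: "has_mwirt B P Q z" using dB_ex by blast
  have padPQ: "padded K P" "padded K Q" by (rule has_mwirt_padded[OF PQ], simp)+
  have "has_mwirt (\<lambda>w. ident_mat K) (mm K P (G z) + mm K (B z) (mm K (G z) (A z)))
      (mm K Q (G z) + mm K (B z) (mm K (ct (A z)) (G z))) z"
    using has_mwirt_mm[OF PQ dG, of K] by (simp add: inv)
  from has_mwirt_unique[OF this has_mwirt_const]
  have "mm K P (G z) = - mm K (B z) (mm K (G z) (A z))"
    "mm K Q (G z) = - mm K (B z) (mm K (ct (A z)) (G z))"
    by (simp_all add: eq_neg_iff_add_eq_0)
  hence "mm K (mm K P (G z)) (B z) = - mm K (A z) (B z)"
    "mm K (mm K Q (G z)) (B z) = - mm K (B z) (ct (A z))"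
    by (simp_all add: mm_assoc cancel mm_uminus_left inv mm_one_right)
  hence "P = - mm K (A z) (B z)" "Q = - mm K (B z) (ct (A z))"
    by (simp_all add: mm_assoc inv mm_one_right padPQ)
  thus ?thesis using PQ by simp
qed

end

locale hitchin_pair =
  sol: hitchin_solution K \<Phi> G B A \<Psi> + sol': hitchin_solution K \<Phi> G' B' A' \<Psi>'
  for K \<Phi> G B A \<Psi> G' B' A' \<Psi>'
begin

definition "s z = mm K (B z) (G' z)"
definition "\<tau> z = Re (mtr K (s z))"
definition "Y z = A' z - A z"
definition "N z = mm K (\<Phi> z) (s z) - mm K (s z) (\<Phi> z)"
definition "p z = mtr K (mm K (s z) (Y z))"

lemma padded_s [simp]: "padded K (s z)" by (simp add: s_def)
lemma padded_Y [simp]: "padded K (Y z)" by (simp add: Y_def)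
lemma padded_N [simp]: "padded K (N z)" by (simp add: N_def)

lemma mtr_s: "mtr K (s z) = of_real (\<tau> z)"
proof -
  have "cnj (mtr K (s z)) = mtr K (s z)"
    unfolding mtr_ct[symmetric] s_def by (simp add: ct_mm mtr_cyclic)
  thus ?thesis by (simp add: \<tau>_def complex_eq_iff complex_cnj)
qed

lemma ds: "has_mwirt s (mm K (s z) (A' z) - mm K (A z) (s z)) (mm K (B z) (mm K (ct (Y z)) (G' z))) z"
proof -
  have "mm K (s z) (A' z) - mm K (A z) (s z) = mm K (- mm K (A z) (B z)) (G' z) + mm K (B z) (mm K (G' z) (A' z))"
    by (simp add: s_def mm_assoc mm_uminus_left)
  moreover have "mm K (B z) (mm K (ct (Y z)) (G' z)) =
      mm K (- mm K (B z) (ct (A z))) (G' z) + mm K (B z) (mm K (ct (A' z)) (G' z))"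
    by (simp add: Y_def ct_diff mm_assoc mm_distribs)
  ultimately show ?thesis
    using has_mwirt_mm[OF sol.dB sol'.dG, of K z] unfolding s_def by simp
qed

text \<open>
The form \<open>p = tr (s (A' - A))\<close> no longer contains derivatives, so it can be differentiated again without
second derivatives of the metrics; only the connection forms have to be differentiable.
\<close>

lemma dtr: "has_wirtinger (\<lambda>w. mtr K (s w)) (p z) (cnj (p z)) z"
proof -
  have "mtr K (mm K (s z) (A' z) - mm K (A z) (s z)) = p z"
    by (simp add: p_def Y_def mm_diff_right mtr_diff mtr_cyclic[of K "A z"])
  moreover have "mtr K (mm K (B z) (mm K (ct (Y z)) (G' z))) = cnj (p z)"
    unfolding p_def mtr_ct[symmetric]
    by (subst mtr_cyclic) (simp add: s_def ct_mm mm_assoc)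
  ultimately show ?thesis using has_wirtinger_mtr[OF ds, of K z] by simp
qed

text \<open>
The two squares in the Laplacian of \<open>tr s\<close>: the squared lengths of \<open>A' - A\<close> and of the commutator \<open>N = [\<Phi>, s]\<close> for suitable
inner products.
\<close>

definition "q z = mtr K (mm K (B z) (mm K (ct (Y z)) (mm K (G' z) (Y z))))"
definition "n z = mtr K (mm K (B' z) (mm K (ct (N z)) (mm K (G z) (N z))))"

text \<open>
The contribution of the Higgs field to the Laplacian of \<open>tr s\<close> is a square: writing \<open>\<Psi> = B \<Phi>\<^sup>* G\<close> and
\<open>\<Psi>' = B' \<Phi>\<^sup>* G'\<close>, both sides expand into the same four traces up to cyclic permutation.
\<close>

lemma commutator_term:
  "mtr K (mm K (s z) ((mm K (\<Phi> z) (\<Psi>' z) - mm K (\<Psi>' z) (\<Phi> z)) - (mm K (\<Phi> z) (\<Psi> z) - mm K (\<Psi> z) (\<Phi> z)))) = n z"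
proof -
  note c = sol.cancel sol'.cancel sol.inv sol'.inv mm_one_left mm_one_right
  let ?F = "\<Phi> z" let ?H = "ct (\<Phi> z)" let ?B = "B z" let ?C = "B' z" let ?G = "G z" let ?D = "G' z"
  let ?m = "mm K"
  have ctN: "ct (N z) = ?m ?D (?m ?B ?H) - ?m ?H (?m ?D ?B)"
    by (simp add: N_def s_def ct_diff ct_mm mm_assoc)
  have "n z = mtr K (?m ?B (?m ?H (?m ?G (?m ?F (?m ?B ?D))))) - mtr K (?m ?B (?m ?H (?m ?D ?F)))
      - (mtr K (?m ?C (?m ?H (?m ?D (?m ?F (?m ?B ?D))))) - mtr K (?m ?C (?m ?H (?m ?D (?m ?B (?m ?D ?F))))))"
    unfolding n_def ctN by (simp add: N_def s_def mm_distribs mm_assoc mtr_diff c)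
  also have "mtr K (?m ?B (?m ?H (?m ?G (?m ?F (?m ?B ?D))))) = mtr K (?m ?B (?m ?D (?m ?B (?m ?H (?m ?G ?F)))))"
    using mtr_cyclic[of K "?m ?B (?m ?H (?m ?G ?F))" "?m ?B ?D"] by (simp add: mm_assoc)
  also have "mtr K (?m ?C (?m ?H (?m ?D (?m ?F (?m ?B ?D))))) = mtr K (?m ?B (?m ?D (?m ?F (?m ?B (?m ?H ?G)))))"
  proof -
    have "mtr K (?m ?C (?m ?H (?m ?D (?m ?F (?m ?B ?D))))) = mtr K (?m (?m ?H (?m ?D (?m ?F ?B))) (?m ?D ?C))"
      using mtr_cyclic[of K "?m ?C (?m ?H (?m ?D (?m ?F ?B)))" "?D"] mtr_cyclic[of K "?m ?D ?C" "?m ?H (?m ?D (?m ?F ?B))"]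
      by (simp add: mm_assoc)
    also have "\<dots> = mtr K (?m ?H (?m ?D (?m ?F ?B)))" by (simp add: c mm_assoc)
    also have "\<dots> = mtr K (?m ?G (?m ?B (?m ?D (?m ?F (?m ?B ?H)))))"
      using mtr_cyclic[of K ?H "?m ?D (?m ?F ?B)"] by (simp add: c mm_assoc)
    also have "\<dots> = mtr K (?m ?B (?m ?D (?m ?F (?m ?B (?m ?H ?G)))))"
      by (subst mtr_cyclic) (simp add: mm_assoc)
    finally show ?thesis .
  qed
  also have "mtr K (?m ?C (?m ?H (?m ?D (?m ?B (?m ?D ?F))))) = mtr K (?m ?B (?m ?D (?m ?F (?m ?C (?m ?H ?D)))))"
    using mtr_cyclic[of K "?m ?C (?m ?H ?D)" "?m ?B (?m ?D ?F)"] by (simp add: mm_assoc)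
  finally have n_eq: "n z = mtr K (?m ?B (?m ?D (?m ?B (?m ?H (?m ?G ?F))))) - mtr K (?m ?B (?m ?H (?m ?D ?F)))
      - (mtr K (?m ?B (?m ?D (?m ?F (?m ?B (?m ?H ?G))))) - mtr K (?m ?B (?m ?D (?m ?F (?m ?C (?m ?H ?D))))))" .
  show ?thesis
    unfolding n_eq sol.Psi_eq sol'.Psi_eq s_def
    by (simp add: mm_distribs mm_assoc mtr_diff c)
qed


lemma Re_q_nonneg: "0 \<le> Re (q z)"
  unfolding q_def by (rule trace_form(1)[OF sol.pd_B sol'.pd])

lemma Re_n_nonneg: "0 \<le> Re (n z)"
  unfolding n_def by (rule trace_form(1)[OF sol'.pd_B sol.pd])

text \<open>
This is the Weitzenboeck type formula: the \<open>z\<^sup>-\<close>-derivative of \<open>p\<close>, which is a quarter of the Laplacian of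
\<open>tr s\<close>, is the sum of the two squares \<open>q\<close> and \<open>n\<close>.
\<close>

lemma dp: "\<exists>P. has_wirtinger p P (q z + n z) z"
proof -
  obtain P where P: "has_mwirt A P (mm K (\<Phi> z) (\<Psi> z) - mm K (\<Psi> z) (\<Phi> z)) z"
    using sol.dA by blast
  obtain P' where P': "has_mwirt A' P' (mm K (\<Phi> z) (\<Psi>' z) - mm K (\<Psi>' z) (\<Phi> z)) z"
    using sol'.dA by blast
  have "has_mwirt Y (P' - P) ((mm K (\<Phi> z) (\<Psi>' z) - mm K (\<Psi>' z) (\<Phi> z)) - (mm K (\<Phi> z) (\<Psi> z) - mm K (\<Psi> z) (\<Phi> z))) z"
    using has_mwirt_diff[OF P' P] unfolding Y_def .
  from has_wirtinger_mtr[OF has_mwirt_mm[OF ds this, of K], of K]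
  show ?thesis
    unfolding p_def mtr_add commutator_term by (auto simp: q_def mm_assoc)
qed

lemma tau_pos: "\<tau> z > 0"
proof -
  have eq: "mtr K (mm K (B z) (mm K (ct (ident_mat K)) (mm K (G' z) (ident_mat K)))) = mtr K (s z)"
    by (simp add: s_def mm_one_left mm_one_right)
  have "0 \<le> \<tau> z"
    using trace_form(1)[OF sol.pd_B[of z] sol'.pd[of z], of "ident_mat K"] unfolding eq \<tau>_def .
  moreover have "\<tau> z \<noteq> 0"
  proof
    assume "\<tau> z = 0"
    hence "B z i j = 0" if "i < K" "j < K" for i j
      using trace_form(2)[OF sol.pd_B[of z] sol'.pd[of z], of "ident_mat K" i j] that
      unfolding eq \<tau>_def by (simp add: mm_one_left)
    hence "mm K (B z) (G z) i i = 0" if "i < K" for i using that by (simp add: mm_def)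
    thus False using sol.K_pos sol.inv(1)[of z] by (auto simp: ident_mat_def)
  qed
  ultimately show ?thesis by simp
qed

text \<open>
The Cauchy-Schwarz inequality for the inner product \<open>tr (B X\<^sup>* G' Y)\<close> and the matrices \<open>1\<close> and \<open>A' - A\<close>,
whose products are \<open>\<tau>\<close>, \<open>p\<close> and \<open>q\<close>. It is what makes the logarithm of \<open>\<tau>\<close>, and not just \<open>\<tau>\<close>,
subharmonic.
\<close>

lemma cauchy_schwarz: "(norm (p z))\<^sup>2 \<le> Re (q z) * \<tau> z"
proof -
  define c where "c = p z / of_real (\<tau> z)"
  \<comment> \<open>subtract from \<open>Y = A' - A\<close> its projection \<open>c\<close> to the scalar matrices\<close>
  define J where "J = (\<lambda>i j. c * ident_mat K i j)"
  have JL: "mm K J X = (\<lambda>i j. c * X i j)" if "padded K X" for X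
    using mm_one_left[OF that] by (simp add: J_def mm_def sum_distrib_left[symmetric] mult.assoc fun_eq_iff)
  have cJL: "mm K (ct J) X = (\<lambda>i j. cnj c * X i j)" if "padded K X" for X
  proof -
    have "ct J = (\<lambda>i j. cnj c * ident_mat K i j)" by (auto simp: J_def ct_def ident_mat_def fun_eq_iff)
    thus ?thesis
      using mm_one_left[OF that] by (simp add: mm_def sum_distrib_left[symmetric] mult.assoc fun_eq_iff)
  qed
  have RJ: "mm K X J = (\<lambda>i j. c * X i j)" if "padded K X" for X
    using mm_one_right[OF that] by (simp add: J_def mm_def sum_distrib_left[symmetric] mult.left_commute fun_eq_iff)
  have sc: "mm K X (\<lambda>i j. d * Z i j) = (\<lambda>i j. d * mm K X Z i j)" for X Z d
    by (simp add: mm_def sum_distrib_left mult.left_commute)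
  have tsc: "mtr K (\<lambda>i j. d * Z i j) = d * mtr K Z" for Z d
    by (simp add: mtr_def sum_distrib_left)
  have cp: "mtr K (mm K (B z) (mm K (ct (Y z)) (G' z))) = cnj (p z)"
    unfolding p_def mtr_ct[symmetric]
    by (subst mtr_cyclic) (simp add: s_def ct_mm mm_assoc)
  have "mtr K (mm K (B z) (mm K (ct (Y z - J)) (mm K (G' z) (Y z - J)))) =
     q z - c * cnj (p z) - (cnj c * p z - cnj c * (c * of_real (\<tau> z)))"
    by (simp add: ct_diff mm_distribs mtr_diff RJ cJL sc tsc q_def cp p_def mtr_s[unfolded s_def] s_def mm_assoc)
  also have "\<dots> = q z - of_real ((norm (p z))\<^sup>2 / \<tau> z)"
    using tau_pos[of z] by (simp add: c_def divide_simps complex_norm_square[symmetric] power2_eq_square)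
  finally have "0 \<le> Re (q z) - (norm (p z))\<^sup>2 / \<tau> z"
    using trace_form(1)[OF sol.pd_B[of z] sol'.pd[of z], of "Y z - J"] by simp
  thus ?thesis using tau_pos[of z] by (simp add: divide_simps)
qed

lemma tau_constant:
  assumes growth: "\<And>\<epsilon>. 0 < \<epsilon> \<Longrightarrow> eventually (\<lambda>z. \<tau> z \<le> norm z powr \<epsilon>) at_infinity"
  shows "\<tau> z = \<tau> w"
proof -
  define P where "P = (\<lambda>z. SOME P. has_wirtinger p P (q z + n z) z)"
  have P: "has_wirtinger p (P z) (q z + n z) z" for z
    unfolding P_def using dp by (rule someI_ex)
  have tau1: "((\<lambda>t. \<tau> (z + of_real t)) has_real_derivative 2 * Re (p z)) (at 0)" for z
    using has_wirtinger_real_direction(1)[OF dtr, of z] by (simp add: \<tau>_def)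
  have tau2: "((\<lambda>t. \<tau> (z + \<i> * of_real t)) has_real_derivative - 2 * Im (p z)) (at 0)" for z
    using has_wirtinger_imag_direction(1)[OF dtr, of z] by (simp add: \<tau>_def)
  define v1 where "v1 = (\<lambda>z. 2 * Re (p z) / \<tau> z)"
  define v2 where "v2 = (\<lambda>z. - 2 * Im (p z) / \<tau> z)"
  define v11 where "v11 = (\<lambda>z. (2 * Re (P z + (q z + n z)) * \<tau> z - 2 * Re (p z) * (2 * Re (p z))) / (\<tau> z * \<tau> z))"
  define v22 where "v22 = (\<lambda>z. (- 2 * Re (P z - (q z + n z)) * \<tau> z - (- 2 * Im (p z)) * (- 2 * Im (p z))) / (\<tau> z * \<tau> z))"
  have "ln (\<tau> z) = ln (\<tau> w)"
  proof (rule sublogarithmic_subharmonic_constant[of "\<lambda>z. ln (\<tau> z)" v1 v2 v11 v22])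
    have "continuous_on UNIV (\<lambda>w. mtr K (s w))"
      using dtr unfolding has_wirtinger_def
      by (meson continuous_at_imp_continuous_on has_derivative_continuous)
    hence "continuous_on UNIV \<tau>" unfolding \<tau>_def by (rule continuous_on_Re)
    thus "continuous_on UNIV (\<lambda>z. ln (\<tau> z))"
      using tau_pos by (intro continuous_on_ln) (auto simp: less_imp_neq[THEN not_sym])
    show "((\<lambda>t. ln (\<tau> (z + of_real t))) has_real_derivative v1 z) (at 0)" for z
      using tau_pos[of z] unfolding v1_def by (auto intro!: derivative_eq_intros tau1 simp: divide_simps)
    show "((\<lambda>t. ln (\<tau> (z + \<i> * of_real t))) has_real_derivative v2 z) (at 0)" for z
      using tau_pos[of z] unfolding v2_def by (auto intro!: derivative_eq_intros tau2 simp: divide_simps)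
    show "((\<lambda>t. v1 (z + of_real t)) has_real_derivative v11 z) (at 0)" for z
      using DERIV_divide[OF DERIV_cmult[OF has_wirtinger_real_direction(1)[OF P, of z], of 2] tau1] tau_pos[of z]
      unfolding v1_def v11_def by simp
    show "((\<lambda>t. v2 (z + \<i> * of_real t)) has_real_derivative v22 z) (at 0)" for z
      using DERIV_divide[OF DERIV_cmult[OF has_wirtinger_imag_direction(2)[OF P, of z], of "-2"] tau2] tau_pos[of z]
      unfolding v2_def v22_def by simp
    show "0 \<le> v11 z + v22 z" for z
    proof -
      have "v11 z + v22 z = 4 * (Re (q z) * \<tau> z + Re (n z) * \<tau> z - (norm (p z))\<^sup>2) / (\<tau> z * \<tau> z)"
        unfolding v11_def v22_def cmod_power2 by (simp add: add_divide_distrib[symmetric] algebra_simps power2_eq_square)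
      moreover have "0 \<le> Re (n z) * \<tau> z" using Re_n_nonneg tau_pos[of z] by simp
      ultimately show ?thesis
        using cauchy_schwarz[of z] tau_pos[of z] by simp
    qed
    show "eventually (\<lambda>z. ln (\<tau> z) \<le> \<epsilon> * ln (norm z)) at_infinity" if "0 < \<epsilon>" for \<epsilon>
    proof -
      have "eventually (\<lambda>z::complex. norm z \<ge> 1) at_infinity"
        unfolding eventually_at_infinity by blast
      with growth[OF that] show ?thesis
      proof eventually_elim
        case (elim z)
        hence "ln (\<tau> z) \<le> ln (norm z powr \<epsilon>)" using tau_pos[of z] by (intro ln_mono) auto
        also have "\<dots> = \<epsilon> * ln (norm z)" using elim by (simp add: ln_powr)
        finally show ?case .
      qed
    qed
  qed
  thus ?thesis using tau_pos[of z] tau_pos[of w] by simp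
qed

text \<open>
Since \<open>\<tau>\<close> is constant, its derivatives \<open>p\<close> and \<open>q + n\<close> vanish, hence so do \<open>q\<close> and \<open>n\<close> separately. The first
gives \<open>A = A'\<close>, which makes \<open>s\<close> holomorphic, the second that \<open>s\<close> commutes with \<open>\<Phi>\<close>.
\<close>

lemma rigidity:
  assumes growth: "\<And>\<epsilon>. 0 < \<epsilon> \<Longrightarrow> eventually (\<lambda>z. \<tau> z \<le> norm z powr \<epsilon>) at_infinity"
  shows "mm K (\<Phi> z) (s z) = mm K (s z) (\<Phi> z)"
    and "(\<lambda>w. s w i j) holomorphic_on UNIV"
proof -
  have p0: "p z = 0" for z
  proof -
    have "(\<lambda>w. mtr K (s w)) = (\<lambda>w. of_real (\<tau> 0))"
      using tau_constant[OF growth] by (metis mtr_s)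
    with dtr[of z] have "has_wirtinger (\<lambda>w. of_real (\<tau> 0)) (p z) (cnj (p z)) z" by simp
    from has_wirtinger_unique(1)[OF this has_wirtinger_const] show ?thesis .
  qed
  have qn: "q z + n z = 0" for z
  proof -
    obtain P where P: "has_wirtinger p P (q z + n z) z" using dp by blast
    have "p = (\<lambda>w. 0)" using p0 by blast
    with P have "has_wirtinger (\<lambda>w. 0) P (q z + n z) z" by simp
    from has_wirtinger_unique(2)[OF this has_wirtinger_const] show ?thesis .
  qed
  have "Re (q z) = 0 \<and> Re (n z) = 0" for z
  proof -
    have "Re (q z) + Re (n z) = 0" using arg_cong[OF qn[of z], of Re] by simp
    thus ?thesis using Re_q_nonneg[of z] Re_n_nonneg[of z] by linarith
  qed
  hence q0: "Re (q z) = 0" and n0: "Re (n z) = 0" for z by auto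
  have padded_zeroI: "X = 0" if "padded K X" "\<And>i j. i < K \<Longrightarrow> j < K \<Longrightarrow> X i j = 0" for X
    using that unfolding padded_def fun_eq_iff zero_fun_def by metis
  have "mm K (Y z) (B z) = 0" for z
    using trace_form(2)[OF sol.pd_B sol'.pd q0[unfolded q_def]] by (intro padded_zeroI) auto
  hence "mm K (mm K (Y z) (B z)) (G z) = 0" for z by (simp add: mm_def fun_eq_iff)
  hence Y0: "Y z = 0" for z by (simp add: mm_assoc sol.inv mm_one_right)
  have "mm K (N z) (B' z) = 0" for z
    using trace_form(2)[OF sol'.pd_B sol.pd n0[unfolded n_def]] by (intro padded_zeroI) auto
  hence "mm K (mm K (N z) (B' z)) (G' z) = 0" for z by (simp add: mm_def fun_eq_iff)
  hence N0: "N z = 0" for z by (simp add: mm_assoc sol'.inv mm_one_right)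
  thus "mm K (\<Phi> z) (s z) = mm K (s z) (\<Phi> z)" by (simp add: N_def)
  have "mm K (B z) (mm K (ct (Y z)) (G' z)) = 0" for z
    using Y0[of z] by (simp add: mm_def ct_def fun_eq_iff)
  hence "has_wirtinger (\<lambda>w. s w i j) ((mm K (s z) (A' z) - mm K (A z) (s z)) i j) 0 z" for z
    using ds[of z] unfolding has_mwirt_def by (metis zero_fun_apply)
  hence "((\<lambda>w. s w i j) has_field_derivative (mm K (s z) (A' z) - mm K (A z) (s z)) i j) (at z)" for z
    unfolding has_wirtinger_def has_field_derivative_def by simp
  thus "(\<lambda>w. s w i j) holomorphic_on UNIV"
    by (metis holomorphic_onI field_differentiable_at_within field_differentiable_def)
qed

end

section \<open>Decay of solutions of the cyclic Toda system\<close>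

text \<open>
With \<open>p = f' + m f\<close> the hypothesis says that \<open>p e\<^sup>-\<^sup>m\<^sup>t\<close> is nondecreasing. If it were positive somewhere, then \<open>f\<close>
would grow at least like \<open>e\<^sup>m\<^sup>t\<close>, against the quadratic bound; so \<open>p \<le> 0\<close>, which means that \<open>f e\<^sup>m\<^sup>t\<close> is nonincreasing.
\<close>

lemma exponential_decay:
  fixes f f' f'' :: "real \<Rightarrow> real"
  assumes f': "\<And>t. t \<ge> t0 \<Longrightarrow> (f has_real_derivative f' t) (at t)"
    and f'': "\<And>t. t \<ge> t0 \<Longrightarrow> (f' has_real_derivative f'' t) (at t)"
    and ineq: "\<And>t. t \<ge> t0 \<Longrightarrow> m\<^sup>2 * f t \<le> f'' t"
    and m: "m > 0"
    and growth: "eventually (\<lambda>t. f t \<le> C * t\<^sup>2) at_top"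
    and t: "t \<ge> t0"
  shows "f t \<le> f t0 * exp (m * t0) * exp (- m * t)"
proof -
  define p where "p = (\<lambda>t. (f' t + m * f t) * exp (- m * t))"
  have dp: "(p has_real_derivative (f'' t - m\<^sup>2 * f t) * exp (- m * t)) (at t)" if "t \<ge> t0" for t
    unfolding p_def using that
    by (auto intro!: derivative_eq_intros f' f'' simp: algebra_simps power2_eq_square)
  have mono_p: "p t1 \<le> p t" if "t0 \<le> t1" "t1 \<le> t" for t1 t
  proof (rule DERIV_nonneg_imp_nondecreasing[OF that(2)])
    fix x assume x: "t1 \<le> x" "x \<le> t"
    have "0 \<le> (f'' x - m\<^sup>2 * f x) * exp (- m * x)" using ineq[of x] x that by simp
    thus "\<exists>y. (p has_real_derivative y) (at x) \<and> 0 \<le> y" using dp[of x] x that by (meson order_trans)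
  qed
  have p_nonpos: "p t1 \<le> 0" if t1: "t1 \<ge> t0" for t1
  proof (rule ccontr)
    assume "\<not> p t1 \<le> 0"
    hence pos: "p t1 > 0" by simp
    define a where "a = p t1"
    \<comment> \<open>\<open>f e\<^sup>m\<^sup>t\<close> minus a primitive of the lower bound \<open>a e\<^sup>2\<^sup>m\<^sup>t\<close> for its derivative\<close>
    define h where "h = (\<lambda>t. f t * exp (m * t) - a * exp (2 * m * t) / (2 * m))"
    have dh: "(h has_real_derivative (p t - a) * exp (2 * m * t)) (at t)" if "t \<ge> t0" for t
    proof -
      have e: "exp (- (m * t)) * exp (2 * m * t) = exp (m * t)" by (simp flip: exp_add)
      have "(h has_real_derivative f' t * exp (m * t) + f t * (exp (m * t) * m) - a * exp (2 * m * t)) (at t)"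
        unfolding h_def using that m
        by (auto intro!: derivative_eq_intros f' simp: field_simps)
      moreover have "f' t * exp (m * t) + f t * (exp (m * t) * m) - a * exp (2 * m * t) = (p t - a) * exp (2 * m * t)"
        using e by (simp add: p_def algebra_simps)
      ultimately show ?thesis by simp
    qed
    have "h t1 \<le> h t" if "t1 \<le> t" for t
    proof (rule DERIV_nonneg_imp_nondecreasing[OF that])
      fix x assume x: "t1 \<le> x" "x \<le> t"
      have "0 \<le> (p x - a) * exp (2 * m * x)" using mono_p[OF t1 x(1)] by (simp add: a_def)
      thus "\<exists>y. (h has_real_derivative y) (at x) \<and> 0 \<le> y" using dh[of x] x t1 by (meson order_trans)
    qed
    hence "eventually (\<lambda>t. h t1 \<le> h t) at_top"
      unfolding eventually_at_top_linorder by blast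
    moreover have "eventually (\<lambda>t. C * t\<^sup>2 * exp (m * t) < h t1 + a * exp (2 * m * t) / (2 * m)) at_top"
      using m pos unfolding a_def[symmetric] by real_asymp
    ultimately have "eventually (\<lambda>t::real. False) at_top"
      using growth
    proof eventually_elim
      case (elim t)
      have "f t * exp (m * t) \<le> C * t\<^sup>2 * exp (m * t)" using elim by simp
      with elim(1,2) show ?case by (simp add: h_def)
    qed
    thus False by simp
  qed
  have "f t * exp (m * t) \<le> f t0 * exp (m * t0)"
  proof (rule DERIV_nonpos_imp_nonincreasing[OF t, of "\<lambda>t. f t * exp (m * t)"])
    fix x assume x: "t0 \<le> x" "x \<le> t"
    have e: "exp (- (m * x)) * exp (2 * m * x) = exp (m * x)" by (simp flip: exp_add)
    have "((\<lambda>t. f t * exp (m * t)) has_real_derivative f' x * exp (m * x) + f x * (exp (m * x) * m)) (at x)"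
      using x by (auto intro!: derivative_eq_intros f')
    moreover have "f' x * exp (m * x) + f x * (exp (m * x) * m) = p x * exp (2 * m * x)"
      using e by (simp add: p_def algebra_simps)
    moreover have "p x * exp (2 * m * x) \<le> 0" using p_nonpos[OF x(1)] by (simp add: mult_nonpos_nonneg)
    ultimately show "\<exists>y. ((\<lambda>t. f t * exp (m * t)) has_real_derivative y) (at x) \<and> y \<le> 0" by metis
  qed
  hence "f t * exp (m * t) * exp (- m * t) \<le> f t0 * exp (m * t0) * exp (- m * t)"
    by (intro mult_right_mono) auto
  thus ?thesis by (simp add: mult.assoc flip: exp_add)
qed

lemma cyclic_pred_succ:
  fixes i K :: nat
  assumes "i < K"
  shows "((i + 1) mod K + K - 1) mod K = i" "((i + K - 1) mod K + 1) mod K = i"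
proof -
  show "((i + 1) mod K + K - 1) mod K = i"
    by (cases "i + 1 = K") (use assms in auto)
  show "((i + K - 1) mod K + 1) mod K = i"
    by (cases i) (use assms in auto)
qed

lemma sum_cyclic_shift:
  fixes g :: "nat \<Rightarrow> 'a::comm_monoid_add"
  shows "(\<Sum>i<K. g ((i + 1) mod K)) = (\<Sum>i<K. g i)"
  by (rule sum.reindex_bij_witness[of _ "\<lambda>i. (i + K - 1) mod K" "\<lambda>i. (i + 1) mod K"])
     (auto simp: cyclic_pred_succ simp del: One_nat_def add_Suc_right)

lemma abs_exp_minus_one_le:
  fixes x :: real
  assumes "\<bar>x\<bar> \<le> 1 / 2"
  shows "\<bar>exp x - 1\<bar> \<le> 2 * \<bar>x\<bar>"
proof -
  have "norm (exp x) \<le> 1 + 2 * norm x" by (rule exp_bound_lemma) (use assms in simp)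
  hence "exp x \<le> 1 + 2 * \<bar>x\<bar>" by simp
  moreover have "1 + x \<le> exp x" by (rule exp_ge_add_one_self)
  ultimately show ?thesis by linarith
qed

text \<open>
Since the cyclic differences \<open>d\<^sub>i\<close> sum to zero, \<open>d\<^sub>i e\<^bsup>d\<^sub>i\<^esup>\<close> may be replaced by
\<open>d\<^sub>i (e\<^bsup>d\<^sub>i\<^esup> - 1)\<close>, which is nonnegative, and at least \<open>d\<^sub>i\<^sup>2\<close> when \<open>d\<^sub>i \<ge> 0\<close>. The sum \<open>S\<close> of the positive parts bounds every
\<open>|d\<^sub>i|\<close>, hence, by chaining and because the \<open>w\<^sub>i\<close> sum to zero, every \<open>|w\<^sub>i|\<close>. The estimate is uniform in the size of the
\<open>w\<^sub>i\<close>, which matters because solutions of the Toda system are at first only known to be \<open>o(t)\<close>.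
\<close>

lemma cyclic_exp_energy:
  fixes w :: "nat \<Rightarrow> real"
  assumes K: "K > 0" and sum0: "(\<Sum>i<K. w i) = 0"
  defines "d \<equiv> \<lambda>i. w i - w ((i + 1) mod K)"
  shows "(\<Sum>i<K. (w i)\<^sup>2) \<le> 4 * real K ^ 4 * (\<Sum>i<K. d i * exp (d i))"
proof -
  define D where "D = (\<lambda>i. max (d i) 0)"
  define S where "S = (\<Sum>i<K. D i)"
  have sumd: "(\<Sum>i<K. d i) = 0"
    unfolding d_def sum_subtractf sum_cyclic_shift[of w] by simp
  have D_le: "D i \<le> S" if "i < K" for i
    unfolding S_def using that by (intro member_le_sum) (auto simp: D_def)
  have d_abs: "\<bar>d i\<bar> \<le> S" if "i < K" for i
  proof -
    have "d i + (\<Sum>j\<in>{..<K} - {i}. d j) = 0" using sumd that by (simp flip: sum.remove)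
    moreover have "(\<Sum>j\<in>{..<K} - {i}. d j) \<le> (\<Sum>j\<in>{..<K} - {i}. D j)"
      by (intro sum_mono) (simp add: D_def)
    moreover have "(\<Sum>j\<in>{..<K} - {i}. D j) \<le> S"
      unfolding S_def by (intro sum_mono2) (auto simp: D_def)
    ultimately have "- d i \<le> S" by linarith
    moreover have "d i \<le> S" using D_le[OF that] by (simp add: D_def)
    ultimately show ?thesis by linarith
  qed
  have S0: "0 \<le> S" unfolding S_def by (intro sum_nonneg) (simp add: D_def)
  have chain: "\<bar>w n - w 0\<bar> \<le> real n * S" if "n < K" for n
    using that
  proof (induction n)
    case (Suc n)
    have "\<bar>w n - w (Suc n)\<bar> \<le> S" using d_abs[of n] Suc.prems by (simp add: d_def)
    moreover have "\<bar>w n - w 0\<bar> \<le> real n * S" using Suc by simp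
    ultimately show ?case by (simp add: algebra_simps)
  qed simp
  have chain': "\<bar>w n - w 0\<bar> \<le> real K * S" if "n < K" for n
  proof -
    have "real n * S \<le> real K * S" using that S0 by (intro mult_right_mono) auto
    with chain[OF that] show ?thesis by linarith
  qed
  have "real K * \<bar>w 0\<bar> = \<bar>\<Sum>n<K. w n - w 0\<bar>"
    by (simp add: sum_subtractf sum0 abs_mult)
  also have "\<dots> \<le> (\<Sum>n<K. \<bar>w n - w 0\<bar>)" by (rule sum_abs)
  also have "\<dots> \<le> (\<Sum>n<K. real K * S)" by (intro sum_mono chain') auto
  finally have "real K * \<bar>w 0\<bar> \<le> real K * (real K * S)" by simp
  hence w0: "\<bar>w 0\<bar> \<le> real K * S" using K by simp
  have wn: "(w n)\<^sup>2 \<le> (2 * real K * S)\<^sup>2" if "n < K" for n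
  proof -
    have "\<bar>w n\<bar> \<le> 2 * real K * S" using chain'[OF that] w0 by linarith
    thus ?thesis by (metis abs_le_square_iff abs_ge_self order_trans)
  qed
  have "S\<^sup>2 \<le> (\<Sum>i<K. (D i)\<^sup>2) * real K"
    using Cauchy_Schwarz_ineq_sum[of D "\<lambda>_. 1" "{..<K}"] by (simp add: S_def)
  moreover have "(\<Sum>i<K. (D i)\<^sup>2) \<le> (\<Sum>i<K. d i * (exp (d i) - 1))"
  proof (intro sum_mono)
    fix i
    show "(D i)\<^sup>2 \<le> d i * (exp (d i) - 1)"
    proof (cases "d i \<ge> 0")
      case True
      have "d i * d i \<le> d i * (exp (d i) - 1)"
        using True exp_ge_add_one_self[of "d i"] by (intro mult_left_mono) linarith+
      thus ?thesis using True by (simp add: D_def power2_eq_square)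
    next
      case False
      hence "exp (d i) \<le> 1" by simp
      thus ?thesis using False by (simp add: D_def mult_nonpos_nonpos)
    qed
  qed
  moreover have "(\<Sum>i<K. d i * (exp (d i) - 1)) = (\<Sum>i<K. d i * exp (d i))"
    by (simp add: right_diff_distrib sum_subtractf sumd)
  ultimately have S2: "S\<^sup>2 \<le> (\<Sum>i<K. d i * exp (d i)) * real K"
    by (smt (verit) mult_right_mono of_nat_0_le_iff)
  have "(\<Sum>i<K. (w i)\<^sup>2) \<le> (\<Sum>i<K. (2 * real K * S)\<^sup>2)" by (intro sum_mono wn) auto
  also have "\<dots> = 4 * real K ^ 3 * S\<^sup>2" by (simp add: power_mult_distrib power3_eq_cube power2_eq_square)
  also have "\<dots> \<le> 4 * real K ^ 3 * ((\<Sum>i<K. d i * exp (d i)) * real K)"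
    using S2 by (intro mult_left_mono) auto
  also have "\<dots> = 4 * real K ^ 4 * (\<Sum>i<K. d i * exp (d i))" by (simp add: power3_eq_cube power4_eq_xxxx)
  finally show ?thesis .
qed

text \<open>
Over the interval from \<open>t\<close> to \<open>t + 1\<close> the mean value theorem gives a point where \<open>w'\<close> is the small increment of \<open>w\<close>, and
\<open>w'\<close> changes little over that interval because \<open>w''\<close> is small.
\<close>

lemma derivative_tendsto_zero:
  fixes w w' w'' :: "real \<Rightarrow> real"
  assumes w': "\<And>t. (w has_real_derivative w' t) (at t)"
    and w'': "\<And>t. (w' has_real_derivative w'' t) (at t)"
    and lim: "(w \<longlongrightarrow> 0) at_top" "(w'' \<longlongrightarrow> 0) at_top"
  shows "(w' \<longlongrightarrow> 0) at_top"
proof (rule tendstoI)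
  fix e :: real assume "e > 0"
  hence e3: "e / 3 > 0" by simp
  obtain T1 where T1: "\<And>t. t \<ge> T1 \<Longrightarrow> \<bar>w t\<bar> < e / 3"
    using tendstoD[OF lim(1) e3] unfolding eventually_at_top_linorder by (auto simp: dist_real_def)
  obtain T2 where T2: "\<And>t. t \<ge> T2 \<Longrightarrow> \<bar>w'' t\<bar> < e / 3"
    using tendstoD[OF lim(2) e3] unfolding eventually_at_top_linorder by (auto simp: dist_real_def)
  have "\<bar>w' t\<bar> < e" if t: "t \<ge> max T1 T2" for t
  proof -
    obtain x where x: "t < x" "x < t + 1" "w (t + 1) - w t = (t + 1 - t) * w' x"
      using MVT2[of t "t + 1" w w'] w' by auto
    obtain y where y: "t < y" "y < x" "w' x - w' t = (x - t) * w'' y"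
      using MVT2[of t x w' w''] w'' x by auto
    have "\<bar>(x - t) * w'' y\<bar> \<le> 1 * \<bar>w'' y\<bar>"
      unfolding abs_mult using x by (intro mult_right_mono) auto
    moreover have "\<bar>w'' y\<bar> < e / 3" using T2[of y] y t by simp
    moreover have "\<bar>w (t + 1)\<bar> < e / 3" "\<bar>w t\<bar> < e / 3" using T1 t by auto
    ultimately show ?thesis using x(3) y(3) by simp
  qed
  thus "eventually (\<lambda>t. dist (w' t) 0 < e) at_top"
    unfolding eventually_at_top_linorder by (intro exI[of _ "max T1 T2"]) (simp add: dist_real_def)
qed

lemma exp_times_exp_minus_one_tendsto_zero:
  fixes d :: "real \<Rightarrow> real"
  assumes "c > 0" "((\<lambda>t. exp (c * t) * d t) \<longlongrightarrow> 0) at_top"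
  shows "((\<lambda>t. exp (c * t) * (exp (d t) - 1)) \<longlongrightarrow> 0) at_top"
proof (rule Lim_null_comparison)
  have "((\<lambda>t. exp (- c * t) * (exp (c * t) * d t)) \<longlongrightarrow> 0 * 0) at_top"
    by (intro tendsto_mult assms(2)) (use assms(1) in real_asymp)
  hence "(d \<longlongrightarrow> 0) at_top" by (simp add: mult.assoc[symmetric] flip: exp_add)
  hence "eventually (\<lambda>t. dist (d t) 0 < 1 / 2) at_top" by (rule tendstoD) simp
  thus "eventually (\<lambda>t. norm (exp (c * t) * (exp (d t) - 1)) \<le> 2 * \<bar>exp (c * t) * d t\<bar>) at_top"
  proof eventually_elim
    case (elim t)
    have "\<bar>exp (d t) - 1\<bar> \<le> 2 * \<bar>d t\<bar>" by (rule abs_exp_minus_one_le) (use elim in simp)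
    hence "exp (c * t) * \<bar>exp (d t) - 1\<bar> \<le> exp (c * t) * (2 * \<bar>d t\<bar>)" by (intro mult_left_mono) auto
    thus ?case by (simp add: abs_mult)
  qed
  show "((\<lambda>t. 2 * \<bar>exp (c * t) * d t\<bar>) \<longlongrightarrow> 0) at_top"
    using tendsto_mult_left[OF tendsto_rabs[OF assms(2)], of 2] by simp
qed

text \<open>
The Toda system in the variable \<open>t = ln r\<close>. The energy \<open>f = \<Sum> w\<^sub>i\<^sup>2\<close> satisfies
\<open>f'' \<ge> 2 \<Sum> w\<^sub>i w\<^sub>i'' = 8 e\<^sup>c\<^sup>t \<Sum> d\<^sub>i e\<^bsup>d\<^sub>i\<^esup>\<close> with \<open>d\<^sub>i = w\<^sub>i - w\<^sub>i\<^sub>+\<^sub>1\<close>, hence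
\<open>f'' \<ge> m\<^sup>2 f\<close> eventually, for every \<open>m\<close>.
\<close>

lemma toda_decay:
  fixes w w' w'' :: "nat \<Rightarrow> real \<Rightarrow> real"
  assumes K: "K > 0" and c: "c > 0"
    and w': "\<And>i t. i < K \<Longrightarrow> (w i has_real_derivative w' i t) (at t)"
    and w'': "\<And>i t. i < K \<Longrightarrow> (w' i has_real_derivative w'' i t) (at t)"
    and toda: "\<And>i t. i < K \<Longrightarrow> w'' i t = 4 * exp (c * t) *
        (exp (w i t - w ((i + 1) mod K) t) - exp (w ((i + K - 1) mod K) t - w i t))"
    and sum0: "\<And>t. (\<Sum>i<K. w i t) = 0"
    and growth: "\<And>i. i < K \<Longrightarrow> eventually (\<lambda>t. \<bar>w i t\<bar> \<le> t) at_top"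
    and i: "i < K"
  shows "((\<lambda>t. exp (m * t) * w i t) \<longlongrightarrow> 0) at_top" and "(w' i \<longlongrightarrow> 0) at_top"
proof -
  define f where "f = (\<lambda>t. \<Sum>i<K. (w i t)\<^sup>2)"
  define f' where "f' = (\<lambda>t. \<Sum>i<K. 2 * w i t * w' i t)"
  define f'' where "f'' = (\<lambda>t. \<Sum>i<K. 2 * (w' i t * w' i t + w i t * w'' i t))"
  have df: "(f has_real_derivative f' t) (at t)" for t
    unfolding f_def f'_def by (intro DERIV_sum) (auto intro!: derivative_eq_intros w')
  have df': "(f' has_real_derivative f'' t) (at t)" for t
    unfolding f'_def f''_def by (intro DERIV_sum) (auto intro!: derivative_eq_intros w' w'' simp: algebra_simps)
  have f''_ge: "2 * exp (c * t) / real K ^ 4 * f t \<le> f'' t" for t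
  proof -
    define d where "d = (\<lambda>i. w i t - w ((i + 1) mod K) t)"
    have "(\<Sum>i<K. w i t * exp (w ((i + K - 1) mod K) t - w i t)) = (\<Sum>i<K. w ((i + 1) mod K) t * exp (d i))"
      unfolding sum_cyclic_shift[of "\<lambda>i. w i t * exp (w ((i + K - 1) mod K) t - w i t)", symmetric] d_def
      by (intro sum.cong) (simp_all add: cyclic_pred_succ del: One_nat_def add_Suc_right)
    hence "(\<Sum>i<K. w i t * (exp (d i) - exp (w ((i + K - 1) mod K) t - w i t))) = (\<Sum>i<K. d i * exp (d i))"
      by (simp add: d_def right_diff_distrib left_diff_distrib sum_subtractf)
    moreover have "(\<Sum>i<K. w i t * w'' i t) = 4 * exp (c * t) * (\<Sum>i<K. w i t * (exp (d i) - exp (w ((i + K - 1) mod K) t - w i t)))"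
      unfolding sum_distrib_left d_def by (intro sum.cong) (simp_all add: toda mult.left_commute)
    ultimately have 1: "(\<Sum>i<K. w i t * w'' i t) = 4 * exp (c * t) * (\<Sum>i<K. d i * exp (d i))" by simp
    have "f t / (4 * real K ^ 4) \<le> (\<Sum>i<K. d i * exp (d i))"
      using cyclic_exp_energy[OF K, of "\<lambda>i. w i t"] sum0 K unfolding f_def d_def
      by (simp add: divide_simps mult.commute)
    hence "4 * exp (c * t) * (f t / (4 * real K ^ 4)) \<le> (\<Sum>i<K. w i t * w'' i t)"
      unfolding 1 by (intro mult_left_mono) auto
    moreover have "0 \<le> (\<Sum>i<K. w' i t * w' i t)" by (intro sum_nonneg) auto
    moreover have "f'' t = 2 * ((\<Sum>i<K. w' i t * w' i t) + (\<Sum>i<K. w i t * w'' i t))"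
      by (simp add: f''_def sum.distrib flip: sum_distrib_left)
    ultimately show ?thesis by simp
  qed
  have f_growth: "eventually (\<lambda>t. f t \<le> real K * t\<^sup>2) at_top"
  proof -
    have "eventually (\<lambda>t. \<forall>i<K. \<bar>w i t\<bar> \<le> t) at_top"
      using eventually_ball_finite[of "{..<K}" "\<lambda>t i. \<bar>w i t\<bar> \<le> t" at_top] growth
      by (simp add: lessThan_def)
    thus ?thesis
    proof eventually_elim
      case (elim t)
      have "f t \<le> (\<Sum>i<K. t\<^sup>2)"
        unfolding f_def
      proof (intro sum_mono)
        fix i assume "i \<in> {..<K}"
        hence "\<bar>w i t\<bar> \<le> t" using elim by simp
        thus "(w i t)\<^sup>2 \<le> t\<^sup>2" by (metis abs_le_square_iff abs_ge_self order_trans)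
      qed
      thus ?case by simp
    qed
  qed
  have f_nonneg: "0 \<le> f t" for t unfolding f_def by (intro sum_nonneg) simp
  have decay: "\<exists>C. eventually (\<lambda>t. f t \<le> C * exp (- m * t)) at_top" if m: "m > 0" for m
  proof -
    have "eventually (\<lambda>t. m\<^sup>2 \<le> 2 * exp (c * t) / real K ^ 4) at_top"
      using c K by real_asymp
    then obtain t0 where t0: "\<And>t. t \<ge> t0 \<Longrightarrow> m\<^sup>2 \<le> 2 * exp (c * t) / real K ^ 4"
      unfolding eventually_at_top_linorder by blast
    have "m\<^sup>2 * f t \<le> f'' t" if "t \<ge> t0" for t
      using mult_right_mono[OF t0[OF that] f_nonneg[of t]] f''_ge[of t] by linarith
    hence "f t \<le> f t0 * exp (m * t0) * exp (- m * t)" if "t \<ge> t0" for t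
      using exponential_decay[OF df df' _ m f_growth that] by blast
    thus ?thesis unfolding eventually_at_top_linorder by blast
  qed
  have lim: "((\<lambda>t. exp (m * t) * w i t) \<longlongrightarrow> 0) at_top" if i: "i < K" for m i
  proof -
    \<comment> \<open>any rate above \<open>m\<close>; the energy must decay at twice the rate, being quadratic in \<open>w\<close>\<close>
    define k where "k = \<bar>m\<bar> + 1"
    obtain C where C: "eventually (\<lambda>t. f t \<le> C * exp (- (2 * k) * t)) at_top"
      using decay[of "2 * k"] unfolding k_def by fastforce
    have "((\<lambda>t. (exp (m * t) * w i t)\<^sup>2) \<longlongrightarrow> 0) at_top"
    proof (rule Lim_null_comparison)
      show "eventually (\<lambda>t. norm ((exp (m * t) * w i t)\<^sup>2) \<le> C * exp ((2 * m - 2 * k) * t)) at_top"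
        using C
      proof eventually_elim
        case (elim t)
        have "(w i t)\<^sup>2 \<le> f t" unfolding f_def using i by (intro member_le_sum) auto
        hence "(exp (m * t))\<^sup>2 * (w i t)\<^sup>2 \<le> (exp (m * t))\<^sup>2 * (C * exp (- (2 * k) * t))"
          using elim by (intro mult_left_mono) auto
        also have "\<dots> = C * exp ((2 * m - 2 * k) * t)"
          by (simp add: power2_eq_square algebra_simps flip: exp_add)
        finally show ?case by (simp add: power_mult_distrib)
      qed
      have "2 * m - 2 * k < 0" by (simp add: k_def)
      thus "((\<lambda>t. C * exp ((2 * m - 2 * k) * t)) \<longlongrightarrow> 0) at_top"
        by real_asymp
    qed
    thus ?thesis by (simp add: power_tendsto_0_iff)
  qed
  show "((\<lambda>t. exp (m * t) * w i t) \<longlongrightarrow> 0) at_top" by (rule lim[OF i])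
  have lim_d: "((\<lambda>t. exp (c * t) * (exp (w i t - w j t) - 1)) \<longlongrightarrow> 0) at_top" if "i < K" "j < K" for i j
  proof (rule exp_times_exp_minus_one_tendsto_zero[OF c])
    show "((\<lambda>t. exp (c * t) * (w i t - w j t)) \<longlongrightarrow> 0) at_top"
      using tendsto_diff[OF lim[OF that(1), of c] lim[OF that(2), of c]] by (simp add: right_diff_distrib)
  qed
  show "(w' i \<longlongrightarrow> 0) at_top"
  proof (rule derivative_tendsto_zero[OF w'[OF i] w''[OF i]])
    show "(w i \<longlongrightarrow> 0) at_top" using lim[OF i, of 0] by simp
    have "(i + 1) mod K < K" "(i + K - 1) mod K < K" using K by auto
    hence "((\<lambda>t. 4 * (exp (c * t) * (exp (w i t - w ((i + 1) mod K) t) - 1)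
        - exp (c * t) * (exp (w ((i + K - 1) mod K) t - w i t) - 1))) \<longlongrightarrow> 4 * (0 - 0)) at_top"
      by (intro tendsto_intros lim_d i)
    moreover have "w'' i = (\<lambda>t. 4 * (exp (c * t) * (exp (w i t - w ((i + 1) mod K) t) - 1)
        - exp (c * t) * (exp (w ((i + K - 1) mod K) t - w i t) - 1)))"
      using toda[OF i] by (intro ext) (simp add: right_diff_distrib)
    ultimately show "(w'' i \<longlongrightarrow> 0) at_top" by (simp only: diff_self mult_zero_right)
  qed
qed

section \<open>The commutant of the cyclic Higgs field\<close>

lemma holomorphic_zero_off_origin:
  fixes f :: "complex \<Rightarrow> complex"
  assumes "f holomorphic_on UNIV" "\<And>z. z \<noteq> 0 \<Longrightarrow> f z = 0"
  shows "f z = 0"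
proof -
  have "isCont f 0"
    using holomorphic_on_imp_continuous_on[OF assms(1)] by (simp add: continuous_on_eq_continuous_at)
  hence "(f \<longlongrightarrow> f 0) (at 0)" by (simp add: isCont_def)
  moreover have "(f \<longlongrightarrow> 0) (at 0)"
    by (rule tendsto_eventually) (simp add: eventually_at_filter assms(2))
  ultimately have "f 0 = 0" by (rule tendsto_unique[OF trivial_limit_at])
  thus ?thesis using assms(2) by (cases "z = 0") auto
qed

lemma powr_neg_tendsto_zero_at_infinity:
  assumes "d < 0"
  shows "((\<lambda>z::complex. norm z powr d) \<longlongrightarrow> 0) at_infinity"
proof -
  have "((\<lambda>x::real. x powr d) \<longlongrightarrow> 0) at_top" using assms by real_asymp
  thus ?thesis
    by (rule filterlim_compose) (rule filterlim_norm_at_top)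
qed

lemma eventually_mult_powr_le:
  assumes "0 < \<epsilon>"
  shows "eventually (\<lambda>z::complex. C * norm z powr a \<le> norm z powr (a + \<epsilon>)) at_infinity"
proof -
  have "eventually (\<lambda>x::real. C \<le> x powr \<epsilon>) at_top" using assms by real_asymp
  hence "eventually (\<lambda>z::complex. C \<le> norm z powr \<epsilon>) at_infinity"
    by (rule eventually_compose_filterlim) (rule filterlim_norm_at_top)
  thus ?thesis
    by eventually_elim (metis mult.commute mult_left_mono powr_add powr_ge_zero)
qed

text \<open>
The weights \<open>\<gamma>\<close> of the inner index cancel in the product; the losses \<open>\<epsilon>\<close> are arbitrary, which absorbs constants.
\<close>

lemma growth_mm:
  assumes X: "\<And>k \<epsilon>. k < K \<Longrightarrow> 0 < \<epsilon> \<Longrightarrow> eventually (\<lambda>z. norm (X z i k) \<le> norm z powr (a + \<gamma> k + \<epsilon>)) at_infinity"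
    and Y: "\<And>k \<epsilon>. k < K \<Longrightarrow> 0 < \<epsilon> \<Longrightarrow> eventually (\<lambda>z. norm (Y z k j) \<le> norm z powr (c - \<gamma> k + \<epsilon>)) at_infinity"
    and e: "0 < \<epsilon>"
  shows "eventually (\<lambda>z::complex. norm (mm K (X z) (Y z) i j) \<le> norm z powr (a + c + \<epsilon>)) at_infinity"
proof -
  have e3: "0 < \<epsilon> / 3" using e by simp
  have "eventually (\<lambda>z. \<forall>k\<in>{..<K}. norm (X z i k) \<le> norm z powr (a + \<gamma> k + \<epsilon> / 3) \<and>
      norm (Y z k j) \<le> norm z powr (c - \<gamma> k + \<epsilon> / 3)) at_infinity"
    using X[OF _ e3] Y[OF _ e3] by (intro eventually_ball_finite) (auto intro: eventually_conj)
  moreover have "eventually (\<lambda>z::complex. real K * norm z powr (a + c + 2 * \<epsilon> / 3) \<le> norm z powr (a + c + \<epsilon>)) at_infinity"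
    using eventually_mult_powr_le[OF e3, of "real K" "a + c + 2 * \<epsilon> / 3"] by (simp add: algebra_simps)
  ultimately show ?thesis
  proof eventually_elim
    case (elim z)
    have "norm (mm K (X z) (Y z) i j) \<le> (\<Sum>k<K. norm (X z i k * Y z k j))"
      unfolding mm_def by (rule norm_sum)
    also have "\<dots> \<le> (\<Sum>k<K. norm z powr (a + c + 2 * \<epsilon> / 3))"
    proof (intro sum_mono)
      fix k assume "k \<in> {..<K}"
      hence "norm (X z i k * Y z k j) \<le> norm z powr (a + \<gamma> k + \<epsilon> / 3) * norm z powr (c - \<gamma> k + \<epsilon> / 3)"
        unfolding norm_mult using elim(1) by (intro mult_mono) auto
      also have "\<dots> = norm z powr (a + c + 2 * \<epsilon> / 3)" 
      proof -
        have "(a + \<gamma> k + \<epsilon> / 3) + (c - \<gamma> k + \<epsilon> / 3) = a + c + 2 * \<epsilon> / 3" by simp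
        thus ?thesis by (simp only: powr_add[symmetric])
      qed
      finally show "norm (X z i k * Y z k j) \<le> norm z powr (a + c + 2 * \<epsilon> / 3)" .
    qed
    also have "\<dots> = real K * norm z powr (a + c + 2 * \<epsilon> / 3)" by simp
    also have "\<dots> \<le> norm z powr (a + c + \<epsilon>)" using elim(2) by simp
    finally show ?case .
  qed
qed

locale ordered_partition =
  fixes K N :: nat and b :: "nat \<Rightarrow> nat" and \<alpha> :: "nat \<Rightarrow> real"
  assumes K2: "K \<ge> 2" and coprime: "coprime K N"
    and sum_b: "(\<Sum>i<K. b i) = N"
    and weights: "\<And>i. i < K \<Longrightarrow> real (b i) - real N / real K = \<alpha> i - \<alpha> ((i + 1) mod K)"
    and sum_weights: "(\<Sum>i<K. \<alpha> i) = 0"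
begin

lemma K_pos: "0 < K" using K2 by simp

text \<open>
The difference of two weights is an integer minus \<open>(j - i) N / K\<close>, and the latter is not an integer as \<open>K\<close> is
coprime to \<open>N\<close> and \<open>0 < j - i < K\<close>.
\<close>

lemma weights_distinct:
  assumes "i < j" "j < K"
  shows "\<alpha> i \<noteq> \<alpha> j"
proof
  assume eq: "\<alpha> i = \<alpha> j"
  have "\<alpha> i - \<alpha> (i + n) = (\<Sum>l<n. real (b (i + l))) - real n * (real N / real K)" if "i + n < K" for n
    using that
  proof (induction n)
    case (Suc n)
    have "\<alpha> (i + n) - \<alpha> (i + Suc n) = real (b (i + n)) - real N / real K"
      using weights[of "i + n"] Suc.prems by simp
    moreover have "\<alpha> i - \<alpha> (i + n) = (\<Sum>l<n. real (b (i + l))) - real n * (real N / real K)"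
      using Suc by simp
    moreover have "real (Suc n) * (real N / real K) = real n * (real N / real K) + real N / real K"
      by (simp add: add_divide_distrib distrib_right)
    ultimately show ?case by (simp only: sum.lessThan_Suc)
  qed simp
  from this[of "j - i"] have "real (j - i) * (real N / real K) = (\<Sum>l<j - i. real (b (i + l)))"
    using assms eq by simp
  hence "real (j - i) * real N = real (\<Sum>l<j - i. b (i + l)) * real K"
    using K_pos by (simp add: field_simps)
  hence "(j - i) * N = (\<Sum>l<j - i. b (i + l)) * K"
    by (metis of_nat_eq_iff of_nat_mult)
  hence "K dvd (j - i) * N" by simp
  hence "K dvd j - i" using coprime by (simp add: coprime_dvd_mult_left_iff)
  thus False using assms by (auto dest: dvd_imp_le)
qed

lemma sum_rotated_weights: "(\<Sum>k<K. \<alpha> ((i + k) mod K)) = 0"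
proof (induction i)
  case 0
  have "(\<Sum>k<K. \<alpha> ((0 + k) mod K)) = (\<Sum>k<K. \<alpha> k)" by (intro sum.cong) auto
  thus ?case using sum_weights by simp
next
  case (Suc i)
  have "(\<Sum>k<K. \<alpha> ((Suc i + k) mod K)) = (\<Sum>k<K. \<alpha> ((i + (k + 1) mod K) mod K))"
    by (intro sum.cong) (auto simp: mod_simps)
  also have "\<dots> = (\<Sum>k<K. \<alpha> ((i + k) mod K))"
    by (rule sum_cyclic_shift[of "\<lambda>k. \<alpha> ((i + k) mod K)"])
  finally show ?case using Suc by simp
qed

lemma rotated_weights_separate:
  assumes "i < K" "j < K" "i \<noteq> j"
  obtains k where "k < K" "\<alpha> ((i + k) mod K) < \<alpha> ((j + k) mod K)"
proof -
  have "\<exists>k<K. \<alpha> ((i + k) mod K) < \<alpha> ((j + k) mod K)"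
  proof (rule ccontr)
    assume "\<not> ?thesis"
    hence nonneg: "0 \<le> \<alpha> ((i + k) mod K) - \<alpha> ((j + k) mod K)" if "k < K" for k
      using that by (metis diff_ge_0_iff_ge not_less)
    have "(\<Sum>k<K. \<alpha> ((i + k) mod K) - \<alpha> ((j + k) mod K)) = 0"
      by (simp only: sum_subtractf sum_rotated_weights diff_self)
    hence "\<alpha> ((i + 0) mod K) - \<alpha> ((j + 0) mod K) = 0"
      using sum_nonneg_eq_0_iff[of "{..<K}" "\<lambda>k. \<alpha> ((i + k) mod K) - \<alpha> ((j + k) mod K)"] nonneg K_pos
      by (metis (no_types, lifting) finite_lessThan lessThan_iff)
    hence "\<alpha> i = \<alpha> j" using assms by simp
    thus False using weights_distinct[of i j] weights_distinct[of j i] assms by (cases "i < j") auto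
  qed
  thus thesis using that by blast
qed

text \<open>The matrix of \<open>e\<^sub>i\<^sub>+\<^sub>1 \<mapsto> z\<^bsup>b i\<^esup> e\<^sub>i\<close>.\<close>

definition higgs_matrix :: "complex \<Rightarrow> cmat" where
  "higgs_matrix z = (\<lambda>i j. if i < K \<and> j = (i + 1) mod K then z ^ b i else 0)"

lemma padded_higgs_matrix [simp]: "padded K (higgs_matrix z)"
  using K_pos by (auto simp: padded_def higgs_matrix_def)

lemma mm_higgs_left: "i < K \<Longrightarrow> mm K (higgs_matrix z) X i j = z ^ b i * X ((i + 1) mod K) j"
proof -
  assume i: "i < K"
  have "mm K (higgs_matrix z) X i j = (\<Sum>k<K. if k = (i + 1) mod K then z ^ b i * X k j else 0)"
    unfolding mm_def higgs_matrix_def using i by (intro sum.cong) auto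
  thus ?thesis using K_pos by simp
qed

lemma mm_higgs_right: "j < K \<Longrightarrow> mm K X (higgs_matrix z) i ((j + 1) mod K) = X i j * z ^ b j"
proof -
  assume j: "j < K"
  have "(j + 1) mod K = (k + 1) mod K \<longleftrightarrow> k = j" if "k < K" for k
    using cyclic_pred_succ(1)[OF that] cyclic_pred_succ(1)[OF j] by metis
  hence "mm K X (higgs_matrix z) i ((j + 1) mod K) = (\<Sum>k<K. if k = j then X i k * z ^ b k else 0)"
    unfolding mm_def higgs_matrix_def by (intro sum.cong) auto
  thus ?thesis using j by simp
qed

text \<open>
Comparing entries of \<open>\<Phi> s = s \<Phi>\<close> gives
\<open>z\<^bsup>b i\<^esup> s\<^sub>i\<^sub>+\<^sub>1\<^sub>,\<^sub>j\<^sub>+\<^sub>1 = z\<^bsup>b j\<^esup> s\<^sub>i\<^sub>j\<close>, so a vanishing entry makes its successor vanish, and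
successive diagonal entries are equal. On an off-diagonal orbit some entry tends to zero at infinity and
therefore vanishes identically; from there one goes once around the orbit.
\<close>

lemma commutant_scalar:
  fixes s :: "complex \<Rightarrow> cmat"
  assumes hol: "\<And>i j. (\<lambda>z. s z i j) holomorphic_on UNIV"
    and comm: "\<And>z. mm K (higgs_matrix z) (s z) = mm K (s z) (higgs_matrix z)"
    and growth: "\<And>i j \<epsilon>. i < K \<Longrightarrow> j < K \<Longrightarrow> 0 < \<epsilon> \<Longrightarrow>
        eventually (\<lambda>z. norm (s z i j) \<le> norm z powr (\<alpha> i - \<alpha> j + \<epsilon>)) at_infinity"
    and ij: "i < K" "j < K"
  shows "s z i j = (if i = j then s z 0 0 else 0)"
proof -
  have shift: "z ^ b i * s z ((i + 1) mod K) ((j + 1) mod K) = s z i j * z ^ b j"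
    if "i < K" "j < K" for i j z
    using fun_cong[OF fun_cong[OF comm], of z i "(j + 1) mod K"] that
    by (simp only: mm_higgs_left mm_higgs_right)
  have zero_step: "s z ((i + 1) mod K) ((j + 1) mod K) = 0"
    if "i < K" "j < K" "\<And>z. s z i j = 0" for i j z
  proof (rule holomorphic_zero_off_origin[OF hol])
    fix z :: complex assume "z \<noteq> 0"
    thus "s z ((i + 1) mod K) ((j + 1) mod K) = 0" using shift[OF that(1,2), of z] that(3)[of z] by simp
  qed
  have off: "s z i j = 0" if ij: "i < K" "j < K" "i \<noteq> j" for i j z
  proof -
    obtain k where k: "k < K" "\<alpha> ((i + k) mod K) < \<alpha> ((j + k) mod K)"
      using rotated_weights_separate[OF ij] .
    define d where "d = \<alpha> ((i + k) mod K) - \<alpha> ((j + k) mod K)"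
    have "((\<lambda>z. s z ((i + k) mod K) ((j + k) mod K)) \<longlongrightarrow> 0) at_infinity"
    proof (rule Lim_null_comparison)
      show "eventually (\<lambda>z. norm (s z ((i + k) mod K) ((j + k) mod K)) \<le> norm z powr (d + (- d / 2))) at_infinity"
        unfolding d_def by (rule growth) (use k K_pos in auto)
      show "((\<lambda>z::complex. norm z powr (d + (- d / 2))) \<longlongrightarrow> 0) at_infinity"
        by (rule powr_neg_tendsto_zero_at_infinity) (use k d_def in linarith)
    qed
    hence base: "s z ((i + k) mod K) ((j + k) mod K) = 0" for z
      by (rule Liouville_weak_0[OF hol])
    have "s z ((i + (k + n)) mod K) ((j + (k + n)) mod K) = 0" for n z
    proof (induction n arbitrary: z)
      case 0
      show ?case using base by simp
    next
      case (Suc n)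
      have "s z (((i + (k + n)) mod K + 1) mod K) (((j + (k + n)) mod K + 1) mod K) = 0"
        by (rule zero_step) (use Suc K_pos in auto)
      thus ?case by (simp add: mod_simps)
    qed
    from this[of z "K - k"] show ?thesis using k ij by simp
  qed
  have diag: "s z i i = s z 0 0" if "i < K" for i
    using that
  proof (induction i)
    case (Suc i)
    have "(\<lambda>z. s z (Suc i) (Suc i) - s z i i) holomorphic_on UNIV"
      by (intro holomorphic_intros hol)
    hence "s z (Suc i) (Suc i) - s z i i = 0"
    proof (rule holomorphic_zero_off_origin)
      fix z :: complex assume "z \<noteq> 0"
      thus "s z (Suc i) (Suc i) - s z i i = 0" using shift[of i i z] Suc.prems by simp
    qed
    thus ?case using Suc by simp
  qed simp
  show ?thesis
  proof (cases "i = j")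
    case True
    thus ?thesis using diag[OF ij(1)] by simp
  next
    case False
    thus ?thesis using off[OF ij False] by simp
  qed
qed

text \<open>
The growth bounds are the ones that adaptedness to the filtration gives for the inverse of the first metric
and for the second one.
\<close>

theorem solutions_proportional:
  assumes pair: "hitchin_pair K higgs_matrix G B A \<Psi> G' B' A' \<Psi>'"
    and growth_B: "\<And>i j \<epsilon>. i < K \<Longrightarrow> j < K \<Longrightarrow> 0 < \<epsilon> \<Longrightarrow>
        eventually (\<lambda>z. norm (B z i j) \<le> norm z powr (\<alpha> i + \<alpha> j + \<epsilon>)) at_infinity"
    and growth_G': "\<And>i j \<epsilon>. i < K \<Longrightarrow> j < K \<Longrightarrow> 0 < \<epsilon> \<Longrightarrow>
        eventually (\<lambda>z. norm (G' z i j) \<le> norm z powr (- \<alpha> i - \<alpha> j + \<epsilon>)) at_infinity"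
  shows "\<exists>c. \<forall>z. G' z = (\<lambda>i j. c * G z i j)"
proof -
  interpret hitchin_pair K higgs_matrix G B A \<Psi> G' B' A' \<Psi>' by (rule pair)
  have growth_s: "eventually (\<lambda>z. norm (s z i j) \<le> norm z powr (\<alpha> i - \<alpha> j + \<epsilon>)) at_infinity"
    if "i < K" "j < K" "0 < \<epsilon>" for i j \<epsilon>
  proof -
    have "eventually (\<lambda>z. norm (mm K (B z) (G' z) i j) \<le> norm z powr (\<alpha> i + (- \<alpha> j) + \<epsilon>)) at_infinity"
      using growth_B[OF that(1)] growth_G'[OF _ that(2)]
      by (intro growth_mm[where \<gamma> = \<alpha>] that(3)) (auto simp: algebra_simps)
    thus ?thesis by (simp add: s_def)
  qed
  have growth_tau: "eventually (\<lambda>z. \<tau> z \<le> norm z powr \<epsilon>) at_infinity" if e: "0 < \<epsilon>" for \<epsilon>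
  proof -
    have e2: "0 < \<epsilon> / 2" using e by simp
    have "eventually (\<lambda>z. \<forall>i\<in>{..<K}. norm (s z i i) \<le> norm z powr (\<epsilon> / 2)) at_infinity"
      using growth_s[OF _ _ e2, of i i for i] by (intro eventually_ball_finite) auto
    moreover have "eventually (\<lambda>z::complex. real K * norm z powr (\<epsilon> / 2) \<le> norm z powr (\<epsilon> / 2 + \<epsilon> / 2)) at_infinity"
      by (rule eventually_mult_powr_le[OF e2])
    ultimately show ?thesis
    proof eventually_elim
      case (elim z)
      have "\<tau> z \<le> norm (mtr K (s z))" unfolding \<tau>_def by (rule complex_Re_le_cmod)
      also have "\<dots> \<le> (\<Sum>i<K. norm (s z i i))" unfolding mtr_def by (rule norm_sum)
      also have "\<dots> \<le> (\<Sum>i<K. norm z powr (\<epsilon> / 2))" using elim(1) by (intro sum_mono) auto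
      also have "\<dots> \<le> norm z powr \<epsilon>" using elim(2) by simp
      finally show ?case .
    qed
  qed
  have scalar: "s z i j = (if i = j then s z 0 0 else 0)" if "i < K" "j < K" for i j z
    using commutant_scalar[OF rigidity(2)[OF growth_tau] rigidity(1)[OF growth_tau] growth_s that] .
  have "s z 0 0 = of_real (\<tau> 0 / real K)" for z
  proof -
    have sii: "s z i i = s z 0 0" if "i < K" for i
      using trans[OF scalar[OF that that] if_P[OF refl]] .
    have "mtr K (s z) = (\<Sum>i<K. s z 0 0)"
      unfolding mtr_def by (rule sum.cong[OF refl], rule sii) simp
    moreover have "\<tau> z = \<tau> 0" by (rule tau_constant[OF growth_tau])
    ultimately have "of_nat K * s z 0 0 = of_real (\<tau> 0)" using mtr_s[of z] by simp
    thus ?thesis using K_pos by (simp add: field_simps)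
  qed
  note s00 = this
  have s_eq: "s z = (\<lambda>i j. of_real (\<tau> 0 / real K) * ident_mat K i j)" for z
  proof (intro ext)
    fix i j
    show "s z i j = of_real (\<tau> 0 / real K) * ident_mat K i j"
    proof (cases "i < K \<and> j < K")
      case True
      hence "s z i j = (if i = j then of_real (\<tau> 0 / real K) else 0)"
        using scalar[of i j z] unfolding s00 by blast
      thus ?thesis using True by (simp add: ident_mat_def)
    next
      case False
      thus ?thesis using padded_s[of z] by (auto simp: padded_def ident_mat_def)
    qed
  qed
  have "G' z = mm K (G z) (s z)" for z by (simp add: s_def sol.cancel)
  also have "mm K (G z) (s z) = (\<lambda>i j. of_real (\<tau> 0 / real K) * mm K (G z) (ident_mat K) i j)" for z
    unfolding s_eq by (simp add: mm_def sum_distrib_left mult.left_commute)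
  finally have "G' z = (\<lambda>i j. of_real (\<tau> 0 / real K) * G z i j)" for z by (simp add: mm_one_right)
  thus ?thesis by blast
qed

end

section \<open>Symmetries of the harmonic metric\<close>

definition smul :: "complex \<Rightarrow> cmat \<Rightarrow> cmat" where
  "smul c X = (\<lambda>i j. c * X i j)"

definition twist :: "(nat \<Rightarrow> complex) \<Rightarrow> cmat \<Rightarrow> cmat" where
  "twist t X = (\<lambda>i j. cnj (t i) * t j * X i j)"

lemma smul_smul: "smul c (smul d X) = smul (c * d) X"
  by (simp add: smul_def mult.assoc)

lemma smul_one [simp]: "smul 1 X = X"
  by (simp add: smul_def)

lemma mm_smul_left: "mm K (smul c X) Y = smul c (mm K X Y)"
  by (simp add: mm_def smul_def sum_distrib_left mult.assoc)

lemma mm_smul_right: "mm K X (smul c Y) = smul c (mm K X Y)"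
  by (simp add: mm_def smul_def sum_distrib_left mult.left_commute)

lemma ct_smul: "ct (smul c X) = smul (cnj c) (ct X)"
  by (simp add: ct_def smul_def)

lemma padded_smul [simp]: "padded K X \<Longrightarrow> padded K (smul c X)"
  by (simp add: padded_def smul_def)

lemma ct_twist: "ct (twist t X) = twist t (ct X)"
  by (simp add: ct_def twist_def mult.commute mult.left_commute)

lemma padded_twist [simp]: "padded K X \<Longrightarrow> padded K (twist t X)"
  by (simp add: padded_def twist_def)

lemma twist_diff: "twist t (X - Y) = twist t X - twist t Y"
  by (simp add: twist_def fun_eq_iff right_diff_distrib)

lemma unimodular_cnj: "norm c = 1 \<Longrightarrow> cnj c * c = (1::complex)" "norm c = 1 \<Longrightarrow> c * cnj c = (1::complex)"
  by (simp_all add: complex_norm_square[symmetric] mult.commute)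

lemma mm_twist:
  assumes "\<And>i. norm (t i) = 1"
  shows "mm K (twist t X) (twist t Y) = twist t (mm K X Y)"
proof (intro ext)
  fix i j
  have eq: "cnj (t i) * t k * X i k * (cnj (t k) * t j * Y k j) = cnj (t i) * t j * (X i k * Y k j)" for k
  proof -
    have "cnj (t i) * t k * X i k * (cnj (t k) * t j * Y k j) = (t k * cnj (t k)) * (cnj (t i) * t j * (X i k * Y k j))"
      by (simp only: mult.assoc mult.commute mult.left_commute)
    thus ?thesis using unimodular_cnj(2)[OF assms] by simp
  qed
  show "mm K (twist t X) (twist t Y) i j = twist t (mm K X Y) i j"
    unfolding mm_def twist_def sum_distrib_left by (rule sum.cong[OF refl]) (rule eq)
qed

lemma twist_one:
  assumes "\<And>i. norm (t i) = 1"
  shows "twist t (ident_mat K) = ident_mat K"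
  using unimodular_cnj(1)[OF assms] by (simp add: twist_def ident_mat_def fun_eq_iff)

lemma herm_pd_twist:
  assumes "\<And>i. norm (t i) = 1" "herm_pd K G"
  shows "herm_pd K (twist t G)"
  unfolding herm_pd_def
proof (intro conjI allI impI)
  fix i j assume "i < K" "j < K"
  hence "cnj (G j i) = G i j" using herm_pd_herm[OF assms(2)] by metis
  thus "twist t G i j = cnj (twist t G j i)" by (simp add: twist_def)
next
  fix x :: "nat \<Rightarrow> complex" assume "\<exists>i<K. x i \<noteq> 0"
  then obtain i where i: "i < K" "x i \<noteq> 0" by blast
  have "t i * x i \<noteq> 0" using i assms(1)[of i] by auto
  from herm_pd_pos[OF assms(2) i(1), of "\<lambda>i. t i * x i", OF this]
  show "0 < Re (\<Sum>i<K. \<Sum>j<K. cnj (x i) * twist t G i j * x j)"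
    by (simp add: twist_def mult.assoc mult.commute mult.left_commute)
qed

lemma has_mwirt_twist: "has_mwirt M P Q z \<Longrightarrow> has_mwirt (\<lambda>w. twist t (M w)) (twist t P) (twist t Q) z"
  unfolding has_mwirt_def twist_def
  using has_wirtinger_mult[OF has_wirtinger_const] by fastforce

lemma has_mwirt_smul: "has_mwirt M P Q z \<Longrightarrow> has_mwirt (\<lambda>w. smul c (M w)) (smul c P) (smul c Q) z"
  unfolding has_mwirt_def smul_def
  using has_wirtinger_mult[OF has_wirtinger_const] by fastforce

lemma has_mwirt_rotate:
  assumes "has_mwirt M P Q (c * z)"
  shows "has_mwirt (\<lambda>w. M (c * w)) (smul c P) (smul (cnj c) Q) z"
  unfolding has_mwirt_def
proof (intro allI)
  fix i j
  have "((\<lambda>w. c * w) has_derivative (\<lambda>v. c * v)) (at z)"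
    by (auto intro!: derivative_eq_intros)
  from has_derivative_compose[OF this, of "\<lambda>w. M w i j" "\<lambda>v. P i j * v + Q i j * cnj v"]
  show "has_wirtinger (\<lambda>w. M (c * w) i j) (smul c P i j) (smul (cnj c) Q i j) z"
    using assms unfolding has_mwirt_def has_wirtinger_def smul_def
    by (simp add: mult.assoc mult.commute mult.left_commute)
qed

text \<open>
The growth conditions are what remains of adaptedness to the filtration; the one for the inverse is the lower
bound on the metric.
\<close>

locale higgs_solution = ordered_partition K N b \<alpha> +
    sol: hitchin_solution K "ordered_partition.higgs_matrix K b" G B A \<Psi>
    for K N :: nat and b :: "nat \<Rightarrow> nat" and \<alpha> :: "nat \<Rightarrow> real" and G B A \<Psi> +
  assumes growth_B: "\<And>i j \<epsilon>. i < K \<Longrightarrow> j < K \<Longrightarrow> 0 < \<epsilon> \<Longrightarrow>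
        eventually (\<lambda>z. norm (B z i j) \<le> norm z powr (\<alpha> i + \<alpha> j + \<epsilon>)) at_infinity"
    and growth_G: "\<And>i j \<epsilon>. i < K \<Longrightarrow> j < K \<Longrightarrow> 0 < \<epsilon> \<Longrightarrow>
        eventually (\<lambda>z. norm (G z i j) \<le> norm z powr (- \<alpha> i - \<alpha> j + \<epsilon>)) at_infinity"
begin

text \<open>
The twist with \<open>t\<close> is conjugation with the diagonal unitary matrix of the \<open>t\<^sub>i\<close>. They are chosen
so that \<open>\<Phi>(c z)\<close> is turned into \<open>\<kappa> \<Phi>(z)\<close>, which for the indices below \<open>K - 1\<close> prescribes \<open>t\<^sub>i\<^sub>+\<^sub>1\<close> from \<open>t\<^sub>i\<close>; the
condition \<open>\<kappa>\<^sup>K = c\<^sup>N\<close> is what closes the cycle. The factor \<open>\<kappa>\<close> disappears from \<open>[\<Phi>, \<Phi>\<^sup>\<dagger>]\<close>. So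
the rotated and twisted metric is again harmonic for \<open>\<Phi>\<close>, and therefore proportional to the original one; comparing
the entry \<open>(0, 0)\<close> at \<open>z = 0\<close>, which neither operation moves, the factor is \<open>1\<close>.
\<close>

lemma symmetry:
  assumes c: "norm c = 1" and \<kappa>: "norm \<kappa> = 1" "\<kappa> ^ K = c ^ N"
  defines "t \<equiv> \<lambda>i. \<kappa> ^ i * cnj c ^ (\<Sum>l<i. b l)"
  shows "twist t (G (c * z)) = G z"
proof -
  have t1: "norm (t i) = 1" for i
    using c \<kappa> by (simp add: t_def norm_mult norm_power)
  have cc: "cnj c * c = 1" "c * cnj c = 1" and kk: "cnj \<kappa> * \<kappa> = 1" "\<kappa> * cnj \<kappa> = 1"
    using unimodular_cnj c \<kappa> by auto
  have cc_pow: "cnj c ^ n * c ^ n = 1" "c ^ n * cnj c ^ n = 1" for n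
    using cc by (simp_all flip: power_mult_distrib)
  have tK: "t K = 1" using cc_pow by (simp add: t_def sum_b \<kappa>)
  have t_mod: "t ((i + 1) mod K) = t (Suc i)" if "i < K" for i
  proof (cases "Suc i = K")
    case True
    thus ?thesis using tK by (simp add: t_def)
  next
    case False
    thus ?thesis using that by simp
  qed
  have Phi_twist: "twist t (higgs_matrix (c * z)) = smul \<kappa> (higgs_matrix z)" for z
  proof (intro ext)
    fix i j
    show "twist t (higgs_matrix (c * z)) i j = smul \<kappa> (higgs_matrix z) i j"
    proof (cases "i < K \<and> j = (i + 1) mod K")
      case True
      have "cnj (t i) * t j * (c * z) ^ b i = (cnj (t i) * t i) * \<kappa> * (cnj c ^ b i * c ^ b i) * z ^ b i"
        using t_mod[of i] True by (simp add: t_def power_add power_mult_distrib mult_ac)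
      also have "\<dots> = \<kappa> * z ^ b i" by (simp add: cc_pow unimodular_cnj[OF t1])
      finally show ?thesis using True by (simp add: twist_def smul_def higgs_matrix_def)
    next
      case False
      thus ?thesis by (simp only: twist_def smul_def higgs_matrix_def if_False mult_zero_right)
    qed
  qed
  have Phi_eq: "higgs_matrix z = smul (cnj \<kappa>) (twist t (higgs_matrix (c * z)))" for z
    by (simp add: Phi_twist smul_smul kk)
  define G' where "G' = (\<lambda>z. twist t (G (c * z)))"
  define B' where "B' = (\<lambda>z. twist t (B (c * z)))"
  define A' where "A' = (\<lambda>z. smul c (twist t (A (c * z))))"
  define \<Psi>' where "\<Psi>' = (\<lambda>z. smul \<kappa> (twist t (\<Psi> (c * z))))"
  have sol': "hitchin_solution K higgs_matrix G' B' A' \<Psi>'"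
  proof
    show "0 < K" by (rule K_pos)
    show "padded K (higgs_matrix z)" "padded K (G' z)" "padded K (B' z)" "padded K (A' z)" "padded K (\<Psi>' z)" for z
      by (simp_all add: G'_def B'_def A'_def \<Psi>'_def)
    show "herm_pd K (G' z)" for z
      unfolding G'_def by (rule herm_pd_twist[OF t1 sol.pd])
    show "mm K (B' z) (G' z) = ident_mat K" "mm K (G' z) (B' z) = ident_mat K" for z
      unfolding G'_def B'_def by (simp_all add: mm_twist[OF t1] sol.inv twist_one[OF t1])
    show "has_mwirt G' (mm K (G' z) (A' z)) (mm K (ct (A' z)) (G' z)) z" for z
      using has_mwirt_rotate[OF has_mwirt_twist[OF sol.dG], of t c z]
      unfolding G'_def A'_def by (simp add: ct_smul ct_twist mm_smul_left mm_smul_right mm_twist[OF t1])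
    show "\<exists>P Q. has_mwirt B' P Q z" for z
      using sol.dB[of "c * z"] has_mwirt_rotate[OF has_mwirt_twist] unfolding B'_def by blast
    show "\<exists>P. has_mwirt A' P (mm K (higgs_matrix z) (\<Psi>' z) - mm K (\<Psi>' z) (higgs_matrix z)) z" for z
    proof -
      obtain P where P: "has_mwirt A P (mm K (higgs_matrix (c * z)) (\<Psi> (c * z)) - mm K (\<Psi> (c * z)) (higgs_matrix (c * z))) (c * z)"
        using sol.dA by blast
      have "smul (cnj c) (smul c (twist t (mm K (higgs_matrix (c * z)) (\<Psi> (c * z)) - mm K (\<Psi> (c * z)) (higgs_matrix (c * z)))))
          = mm K (higgs_matrix z) (\<Psi>' z) - mm K (\<Psi>' z) (higgs_matrix z)"
        unfolding Phi_eq[of z] \<Psi>'_def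
        by (simp add: smul_smul cc kk mm_smul_left mm_smul_right mm_twist[OF t1] twist_diff)
      with has_mwirt_rotate[OF has_mwirt_smul[OF has_mwirt_twist[OF P]], of c t]
      show ?thesis unfolding A'_def by auto
    qed
    show "mm K (ct (higgs_matrix z)) (G' z) = mm K (G' z) (\<Psi>' z)" for z
      unfolding Phi_eq[of z] G'_def \<Psi>'_def
      by (simp add: ct_smul ct_twist mm_smul_left mm_smul_right mm_twist[OF t1] sol.adj)
  qed
  have "hitchin_pair K higgs_matrix G B A \<Psi> G' B' A' \<Psi>'"
    by (intro hitchin_pair.intro sol' sol.hitchin_solution_axioms)
  moreover have "eventually (\<lambda>z. norm (G' z i j) \<le> norm z powr (- \<alpha> i - \<alpha> j + \<epsilon>)) at_infinity"
    if ij: "i < K" "j < K" "0 < \<epsilon>" for i j \<epsilon>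
  proof -
    obtain R where R: "\<And>z. norm z \<ge> R \<Longrightarrow> norm (G z i j) \<le> norm z powr (- \<alpha> i - \<alpha> j + \<epsilon>)"
      using growth_G[OF ij] unfolding eventually_at_infinity by blast
    have "norm (G' z i j) \<le> norm z powr (- \<alpha> i - \<alpha> j + \<epsilon>)" if "norm z \<ge> R" for z
      using R[of "c * z"] that by (simp add: G'_def twist_def norm_mult t1 c)
    thus ?thesis unfolding eventually_at_infinity by blast
  qed
  ultimately obtain d where d: "\<And>z. G' z = (\<lambda>i j. d * G z i j)"
    using solutions_proportional[OF _ growth_B] by blast
  have "G 0 0 0 \<noteq> 0" using herm_pd_diag(1)[OF sol.pd K_pos, of 0] by auto
  moreover have "G' 0 0 0 = G 0 0 0" by (simp add: G'_def twist_def t_def)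
  ultimately have "d = 1" using fun_cong[OF fun_cong[OF d[of 0]], of 0 0] by simp
  thus ?thesis using d[of z] by (simp add: G'_def)
qed

text \<open>
Apply the symmetry with \<open>c = 1\<close> and \<open>\<kappa>\<close> a primitive \<open>K\<close>-th root of unity \<open>\<omega>\<close>: the entry \<open>(i, j)\<close> is multiplied by
\<open>\<omega>\<^bsup>j - i\<^esup> \<noteq> 1\<close>.
\<close>

lemma G_diagonal:
  assumes ij: "i < K" "j < K" "i \<noteq> j"
  shows "G z i j = 0"
proof -
  define \<omega> where "\<omega> = cis (2 * pi / real K)"
  have "\<omega> ^ K = 1" using K_pos by (simp add: \<omega>_def Complex.DeMoivre)
  hence sym: "twist (\<lambda>i. \<omega> ^ i * cnj 1 ^ (\<Sum>l<i. b l)) (G (1 * z)) = G z"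
    by (intro symmetry) (auto simp: \<omega>_def)
  have ne: "\<omega> ^ m \<noteq> 1" if "0 < m" "m < K" for m
  proof
    assume "\<omega> ^ m = 1"
    hence "cis (2 * pi * real m / real K) = 1" by (simp add: \<omega>_def Complex.DeMoivre mult.commute)
    hence "exp (2 * of_real pi * \<i> * of_nat m / of_nat K) = 1"
      by (simp add: cis_conv_exp mult_ac)
    hence "K dvd m" using complex_root_unity_eq_1[of K m] K_pos by simp
    thus False using that by (auto dest: dvd_imp_le)
  qed
  have unit: "cnj (\<omega> ^ i) * \<omega> ^ i = 1" for i
    by (rule unimodular_cnj) (simp add: \<omega>_def norm_power)
  have "cnj (\<omega> ^ i) * \<omega> ^ j \<noteq> 1"
  proof
    assume eq: "cnj (\<omega> ^ i) * \<omega> ^ j = 1"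
    have "\<omega> ^ j = (cnj (\<omega> ^ i) * \<omega> ^ i) * \<omega> ^ j" using unit[of i] by simp
    also have "\<dots> = \<omega> ^ i * (cnj (\<omega> ^ i) * \<omega> ^ j)" by (simp add: mult_ac)
    finally have eq': "\<omega> ^ j = \<omega> ^ i" unfolding eq by simp
    have nz: "\<omega> ^ k \<noteq> 0" for k by (simp add: \<omega>_def)
    show False
    proof (cases "i < j")
      case True
      hence "\<omega> ^ i * \<omega> ^ (j - i) = \<omega> ^ i" using eq' by (simp flip: power_add)
      thus False using ne[of "j - i"] True ij nz[of i] by simp
    next
      case False
      hence "\<omega> ^ j * \<omega> ^ (i - j) = \<omega> ^ i" by (simp flip: power_add)
      hence "\<omega> ^ j * \<omega> ^ (i - j) = \<omega> ^ j" using eq' by simp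
      thus False using ne[of "i - j"] False ij nz[of j] by simp
    qed
  qed
  moreover have "cnj (\<omega> ^ i) * \<omega> ^ j * G z i j = G z i j"
    using fun_cong[OF fun_cong[OF sym], of i j] by (simp add: twist_def)
  ultimately show ?thesis by (metis mult_cancel_right1)
qed

text \<open>
Every unimodular \<open>c\<close> admits a unimodular \<open>\<kappa>\<close> with \<open>\<kappa>\<^sup>K = c\<^sup>N\<close>, and twisting does not change diagonal entries.
\<close>

lemma G_radial:
  assumes "norm c = 1"
  shows "G (c * z) i i = G z i i"
proof -
  obtain \<theta> where c: "c = cis \<theta>" using assms by (metis cis_Arg norm_eq_zero sgn_eq div_by_1 of_real_1 zero_neq_one)
  define \<kappa> where "\<kappa> = cis (\<theta> * real N / real K)"
  have k: "norm \<kappa> = 1" "\<kappa> ^ K = c ^ N" using K_pos by (simp_all add: \<kappa>_def c Complex.DeMoivre mult.commute)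
  define t where "t = (\<lambda>i. \<kappa> ^ i * cnj c ^ (\<Sum>l<i. b l))"
  have "cnj (t i) * t i = 1"
    by (rule unimodular_cnj) (use k assms in \<open>simp add: t_def norm_mult norm_power\<close>)
  moreover have "twist t (G (c * z)) i i = G z i i"
    unfolding t_def using symmetry[OF assms k] by simp
  ultimately show ?thesis by (simp add: twist_def)
qed

end

section \<open>Gram matrices and bounds for inverse matrices\<close>

definition entries :: "nat \<Rightarrow> complex Matrix.mat \<Rightarrow> cmat" where
  "entries K M = (\<lambda>i j. if i < K \<and> j < K then M $$ (i, j) else 0)"

lemma padded_entries [simp]: "padded K (entries K M)"
  by (auto simp: padded_def entries_def)

lemma entries_mult:
  assumes "M \<in> carrier_mat K K" "M' \<in> carrier_mat K K"
  shows "entries K (M * M') = mm K (entries K M) (entries K M')"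
proof (intro ext)
  fix i j
  show "entries K (M * M') i j = mm K (entries K M) (entries K M') i j"
  proof (cases "i < K \<and> j < K")
    case True
    thus ?thesis using assms
      by (auto simp: entries_def mm_def scalar_prod_def atLeast0LessThan intro!: sum.cong)
  next
    case False
    thus ?thesis by (auto simp: entries_def mm_def)
  qed
qed

lemma entries_one: "entries K (1\<^sub>m K) = ident_mat K"
  by (auto simp: entries_def ident_mat_def fun_eq_iff)

lemma herm_form_sum:
  assumes "M \<in> carrier_mat K K" "s \<in> carrier_vec K" "t \<in> carrier_vec K"
  shows "herm_form M s t = (\<Sum>i<K. \<Sum>j<K. cnj (t $ i) * M $$ (i, j) * s $ j)"
proof -
  have "herm_form M s t = (\<Sum>i<K. (\<Sum>j<K. M $$ (i, j) * s $ j) * cnj (t $ i))"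
    using assms unfolding herm_form_def scalar_prod_def
    by (auto simp: scalar_prod_def atLeast0LessThan intro!: sum.cong)
  thus ?thesis by (simp add: sum_distrib_left sum_distrib_right mult_ac)
qed

lemma herm_form_unit_right:
  assumes "M \<in> carrier_mat K K" "s \<in> carrier_vec K" "i < K"
  shows "herm_form M s (unit_vec K i) = (\<Sum>k<K. M $$ (i, k) * s $ k)"
proof -
  have "herm_form M s (unit_vec K i) = (\<Sum>a<K. if a = i then (\<Sum>k<K. M $$ (a, k) * s $ k) else 0)"
    unfolding herm_form_sum[OF assms(1,2) unit_vec_carrier] by (intro sum.cong) (auto simp: unit_vec_def)
  thus ?thesis using assms(3) by simp
qed

lemma herm_form_unit_left:
  assumes "M \<in> carrier_mat K K" "t \<in> carrier_vec K" "j < K"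
  shows "herm_form M (unit_vec K j) t = (\<Sum>a<K. cnj (t $ a) * M $$ (a, j))"
proof -
  have "(\<Sum>k<K. cnj (t $ a) * M $$ (a, k) * unit_vec K j $ k) = cnj (t $ a) * M $$ (a, j)" for a
  proof -
    have "(\<Sum>k<K. cnj (t $ a) * M $$ (a, k) * unit_vec K j $ k) = (\<Sum>k<K. if k = j then cnj (t $ a) * M $$ (a, k) else 0)"
      by (intro sum.cong) (auto simp: unit_vec_def)
    thus ?thesis using assms(3) by simp
  qed
  thus ?thesis unfolding herm_form_sum[OF assms(1) unit_vec_carrier assms(2)] by simp
qed

lemma herm_pd_entries:
  assumes M: "M \<in> carrier_mat K K"
    and herm: "\<And>s t. s \<in> carrier_vec K \<Longrightarrow> t \<in> carrier_vec K \<Longrightarrow> herm_form M s t = cnj (herm_form M t s)"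
    and pos: "\<And>s. s \<in> carrier_vec K \<Longrightarrow> s \<noteq> 0\<^sub>v K \<Longrightarrow> Re (herm_form M s s) > 0"
  shows "herm_pd K (entries K M)"
  unfolding herm_pd_def
proof (intro conjI allI impI)
  fix i j assume ij: "i < K" "j < K"
  have unit: "herm_form M (unit_vec K b) (unit_vec K a) = M $$ (a, b)" if "a < K" "b < K" for a b
  proof -
    have "herm_form M (unit_vec K b) (unit_vec K a) = (\<Sum>k<K. if k = b then M $$ (a, k) else 0)"
      unfolding herm_form_unit_right[OF M unit_vec_carrier that(1)]
      by (intro sum.cong) (auto simp: unit_vec_def)
    thus ?thesis using that by simp
  qed
  show "entries K M i j = cnj (entries K M j i)"
    using herm[of "unit_vec K j" "unit_vec K i"] ij by (simp add: unit entries_def)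
next
  fix x :: "nat \<Rightarrow> complex" assume "\<exists>i<K. x i \<noteq> 0"
  then obtain i where i: "i < K" "x i \<noteq> 0" by blast
  define v where "v = Matrix.vec K x"
  have v: "v \<in> carrier_vec K" by (simp add: v_def)
  have "v $ i \<noteq> 0\<^sub>v K $ i" using i by (simp add: v_def)
  hence "v \<noteq> 0\<^sub>v K" by metis
  from pos[OF v this] show "0 < Re (\<Sum>i<K. \<Sum>j<K. cnj (x i) * entries K M i j * x j)"
    unfolding herm_form_sum[OF M v v] by (simp add: v_def entries_def)
qed

text \<open>
The Cauchy-Schwarz inequality for the form itself, read off from a factorisation \<open>G = V V\<^sup>*\<close>.
\<close>

lemma herm_pd_entry_le:
  assumes G: "herm_pd K G" and ij: "i < K" "j < K"
  shows "norm (G i j) \<le> sqrt (Re (G i i)) * sqrt (Re (G j j))"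
proof -
  from cholesky[OF G] obtain V where V: "\<And>i j. i < K \<Longrightarrow> j < K \<Longrightarrow> G i j = mm K V (ct V) i j" by blast
  have d: "Re (G i i) = (\<Sum>k<K. (norm (V i k))\<^sup>2)" if "i < K" for i
  proof -
    have "G i i = (\<Sum>k<K. of_real ((norm (V i k))\<^sup>2))"
      using V[OF that that] by (simp add: mm_def ct_def complex_norm_square[symmetric])
    thus ?thesis by simp
  qed
  have "norm (G i j) \<le> (\<Sum>k<K. norm (V i k) * norm (V j k))"
    using V[OF ij] norm_sum[of "\<lambda>k. V i k * cnj (V j k)" "{..<K}"] by (simp add: mm_def ct_def norm_mult)
  hence "(norm (G i j))\<^sup>2 \<le> (\<Sum>k<K. norm (V i k) * norm (V j k))\<^sup>2" by (intro power_mono) auto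
  also have "\<dots> \<le> Re (G i i) * Re (G j j)"
    unfolding d[OF ij(1)] d[OF ij(2)] by (rule Cauchy_Schwarz_ineq_sum)
  finally show ?thesis
    by (simp add: real_le_rsqrt flip: real_sqrt_mult)
qed

lemma has_wirtinger_d:
  assumes "f differentiable (at z)"
  shows "has_wirtinger f (d_z f z) (d_zbar f z) z"
proof -
  let ?L = "frechet_derivative f (at z)"
  have L: "(f has_derivative ?L) (at z)" using assms by (simp add: frechet_derivative_works)
  then interpret linear ?L by (rule has_derivative_linear)
  have "?L v = d_z f z * v + d_zbar f z * cnj v" for v
  proof -
    have "?L v = ?L (Re v *\<^sub>R 1 + Im v *\<^sub>R \<i>)"
      by (rule arg_cong[of _ _ ?L]) (simp add: complex_eq_iff)
    also have "\<dots> = of_real (Re v) * ?L 1 + of_real (Im v) * ?L \<i>"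
      by (simp only: add scale) (simp add: scaleR_conv_of_real)
    also have "\<dots> = d_z f z * v + d_zbar f z * cnj v"
      unfolding d_z_def d_zbar_def
      by (subst (3 6) complex_eq) (simp add: field_simps complex_cnj)
    finally show ?thesis .
  qed
  hence "?L = (\<lambda>v. d_z f z * v + d_zbar f z * cnj v)" by (rule ext)
  thus ?thesis using L unfolding has_wirtinger_def by simp
qed

lemma permutes_less: "p permutes {0..<n} \<Longrightarrow> i < n \<Longrightarrow> p i < n" for n i :: nat
  using permutes_in_image[of p "{0..<n}" i] by simp

lemma det_differentiable:
  fixes M :: "complex \<Rightarrow> complex Matrix.mat"
  assumes "\<And>w. M w \<in> carrier_mat n n"
    and d: "\<And>i j. i < n \<Longrightarrow> j < n \<Longrightarrow> (\<lambda>w. M w $$ (i, j)) differentiable (at z)"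
  shows "(\<lambda>w. Determinant.det (M w)) differentiable (at z)"
proof -
  have prod: "(\<lambda>w::complex. \<Prod>i\<in>I. f i w) differentiable (at z)"
    if "\<And>i. i \<in> I \<Longrightarrow> (f i) differentiable (at z)" for f :: "nat \<Rightarrow> complex \<Rightarrow> complex" and I
    using that by (induction I rule: infinite_finite_induct) auto
  have "(\<lambda>w. \<Sum>p\<in>{p. p permutes {0..<n}}. signof p * (\<Prod>i = 0..<n. M w $$ (i, p i))) differentiable (at z)"
  proof (rule differentiable_sum)
    show "finite {p. p permutes {0..<n}}" by (simp add: finite_permutations)
    show "\<forall>p\<in>{p. p permutes {0..<n}}. (\<lambda>w. signof p * (\<Prod>i = 0..<n. M w $$ (i, p i))) differentiable (at z)"
      by (intro ballI differentiable_mult[OF differentiable_const prod]) (auto intro: d permutes_less)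
  qed
  thus ?thesis by (simp only: det_def'[OF assms(1)])
qed

lemma norm_det_le:
  fixes M :: "complex Matrix.mat"
  assumes M: "M \<in> carrier_mat n n" and le: "\<And>i j. i < n \<Longrightarrow> j < n \<Longrightarrow> norm (M $$ (i, j)) \<le> R"
  shows "norm (Determinant.det M) \<le> fact n * R ^ n"
proof -
  have "norm (Determinant.det M) \<le> (\<Sum>p\<in>{p. p permutes {0..<n}}. norm (signof p * (\<Prod>i = 0..<n. M $$ (i, p i))))"
    unfolding det_def'[OF M] by (rule norm_sum)
  also have "\<dots> \<le> (\<Sum>p\<in>{p. p permutes {0..<n}}. R ^ n)"
  proof (intro sum_mono)
    fix p assume "p \<in> {p. p permutes {0..<n}}"
    hence p: "p permutes {0..<n}" by simp
    have "norm (signof p :: complex) = 1" by (simp add: sign_def)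
    moreover have "(\<Prod>i = 0..<n. norm (M $$ (i, p i))) \<le> (\<Prod>i = 0..<n. R)"
      using permutes_less[OF p] by (intro prod_mono) (auto intro!: le)
    ultimately show "norm (signof p * (\<Prod>i = 0..<n. M $$ (i, p i))) \<le> R ^ n"
      by (simp add: norm_mult prod_norm[symmetric])
  qed
  also have "\<dots> = fact n * R ^ n" by (simp add: card_permutations)
  finally show ?thesis .
qed

lemma adj_mat_entry:
  assumes "M \<in> carrier_mat K K" "i < K" "j < K"
  shows "adj_mat M $$ (i, j) = (-1) ^ (j + i) * Determinant.det (mat_delete M j i)"
  using assms by (simp add: adj_mat_def cofactor_def)

text \<open>
The position of the entry in the original matrix does not depend on the matrix, so that an entry of a minor is
differentiable along a family of matrices as soon as all entries of the family are.
\<close>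

lemma mat_delete_entry:
  assumes "M \<in> carrier_mat K K" "a < K" "c < K" "i < K - 1" "j < K - 1"
  shows "\<exists>i'<K. \<exists>j'<K. \<forall>M\<in>carrier_mat K K. mat_delete M a c $$ (i, j) = M $$ (i', j')"
  using assms unfolding mat_delete_def
  by (intro exI[of _ "if i < a then i else Suc i"] exI[of _ "if j < c then j else Suc j"] conjI ballI) auto

lemma norm_adj_mat_le:
  fixes M :: "complex Matrix.mat"
  assumes M: "M \<in> carrier_mat K K" and le: "\<And>i j. i < K \<Longrightarrow> j < K \<Longrightarrow> norm (M $$ (i, j)) \<le> R"
    and ij: "i < K" "j < K"
  shows "norm (adj_mat M $$ (i, j)) \<le> fact (K - 1) * R ^ (K - 1)"
proof -
  have "norm (mat_delete M j i $$ (a, c)) \<le> R" if "a < K - 1" "c < K - 1" for a c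
    using mat_delete_entry[OF M ij(2,1) that] M le by metis
  hence "norm (Determinant.det (mat_delete M j i)) \<le> fact (K - 1) * R ^ (K - 1)"
    by (intro norm_det_le mat_delete_carrier M)
  thus ?thesis by (simp add: adj_mat_entry[OF M ij] norm_mult norm_power)
qed

text \<open>
Scaling row \<open>i\<close> and column \<open>i\<close> by \<open>d\<^sub>i\<close> for all \<open>i\<close>.
\<close>

lemma det_scaled:
  fixes M :: "complex Matrix.mat"
  assumes M: "M \<in> carrier_mat K K"
  shows "Determinant.det (Matrix.mat K K (\<lambda>(i, j). d i * d j * M $$ (i, j))) = (\<Prod>i<K. d i)\<^sup>2 * Determinant.det M"
proof -
  have "(\<Prod>i = 0..<K. Matrix.mat K K (\<lambda>(i, j). d i * d j * M $$ (i, j)) $$ (i, p i)) =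
      (\<Prod>i<K. d i)\<^sup>2 * (\<Prod>i = 0..<K. M $$ (i, p i))" if p: "p permutes {0..<K}" for p
  proof -
    have "(\<Prod>i = 0..<K. Matrix.mat K K (\<lambda>(i, j). d i * d j * M $$ (i, j)) $$ (i, p i)) =
      (\<Prod>i = 0..<K. d i * d (p i) * M $$ (i, p i))"
      using permutes_less[OF p] by (intro prod.cong) auto
    also have "\<dots> = (\<Prod>i = 0..<K. d i) * (\<Prod>i = 0..<K. d (p i)) * (\<Prod>i = 0..<K. M $$ (i, p i))"
      by (simp add: prod.distrib)
    also have "(\<Prod>i = 0..<K. d (p i)) = (\<Prod>i = 0..<K. d i)"
      using prod.permute[OF p, of d] by (simp add: o_def)
    finally show ?thesis by (simp add: power2_eq_square atLeast0LessThan)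
  qed
  thus ?thesis
    unfolding det_def'[OF M] det_def'[OF mat_carrier] sum_distrib_left
    by (intro sum.cong) (simp_all add: mult.left_commute)
qed

text \<open>
Rescaling the basis by \<open>d\<close> makes all entries of the matrix at most \<open>R\<close> and keeps the determinant \<open>1\<close>, so that the inverse is the adjugate,
whose entries are minors of bounded entries; undoing the scaling gives the weights \<open>d\<^sub>i d\<^sub>j\<close>.
With \<open>d\<^sub>i = |z|\<^bsup>\<alpha>\<^sub>i\<^esup>\<close> this turns upper bounds for an adapted metric into upper bounds for its inverse, that is, into
lower bounds for the metric.
\<close>

lemma norm_inverse_le:
  fixes d :: "nat \<Rightarrow> real"
  assumes M: "M \<in> carrier_mat K K" and det: "Determinant.det M = 1"
    and d: "\<And>i. i < K \<Longrightarrow> d i > 0" "(\<Prod>i<K. d i) = 1"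
    and le: "\<And>i j. i < K \<Longrightarrow> j < K \<Longrightarrow> d i * d j * norm (M $$ (i, j)) \<le> R"
    and B: "padded K B" "mm K B (entries K M) = ident_mat K"
    and ij: "i < K" "j < K"
  shows "norm (B i j) \<le> fact (K - 1) * R ^ (K - 1) * (d i * d j)"
proof -
  define S where "S = Matrix.mat K K (\<lambda>(i, j). of_real (d i) * of_real (d j) * M $$ (i, j))"
  have S: "S \<in> carrier_mat K K" by (simp add: S_def)
  have "Determinant.det S = (\<Prod>i<K. of_real (d i))\<^sup>2 * 1"
    unfolding S_def using det_scaled[OF M, of "\<lambda>i. of_real (d i)"] det by simp
  also have "\<dots> = 1" using d(2) by (simp flip: of_real_prod)
  finally have "Determinant.det S = 1" .
  moreover have "1 \<cdot>\<^sub>m 1\<^sub>m K = (1\<^sub>m K :: complex Matrix.mat)" by (rule eq_matI) auto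
  ultimately have "S * adj_mat S = 1\<^sub>m K" using adj_mat(2)[OF S] by simp
  hence inv: "mm K (entries K S) (entries K (adj_mat S)) = ident_mat K"
    using entries_mult[OF S adj_mat(1)[OF S]] by (simp add: entries_one)
  define X where "X = (\<lambda>i j. B i j / (of_real (d i) * of_real (d j)))"
  have padX: "padded K X" using B(1) by (simp add: X_def padded_def)
  have "mm K X (entries K S) = ident_mat K"
  proof (intro ext)
    fix i j
    show "mm K X (entries K S) i j = ident_mat K i j"
    proof (cases "i < K \<and> j < K")
      case True
      have "mm K X (entries K S) i j = (\<Sum>k<K. of_real (d j) / of_real (d i) * (B i k * entries K M k j))"
        unfolding mm_def using True d(1) by (intro sum.cong) (auto simp: X_def S_def entries_def less_imp_neq[THEN not_sym] field_simps)
      also have "\<dots> = of_real (d j) / of_real (d i) * mm K B (entries K M) i j"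
        by (simp add: mm_def sum_distrib_left)
      also have "\<dots> = ident_mat K i j"
        using True d(1)[of i] by (auto simp: B(2) ident_mat_def)
      finally show ?thesis .
    next
      case False
      thus ?thesis using padX by (auto simp: mm_def entries_def ident_mat_def padded_def)
    qed
  qed
  hence "entries K (adj_mat S) = mm K (mm K X (entries K S)) (entries K (adj_mat S))"
    by (simp add: mm_one_left)
  also have "\<dots> = X" using padX by (simp add: mm_assoc inv mm_one_right)
  finally have "X i j = adj_mat S $$ (i, j)" using ij by (metis entries_def)
  moreover have "norm (adj_mat S $$ (i, j)) \<le> fact (K - 1) * R ^ (K - 1)"
  proof (rule norm_adj_mat_le[OF S _ ij])
    fix i j assume "i < K" "j < K"
    thus "norm (S $$ (i, j)) \<le> R" using le[of i j] d(1)[of i] d(1)[of j] by (simp add: S_def norm_mult)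
  qed
  ultimately have "norm (X i j) \<le> fact (K - 1) * R ^ (K - 1)" by simp
  moreover have "norm (B i j) = norm (X i j) * (d i * d j)"
    using d(1)[OF ij(1)] d(1)[OF ij(2)] by (simp add: X_def norm_divide norm_mult)
  ultimately show ?thesis using d(1)[OF ij(1)] d(1)[OF ij(2)] by (simp add: mult_right_mono)
qed

section \<open>Harmonic metrics as solutions of Hitchin's equation\<close>

lemma herm_form_col:
  assumes "M \<in> carrier_mat K K" "X \<in> carrier_mat K K" "i < K" "j < K"
  shows "herm_form M (col X j) (unit_vec K i) = (\<Sum>k<K. M $$ (i, k) * X $$ (k, j))"
    and "herm_form M (unit_vec K j) (col X i) = (\<Sum>k<K. cnj (X $$ (k, i)) * M $$ (k, j))"
proof -
  have dims: "dim_row X = K" "dim_col X = K" using assms(2) by auto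
  have col: "col X l \<in> carrier_vec K" for l unfolding carrier_vec_def by (simp add: dims)
  show "herm_form M (col X j) (unit_vec K i) = (\<Sum>k<K. M $$ (i, k) * X $$ (k, j))"
    unfolding herm_form_unit_right[OF assms(1) col assms(3)]
    by (rule sum.cong[OF refl]) (simp add: dims assms(3,4))
  show "herm_form M (unit_vec K j) (col X i) = (\<Sum>k<K. cnj (X $$ (k, i)) * M $$ (k, j))"
    unfolding herm_form_unit_left[OF assms(1) col assms(4)]
    by (rule sum.cong[OF refl]) (simp add: dims assms(3,4))
qed

lemma pole_order_le_const: "pole_order_le (\<lambda>_. 1) 0" "pole_order_le (\<lambda>_. 0) n"
  unfolding pole_order_le_def
  by (rule exI[of _ 1], simp, rule exI[of _ "\<lambda>_. 1"], simp)
     (rule exI[of _ 1], simp, rule exI[of _ "\<lambda>_. 0"], simp)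

text \<open>
The canonical section \<open>e\<^sub>i\<close> lies in the piece of index \<open>-\<alpha>\<^sub>i\<close> of the filtration. The zero components do not obstruct
this, since the zero section has every pole order.
\<close>

lemma adapted_diagonal_growth:
  assumes H: "\<And>z. H z \<in> carrier_mat K K" and ad: "adapted K (filt_sum K \<alpha>) H"
    and i: "i < K" and \<epsilon>: "0 < \<epsilon>"
  shows "eventually (\<lambda>z. sqrt (Re (H z $$ (i, i))) \<le> norm z powr (- \<alpha> i + \<epsilon>)) at_infinity"
proof -
  define s :: section_inf where "s = (\<lambda>j z. if j = i then 1 else 0)"
  have "s j \<in> filt_line (\<alpha> j) (- \<alpha> i)" for j
  proof (cases "j = i")
    case True
    thus ?thesis using pole_order_le_const(1) by (auto simp: filt_line_def s_def intro!: exI[of _ 0])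
  next
    case False
    thus ?thesis using pole_order_le_const(2)[of "\<lfloor>\<alpha> j - \<alpha> i\<rfloor>"]
      by (auto simp: filt_line_def s_def intro!: exI[of _ "\<lfloor>\<alpha> j - \<alpha> i\<rfloor>"]) linarith
  qed
  hence "s \<in> filt_sum K \<alpha> (- \<alpha> i)" by (simp add: filt_sum_def)
  moreover have "0 < \<epsilon> / 2" using \<epsilon> by simp
  ultimately have "section_norm K H s \<in> O[at_infinity](\<lambda>z. norm (1 / z) powr (- (- \<alpha> i + \<epsilon> / 2)))"
    using ad unfolding adapted_def by blast
  then obtain C where C: "C > 0" "eventually (\<lambda>z. norm (section_norm K H s z) \<le> C * norm (norm (1 / z) powr (- (- \<alpha> i + \<epsilon> / 2)))) at_infinity"
    by (elim landau_o.bigE)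
  have norm_s: "section_norm K H s z = sqrt (Re (H z $$ (i, i)))" for z
  proof -
    have v: "Matrix.vec K (\<lambda>j. s j z) = unit_vec K i"
      by (rule eq_vecI) (auto simp: s_def unit_vec_def)
    have "herm_form (H z) (unit_vec K i) (unit_vec K i) = (\<Sum>k<K. if k = i then H z $$ (i, k) else 0)"
      unfolding herm_form_unit_right[OF H unit_vec_carrier i]
      by (intro sum.cong) (auto simp: unit_vec_def)
    thus ?thesis using i unfolding section_norm_def v by simp
  qed
  have "eventually (\<lambda>z::complex. C * norm z powr (- \<alpha> i + \<epsilon> / 2) \<le> norm z powr (- \<alpha> i + \<epsilon> / 2 + \<epsilon> / 2)) at_infinity"
    by (rule eventually_mult_powr_le) (use \<epsilon> in simp)
  with C(2) show ?thesis
  proof eventually_elim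
    case (elim z)
    have "norm (norm (1 / z) powr (- (- \<alpha> i + \<epsilon> / 2))) = norm z powr (- \<alpha> i + \<epsilon> / 2)"
      by (simp add: norm_divide powr_divide powr_minus_divide powr_diff field_simps)
    thus ?case using elim by (simp add: norm_s)
  qed
qed

locale harmonic_higgs = ordered_partition K N b \<alpha>
    for K N :: nat and b :: "nat \<Rightarrow> nat" and \<alpha> :: "nat \<Rightarrow> real" +
  fixes H :: "complex \<Rightarrow> complex Matrix.mat"
  assumes harmonic: "harmonic_metric K (filt_sum K \<alpha>) (higgs_field K b) H"
    and det_H: "\<And>z. Determinant.det (H z) = 1"
begin

definition "G z = entries K (H z)"
definition "B z = entries K (adj_mat (H z))"

lemma H_carrier [simp]: "H z \<in> carrier_mat K K"
  using harmonic by (auto simp: harmonic_metric_def hermitian_metric_def smooth_mat_def)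

lemma pd_G: "herm_pd K (G z)"
proof -
  have "hermitian_metric K H" using harmonic by (simp add: harmonic_metric_def)
  thus ?thesis
    unfolding G_def hermitian_metric_def by (intro herm_pd_entries[OF H_carrier]) blast+
qed

lemma inverse_G: "mm K (B z) (G z) = ident_mat K" "mm K (G z) (B z) = ident_mat K"
proof -
  have "1 \<cdot>\<^sub>m 1\<^sub>m K = (1\<^sub>m K :: complex Matrix.mat)" by (rule eq_matI) auto
  thus "mm K (B z) (G z) = ident_mat K" "mm K (G z) (B z) = ident_mat K"
    unfolding B_def G_def
    using adj_mat[OF H_carrier[of z]]
    by (simp_all add: det_H entries_one flip: entries_mult)
qed

lemma smooth_mat_differentiable:
  assumes "smooth_mat K M" "i < K" "j < K"
  shows "(\<lambda>w. M w $$ (i, j)) differentiable (at z)"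
proof -
  have "C_k (Suc 0) (\<lambda>w. M w $$ (i, j))" using assms unfolding smooth_mat_def by blast
  thus ?thesis by simp
qed

lemma smooth_entries_mwirt:
  assumes "smooth_mat K M"
  shows "has_mwirt (\<lambda>w. entries K (M w))
     (\<lambda>i j. if i < K \<and> j < K then d_z (\<lambda>w. M w $$ (i, j)) z else 0)
     (\<lambda>i j. if i < K \<and> j < K then d_zbar (\<lambda>w. M w $$ (i, j)) z else 0) z"
  unfolding has_mwirt_def entries_def
  using has_wirtinger_d[OF smooth_mat_differentiable[OF assms]] has_wirtinger_const by auto

lemma growth_G:
  assumes "i < K" "j < K" "0 < \<epsilon>"
  shows "eventually (\<lambda>z. norm (G z i j) \<le> norm z powr (- \<alpha> i - \<alpha> j + \<epsilon>)) at_infinity"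
proof -
  have ad: "adapted K (filt_sum K \<alpha>) H" using harmonic by (simp add: harmonic_metric_def)
  have e: "0 < \<epsilon> / 2" using assms by simp
  show ?thesis
    using adapted_diagonal_growth[OF H_carrier ad assms(1) e] adapted_diagonal_growth[OF H_carrier ad assms(2) e]
  proof eventually_elim
    case (elim z)
    have "norm (G z i j) \<le> sqrt (Re (G z i i)) * sqrt (Re (G z j j))"
      by (rule herm_pd_entry_le[OF pd_G assms(1,2)])
    also have "\<dots> \<le> norm z powr (- \<alpha> i + \<epsilon> / 2) * norm z powr (- \<alpha> j + \<epsilon> / 2)"
      using elim assms herm_pd_diag(1)[OF pd_G, of j z]
      by (intro mult_mono) (auto simp: G_def entries_def)
    also have "\<dots> = norm z powr (- \<alpha> i - \<alpha> j + \<epsilon>)"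
      by (simp add: algebra_simps flip: powr_add)
    finally show ?case .
  qed
qed

lemma growth_B:
  assumes ij: "i < K" "j < K" and e: "0 < \<epsilon>"
  shows "eventually (\<lambda>z. norm (B z i j) \<le> norm z powr (\<alpha> i + \<alpha> j + \<epsilon>)) at_infinity"
proof -
  \<comment> \<open>the adjugate is a sum of products of \<open>K - 1\<close> entries, each of which loses \<open>\<delta>\<close>\<close>
  define \<delta> where "\<delta> = \<epsilon> / (2 * real K)"
  have d: "0 < \<delta>" using e K_pos by (simp add: \<delta>_def)
  have "\<forall>i\<in>{..<K}. \<forall>j\<in>{..<K}. eventually (\<lambda>z. norm (G z i j) \<le> norm z powr (- \<alpha> i - \<alpha> j + \<delta>)) at_infinity"
    using growth_G[OF _ _ d] by auto
  hence ev: "eventually (\<lambda>z. \<forall>i\<in>{..<K}. \<forall>j\<in>{..<K}. norm (G z i j) \<le> norm z powr (- \<alpha> i - \<alpha> j + \<delta>)) at_infinity"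
    by (intro eventually_ball_finite ballI finite_lessThan) auto
  have ev1: "eventually (\<lambda>z::complex. norm z \<ge> 1) at_infinity"
    unfolding eventually_at_infinity by blast
  have e2: "0 < \<epsilon> / 2" using e by simp
  from ev ev1 eventually_mult_powr_le[OF e2, of "fact (K - 1)" "\<alpha> i + \<alpha> j + \<epsilon> / 2"]
  show ?thesis
  proof eventually_elim
    case (elim z)
    have z: "norm z > 0" using elim(2) by linarith
    have "norm (B z i j) \<le> fact (K - 1) * (norm z powr \<delta>) ^ (K - 1) * (norm z powr \<alpha> i * norm z powr \<alpha> j)"
    proof (rule norm_inverse_le[OF H_carrier det_H _ _ _ _ _ ij])
      show "0 < norm z powr \<alpha> i" for i using z by simp
      have "(\<Prod>i<K. norm z powr \<alpha> i) = norm z powr (\<Sum>i<K. \<alpha> i)"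
        using z by (simp add: powr_sum)
      thus "(\<Prod>i<K. norm z powr \<alpha> i) = 1" using z sum_weights by simp
      show "norm z powr \<alpha> i * norm z powr \<alpha> j * norm (H z $$ (i, j)) \<le> norm z powr \<delta>"
        if "i < K" "j < K" for i j
      proof -
        have "norm (H z $$ (i, j)) \<le> norm z powr (- \<alpha> i - \<alpha> j + \<delta>)"
          using elim(1) that by (auto simp: G_def entries_def)
        hence "norm z powr \<alpha> i * norm z powr \<alpha> j * norm (H z $$ (i, j)) \<le>
            norm z powr \<alpha> i * norm z powr \<alpha> j * norm z powr (- \<alpha> i - \<alpha> j + \<delta>)"
          by (intro mult_left_mono) auto
        also have "\<dots> = norm z powr \<delta>" by (simp flip: powr_add)
        finally show ?thesis .
      qed
      show "padded K (B z)" by (simp add: B_def)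
      show "mm K (B z) (entries K (H z)) = ident_mat K" using inverse_G(1) by (simp add: G_def)
    qed
    also have "(norm z powr \<delta>) ^ (K - 1) = norm z powr (real (K - 1) * \<delta>)"
      using z by (simp add: powr_power mult.commute)
    also have "\<dots> \<le> norm z powr (\<epsilon> / 2)"
    proof (rule powr_mono)
      have "real (K - 1) * \<delta> \<le> real K * \<delta>" using d by (intro mult_right_mono) auto
      also have "\<dots> = \<epsilon> / 2" using K_pos by (simp add: \<delta>_def)
      finally show "real (K - 1) * \<delta> \<le> \<epsilon> / 2" .
    qed (use elim(2) in auto)
    also have "fact (K - 1) * norm z powr (\<epsilon> / 2) * (norm z powr \<alpha> i * norm z powr \<alpha> j) =
        fact (K - 1) * norm z powr (\<alpha> i + \<alpha> j + \<epsilon> / 2)"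
      by (simp add: powr_add)
    also have "\<dots> \<le> norm z powr (\<alpha> i + \<alpha> j + \<epsilon>)" using elim(3) by (simp add: algebra_simps)
    finally show ?case by (simp add: mult_left_mono mult_right_mono)
  qed
qed

lemma entries_higgs_field: "entries K (higgs_field K b z) = higgs_matrix z"
  using K_pos by (auto simp: entries_def higgs_field_def higgs_matrix_def fun_eq_iff)

text \<open>
A translation of the matrix equations into entries: the two equations of the Chern connection become
\<open>\<partial>G = G A\<close> and \<open>\<partial>\<^sup>-G = A\<^sup>* G\<close>, the equation for the curvature becomes \<open>\<partial>\<^sup>-A = [\<Phi>, \<Psi>]\<close>. The inverse is differentiable
because it is the adjugate.
\<close>

lemma higgs_solution_exists: "\<exists>A \<Psi>. higgs_solution K N b \<alpha> G B A \<Psi>"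
proof -
  obtain A0 B0 \<Psi>0 where chern: "chern_connection K H A0 B0"
    and adj: "\<And>z. is_adjoint K (H z) (higgs_field K b z) (\<Psi>0 z)"
    and curv: "\<And>z. curvature K A0 B0 z + (higgs_field K b z * \<Psi>0 z - \<Psi>0 z * higgs_field K b z) = 0\<^sub>m K K"
    using harmonic unfolding harmonic_metric_def by blast
  have A0: "smooth_mat K A0" and B0: "\<And>z. B0 z = 0\<^sub>m K K" using chern by (auto simp: chern_connection_def)
  have B0_carrier: "B0 z \<in> carrier_mat K K" for z by (simp add: B0)
  have A0_carrier [simp]: "A0 z \<in> carrier_mat K K" for z using A0 by (simp add: smooth_mat_def)
  have Psi0 [simp]: "\<Psi>0 z \<in> carrier_mat K K" for z using adj by (simp add: is_adjoint_def)
  have dims [simp]: "dim_row (\<Psi>0 z) = K" "dim_col (\<Psi>0 z) = K" "dim_row (A0 z) = K" "dim_col (A0 z) = K" for z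
    by (rule carrier_matD[OF Psi0] carrier_matD[OF A0_carrier])+
  have Phi0 [simp]: "higgs_field K b z \<in> carrier_mat K K" for z by (simp add: higgs_field_def)
  have H_smooth: "smooth_mat K H" using harmonic by (simp add: harmonic_metric_def hermitian_metric_def)
  define A where "A = (\<lambda>z. entries K (A0 z))"
  define \<Psi> where "\<Psi> = (\<lambda>z. entries K (\<Psi>0 z))"
  have "higgs_solution K N b \<alpha> G B A \<Psi>"
  proof (intro higgs_solution.intro ordered_partition_axioms higgs_solution_axioms.intro growth_B growth_G)
    show "hitchin_solution K higgs_matrix G B A \<Psi>"
    proof
      show "0 < K" by (rule K_pos)
      show "padded K (higgs_matrix z)" "padded K (G z)" "padded K (B z)" "padded K (A z)" "padded K (\<Psi> z)" for z
        by (simp_all add: G_def B_def A_def \<Psi>_def)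
      show "herm_pd K (G z)" for z by (rule pd_G)
      show "mm K (B z) (G z) = ident_mat K" "mm K (G z) (B z) = ident_mat K" for z by (rule inverse_G)+
      show "has_mwirt G (mm K (G z) (A z)) (mm K (ct (A z)) (G z)) z" for z
      proof -
        have "(\<lambda>i j. if i < K \<and> j < K then d_z (\<lambda>w. H w $$ (i, j)) z else 0) = mm K (G z) (A z)"
        proof (intro ext)
          fix i j
          show "(if i < K \<and> j < K then d_z (\<lambda>w. H w $$ (i, j)) z else 0) = mm K (G z) (A z) i j"
          proof (cases "i < K \<and> j < K")
            case True
            have "d_z (\<lambda>w. H w $$ (i, j)) z = herm_form (H z) (col (A0 z) j) (unit_vec K i)
                + herm_form (H z) (unit_vec K j) (col (B0 z) i)"
              using chern True unfolding chern_connection_def by blast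
            also have "\<dots> = mm K (G z) (A z) i j"
              using True B0_carrier[of z]
              by (simp add: herm_form_col[of _ K] mm_def G_def A_def entries_def) (simp add: B0)
            finally show ?thesis using True by simp
          qed (auto simp: mm_def G_def A_def entries_def)
        qed
        moreover have "(\<lambda>i j. if i < K \<and> j < K then d_zbar (\<lambda>w. H w $$ (i, j)) z else 0) = mm K (ct (A z)) (G z)"
        proof (intro ext)
          fix i j
          show "(if i < K \<and> j < K then d_zbar (\<lambda>w. H w $$ (i, j)) z else 0) = mm K (ct (A z)) (G z) i j"
          proof (cases "i < K \<and> j < K")
            case True
            have "d_zbar (\<lambda>w. H w $$ (i, j)) z = herm_form (H z) (col (B0 z) j) (unit_vec K i)
                + herm_form (H z) (unit_vec K j) (col (A0 z) i)"
              using chern True unfolding chern_connection_def by blast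
            also have "\<dots> = mm K (ct (A z)) (G z) i j"
              using True B0_carrier[of z]
              by (simp add: herm_form_col[of _ K] mm_def ct_def G_def A_def entries_def) (simp add: B0)
            finally show ?thesis using True by simp
          qed (auto simp: mm_def ct_def G_def A_def entries_def)
        qed
        ultimately show ?thesis
          using smooth_entries_mwirt[OF H_smooth, of z] unfolding G_def by simp
      qed
      show "\<exists>P Q. has_mwirt B P Q z" for z
      proof -
        have diff: "(\<lambda>w. adj_mat (H w) $$ (i, j)) differentiable (at z)" if ij: "i < K" "j < K" for i j
        proof -
          have "(\<lambda>w. mat_delete (H w) j i $$ (a, c)) differentiable (at z)" if ac: "a < K - 1" "c < K - 1" for a c
          proof -
            obtain a' c' where "a' < K" "c' < K" "\<forall>M\<in>carrier_mat K K. mat_delete M j i $$ (a, c) = (M $$ (a', c') :: complex)"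
              using mat_delete_entry[OF H_carrier[of z] ij(2,1) ac] by blast
            thus ?thesis using smooth_mat_differentiable[OF H_smooth, of a' c' z] by simp
          qed
          hence "(\<lambda>w. Determinant.det (mat_delete (H w) j i)) differentiable (at z)"
            by (intro det_differentiable[where n = "K - 1"] mat_delete_carrier H_carrier)
          thus ?thesis
            unfolding adj_mat_entry[OF H_carrier ij] by (intro differentiable_mult differentiable_const)
        qed
        have "has_mwirt B (\<lambda>i j. if i < K \<and> j < K then d_z (\<lambda>w. adj_mat (H w) $$ (i, j)) z else 0)
            (\<lambda>i j. if i < K \<and> j < K then d_zbar (\<lambda>w. adj_mat (H w) $$ (i, j)) z else 0) z"
          unfolding has_mwirt_def B_def entries_def
          using has_wirtinger_d[OF diff] has_wirtinger_const by auto
        thus ?thesis by blast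
      qed
      show "\<exists>P. has_mwirt A P (mm K (higgs_matrix z) (\<Psi> z) - mm K (\<Psi> z) (higgs_matrix z)) z" for z
      proof -
        have "(\<lambda>i j. if i < K \<and> j < K then d_zbar (\<lambda>w. A0 w $$ (i, j)) z else 0) =
            mm K (higgs_matrix z) (\<Psi> z) - mm K (\<Psi> z) (higgs_matrix z)"
        proof (intro ext)
          fix i j
          show "(if i < K \<and> j < K then d_zbar (\<lambda>w. A0 w $$ (i, j)) z else 0) =
            (mm K (higgs_matrix z) (\<Psi> z) - mm K (\<Psi> z) (higgs_matrix z)) i j"
          proof (cases "i < K \<and> j < K")
            case True
            have z0: "d_z (\<lambda>w. B0 w $$ (i, j)) z = 0"
              using True by (simp add: B0 d_z_def)
            have prods: "mm K (higgs_matrix z) (\<Psi> z) i j = (higgs_field K b z * \<Psi>0 z) $$ (i, j)"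
              "mm K (\<Psi> z) (higgs_matrix z) i j = (\<Psi>0 z * higgs_field K b z) $$ (i, j)"
              unfolding \<Psi>_def entries_higgs_field[symmetric] entries_mult[OF Phi0 Psi0, symmetric]
                entries_mult[OF Psi0 Phi0, symmetric] using True by (simp_all add: entries_def)
            have "(A0 z * B0 z - B0 z * A0 z) $$ (i, j) = 0"
              using True by (simp add: B0 right_mult_zero_mat[of _ K] left_mult_zero_mat[of _ K])
            moreover have "(curvature K A0 B0 z + (higgs_field K b z * \<Psi>0 z - \<Psi>0 z * higgs_field K b z)) $$ (i, j) = 0"
              unfolding curv using True by simp
            ultimately have "- d_zbar (\<lambda>w. A0 w $$ (i, j)) z + (mm K (higgs_matrix z) (\<Psi> z) i j - mm K (\<Psi> z) (higgs_matrix z) i j) = 0"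
              unfolding prods curvature_def mat_d_z_def mat_d_zbar_def
              using True z0 A0_carrier[of z] Psi0[of z] Phi0[of z] by (simp add: B0 del: index_mult_mat(1))
            thus ?thesis using True by (simp add: algebra_simps)
          next
            case False
            thus ?thesis using padded_higgs_matrix[of z] by (auto simp: mm_def padded_def \<Psi>_def entries_def)
          qed
        qed
        thus ?thesis using smooth_entries_mwirt[OF A0, of z] unfolding A_def by auto
      qed
      show "mm K (ct (higgs_matrix z)) (G z) = mm K (G z) (\<Psi> z)" for z
      proof -
        have "mm K (G z) (higgs_matrix z) i j = mm K (ct (\<Psi> z)) (G z) i j" if ij: "i < K" "j < K" for i j
        proof -
          have "higgs_field K b z *\<^sub>v unit_vec K j = col (higgs_field K b z) j"
            using ij by (intro eq_vecI) (auto simp: higgs_field_def)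
          moreover have "\<Psi>0 z *\<^sub>v unit_vec K i = col (\<Psi>0 z) i"
            using ij Psi0[of z] by (intro eq_vecI) auto
          moreover have "herm_form (H z) (higgs_field K b z *\<^sub>v unit_vec K j) (unit_vec K i) =
              herm_form (H z) (unit_vec K j) (\<Psi>0 z *\<^sub>v unit_vec K i)"
            using adj[of z] unfolding is_adjoint_def by simp
          ultimately have "herm_form (H z) (col (higgs_field K b z) j) (unit_vec K i) =
              herm_form (H z) (unit_vec K j) (col (\<Psi>0 z) i)" by simp
          thus ?thesis
            using ij Psi0[of z] Phi0[of z]
            by (simp add: herm_form_col[of _ K] mm_def ct_def G_def \<Psi>_def
                entries_higgs_field[symmetric] entries_def)
        qed
        moreover have "padded K (mm K (G z) (higgs_matrix z))" "padded K (mm K (ct (\<Psi> z)) (G z))"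
          by (simp_all add: G_def \<Psi>_def)
        ultimately have "mm K (G z) (higgs_matrix z) = mm K (ct (\<Psi> z)) (G z)"
          unfolding padded_def by (intro ext) metis
        hence "ct (mm K (G z) (higgs_matrix z)) = ct (mm K (ct (\<Psi> z)) (G z))" by simp
        moreover have "ct (G z) = G z" by (rule herm_pd_ct[OF pd_G]) (simp add: G_def)
        ultimately show ?thesis by (simp add: ct_mm)
      qed
    qed
  qed
  thus ?thesis by blast
qed

end

section \<open>The radial Toda equation and its boundary values\<close>

lemma has_wirtinger_rotation:
  assumes "has_wirtinger f p q z"
  shows "((\<lambda>\<theta>. f (cis \<theta> * z)) has_vector_derivative (\<i> * z * p + cnj (\<i> * z) * q)) (at 0)"
proof -
  have d1: "((\<lambda>\<theta>::real. cis \<theta> * z) has_derivative (\<lambda>t. t *\<^sub>R (\<i> * z))) (at 0)"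
    by (auto intro!: derivative_eq_intros)
  have d2: "(f has_derivative (\<lambda>v. p * v + q * cnj v)) (at (cis 0 * z))"
    using assms by (simp add: has_wirtinger_def)
  have "((\<lambda>\<theta>. f (cis \<theta> * z)) has_derivative (\<lambda>t. p * (t *\<^sub>R (\<i> * z)) + q * cnj (t *\<^sub>R (\<i> * z)))) (at 0)"
    by (rule has_derivative_compose[OF d1 d2])
  moreover have "(\<lambda>t. p * (t *\<^sub>R (\<i> * z)) + q * cnj (t *\<^sub>R (\<i> * z))) = (\<lambda>t. t *\<^sub>R (\<i> * z * p + cnj (\<i> * z) * q))"
    by (simp add: fun_eq_iff scaleR_conv_of_real algebra_simps)
  ultimately show ?thesis unfolding has_vector_derivative_def by simp
qed

lemma has_wirtinger_along_reals:
  assumes "has_wirtinger f p q (of_real r)"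
  shows "((\<lambda>r. Re (f (of_real r))) has_real_derivative Re (p + q)) (at r)"
  using has_wirtinger_real_direction(1)[OF assms] DERIV_shift[of "\<lambda>r. Re (f (of_real r))" _ 0 r]
  by (simp add: add.commute)

context higgs_solution
begin

lemma G_pos: "i < K \<Longrightarrow> Re (G z i i) > 0" "i < K \<Longrightarrow> G z i i = of_real (Re (G z i i))"
  using herm_pd_diag[OF sol.pd, of i z] by (auto simp: complex_eq_iff)

lemma G_nz: "i < K \<Longrightarrow> G z i i \<noteq> 0"
  using G_pos(1)[of i z] by auto

lemma mm_G_left: "i < K \<Longrightarrow> j < K \<Longrightarrow> mm K (G z) X i j = G z i i * X i j"
proof -
  assume ij: "i < K" "j < K"
  have "mm K (G z) X i j = (\<Sum>k<K. if k = i then G z i i * X i j else 0)"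
    unfolding mm_def using G_diagonal ij by (intro sum.cong) auto
  thus ?thesis using ij by simp
qed

lemma mm_G_right: "i < K \<Longrightarrow> j < K \<Longrightarrow> mm K X (G z) i j = X i j * G z j j"
proof -
  assume ij: "i < K" "j < K"
  have "mm K X (G z) i j = (\<Sum>k<K. if k = j then X i j * G z j j else 0)"
    unfolding mm_def using G_diagonal ij by (intro sum.cong) auto
  thus ?thesis using ij by simp
qed

lemma dG_diagonal:
  "i < K \<Longrightarrow> has_wirtinger (\<lambda>w. G w i i) (G z i i * A z i i) (cnj (A z i i) * G z i i) z"
  using sol.dG[of z] unfolding has_mwirt_def
  by (metis mm_G_left mm_G_right ct_def)

text \<open>
Differentiating the radial function \<open>G\<^sub>i\<^sub>i\<close>; the connection form \<open>A\<^sub>i\<^sub>i dz\<close> is invariant under rotations.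
\<close>

lemma A_rotate:
  assumes "i < K" "norm c = 1"
  shows "A (c * z) i i = cnj c * A z i i"
proof -
  have "has_wirtinger (\<lambda>w. G (c * w) i i) (smul c (mm K (G (c * z)) (A (c * z))) i i)
      (smul (cnj c) (mm K (ct (A (c * z))) (G (c * z))) i i) z"
    using has_mwirt_rotate[OF sol.dG, of c z] unfolding has_mwirt_def by blast
  hence "has_wirtinger (\<lambda>w. G w i i) (smul c (mm K (G (c * z)) (A (c * z))) i i)
      (smul (cnj c) (mm K (ct (A (c * z))) (G (c * z))) i i) z"
    by (simp add: G_radial[OF assms(2)])
  from has_wirtinger_unique(1)[OF this dG_diagonal[OF assms(1)]]
  have "G z i i * (c * A (c * z) i i) = G z i i * A z i i"
    by (simp add: smul_def mm_G_left[OF assms(1,1)] G_radial[OF assms(2)] mult_ac)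
  hence "c * A (c * z) i i = A z i i" using G_nz[OF assms(1)] by simp
  hence "cnj c * (c * A (c * z) i i) = cnj c * A z i i" by simp
  thus ?thesis using unimodular_cnj[OF assms(2)] by (simp flip: mult.assoc)
qed

text \<open>
\<open>h\<^sub>i\<close> is the squared length of \<open>e\<^sub>i\<close>, \<open>a\<^sub>i\<close> is half the derivative of \<open>ln h\<^sub>i\<close>, and \<open>toda_term\<close> is the square of the norm of
\<open>\<phi> e\<^sub>i\<^sub>+\<^sub>1\<close> relative to that of \<open>e\<^sub>i\<^sub>+\<^sub>1\<close>.
\<close>

definition "h i r = Re (G (of_real r) i i)"
definition "a i r = Re (A (of_real r) i i)"
definition "toda_term i r = r ^ (2 * b i) * (h i r / h ((i + 1) mod K) r)"

lemma h_pos: "i < K \<Longrightarrow> h i r > 0"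
  unfolding h_def by (rule G_pos)

lemma h_derivative:
  assumes "i < K"
  shows "(h i has_real_derivative 2 * h i r * a i r) (at r)"
proof -
  let ?z = "complex_of_real r"
  have "(h i has_real_derivative Re (G ?z i i * A ?z i i + cnj (A ?z i i) * G ?z i i)) (at r)"
    unfolding h_def by (rule has_wirtinger_along_reals[OF dG_diagonal[OF assms]])
  moreover have "Im (G ?z i i) = 0" by (rule herm_pd_diag(2)[OF sol.pd assms])
  ultimately show ?thesis by (simp add: h_def a_def algebra_simps)
qed

lemma Psi_entry:
  assumes "i < K" "j < K"
  shows "\<Psi> z i j = cnj (higgs_matrix z j i) * (G z j j / G z i i)"
proof -
  have "cnj (higgs_matrix z j i) * G z j j = G z i i * \<Psi> z i j"
    using fun_cong[OF fun_cong[OF sol.adj], of z i j] mm_G_left[OF assms] mm_G_right[OF assms]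
    by (simp add: ct_def)
  thus ?thesis using G_nz[OF assms(1), of z] by (simp add: field_simps)
qed

text \<open>
For a diagonal metric the adjoint of \<open>\<Phi>\<close> has the entries \<open>cnj \<Phi>\<^sub>j\<^sub>i G\<^sub>j\<^sub>j / G\<^sub>i\<^sub>i\<close>, and each of the two products has
a single term on the diagonal.
\<close>

lemma curvature_entry:
  assumes "i < K"
  shows "(mm K (higgs_matrix (of_real r)) (\<Psi> (of_real r)) - mm K (\<Psi> (of_real r)) (higgs_matrix (of_real r))) i i
      = of_real (toda_term i r - toda_term ((i + K - 1) mod K) r)"
proof -
  let ?z = "complex_of_real r"
  have toda: "of_real (toda_term j r) = ?z ^ b j * (cnj (?z ^ b j) * (G ?z j j / G ?z ((j + 1) mod K) ((j + 1) mod K)))"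
    if "j < K" for j
  proof -
    have lt: "(j + 1) mod K < K" using K_pos by simp
    have "G ?z j j = of_real (h j r)" "G ?z ((j + 1) mod K) ((j + 1) mod K) = of_real (h ((j + 1) mod K) r)"
      unfolding h_def by (rule G_pos(2)[OF that]) (rule G_pos(2)[OF lt])
    thus ?thesis by (simp add: toda_term_def power_mult power2_eq_square mult_ac power_mult_distrib)
  qed
  define k where "k = (i + K - 1) mod K"
  have k: "k < K" "(k + 1) mod K = i" using cyclic_pred_succ(2)[OF assms] K_pos by (auto simp: k_def)
  have lt: "(i + 1) mod K < K" using K_pos by simp
  have "mm K (higgs_matrix ?z) (\<Psi> ?z) i i = of_real (toda_term i r)"
    unfolding mm_higgs_left[OF assms] Psi_entry[OF lt assms] toda[OF assms] using assms by (simp add: higgs_matrix_def)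
  moreover have "mm K (\<Psi> ?z) (higgs_matrix ?z) i i = of_real (toda_term k r)"
    using mm_higgs_right[OF k(1), of "\<Psi> ?z" ?z i] unfolding Psi_entry[OF assms k(1)] toda[OF k(1)] k(2)
    using k by (simp add: higgs_matrix_def mult_ac)
  ultimately show ?thesis by (simp add: k_def)
qed

text \<open>
Write \<open>P\<close> and \<open>Q\<close> for the \<open>z\<close>- and \<open>z\<^sup>-\<close>-derivatives of \<open>A\<^sub>i\<^sub>i\<close> at the real point \<open>r\<close>. The equation gives \<open>Q\<close>. Differentiating
the rotation rule in the angle gives \<open>r (P - Q) = -A\<^sub>i\<^sub>i\<close>, and the derivative along the reals
is \<open>P + Q\<close>. Since \<open>2 a\<^sub>i = (ln h\<^sub>i)'\<close>, this is the radial form of the Laplacian of \<open>ln h\<^sub>i\<close>.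
\<close>

lemma a_derivative:
  assumes "i < K" "r \<noteq> 0"
  shows "(a i has_real_derivative 2 * (toda_term i r - toda_term ((i + K - 1) mod K) r) - a i r / r) (at r)"
proof -
  let ?z = "complex_of_real r"
  define q where "q = toda_term i r - toda_term ((i + K - 1) mod K) r"
  obtain P where "has_mwirt A P (mm K (higgs_matrix ?z) (\<Psi> ?z) - mm K (\<Psi> ?z) (higgs_matrix ?z)) ?z"
    using sol.dA by blast
  hence A: "has_wirtinger (\<lambda>w. A w i i) (P i i) (of_real q) ?z"
    using curvature_entry[OF assms(1)] unfolding has_mwirt_def q_def by metis
  have "((\<lambda>\<theta>. A (cis \<theta> * ?z) i i) has_vector_derivative (\<i> * ?z * P i i + cnj (\<i> * ?z) * of_real q)) (at 0)"
    by (rule has_wirtinger_rotation[OF A])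
  moreover have "((\<lambda>\<theta>. A (cis \<theta> * ?z) i i) has_vector_derivative (- \<i> * A ?z i i)) (at 0)"
  proof -
    have "((\<lambda>\<theta>. cis (- \<theta>) * A ?z i i) has_derivative (\<lambda>t. t *\<^sub>R (- \<i> * A ?z i i))) (at 0)"
      by (auto intro!: derivative_eq_intros)
    thus ?thesis unfolding has_vector_derivative_def by (simp add: A_rotate[OF assms(1)] cis_cnj)
  qed
  ultimately have "\<i> * ?z * P i i + cnj (\<i> * ?z) * of_real q = - \<i> * A ?z i i"
    by (rule vector_derivative_unique_at)
  hence "\<i> * (?z * (P i i - of_real q)) = \<i> * (- A ?z i i)" by (simp add: algebra_simps)
  hence "?z * (P i i - of_real q) = - A ?z i i" by (simp only: mult_cancel_left complex_i_not_zero if_False) simp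
  hence P: "P i i = of_real q - A ?z i i / ?z" using assms(2) by (simp add: field_simps)
  have "(a i has_real_derivative Re (P i i + of_real q)) (at r)"
    unfolding a_def by (rule has_wirtinger_along_reals[OF A])
  moreover have "Re (P i i + of_real q) = 2 * q - a i r / r" by (simp add: P a_def Re_divide_of_real)
  ultimately show ?thesis unfolding q_def by (simp only:)
qed

lemma continuous_h: "i < K \<Longrightarrow> isCont (h i) r"
  using h_derivative DERIV_isCont by blast

lemma continuous_a: "i < K \<Longrightarrow> isCont (a i) r"
proof -
  assume i: "i < K"
  obtain P Q where "has_wirtinger (\<lambda>w. A w i i) P Q (of_real r)"
    using sol.dA[of "of_real r"] unfolding has_mwirt_def by blast
  from has_wirtinger_along_reals[OF this] show ?thesis unfolding a_def by (rule DERIV_isCont)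
qed

definition "u i r = ln (h i r) + 2 * \<alpha> i * ln r"
definition "u' i r = 2 * a i r + 2 * \<alpha> i / r"
definition "u'' i r = 2 * (2 * (toda_term i r - toda_term ((i + K - 1) mod K) r) - a i r / r) - 2 * \<alpha> i / r\<^sup>2"

lemma u_derivative: "i < K \<Longrightarrow> r > 0 \<Longrightarrow> (u i has_real_derivative u' i r) (at r)"
  unfolding u_def u'_def using h_pos[of i r]
  by (auto intro!: derivative_eq_intros h_derivative simp: field_simps)

lemma u'_derivative: "i < K \<Longrightarrow> r > 0 \<Longrightarrow> (u' i has_real_derivative u'' i r) (at r)"
  unfolding u'_def u''_def
  by (auto intro!: derivative_eq_intros a_derivative simp: field_simps power2_eq_square)

lemma exp_u: "i < K \<Longrightarrow> r > 0 \<Longrightarrow> exp (u i r) = h i r * r powr (2 * \<alpha> i)"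
  using h_pos[of i r] by (simp add: u_def exp_add powr_def mult_ac)

lemma toda_term_eq:
  assumes "i < K" "r > 0"
  shows "toda_term i r = r powr (2 * real N / real K) * exp (u i r - u ((i + 1) mod K) r)"
proof -
  have lt: "(i + 1) mod K < K" using K_pos by simp
  have "2 * real N / real K + 2 * \<alpha> i - 2 * \<alpha> ((i + 1) mod K) = real (2 * b i)"
    using weights[OF assms(1)] by simp
  hence pw: "r powr (2 * real N / real K) * r powr (2 * \<alpha> i) / r powr (2 * \<alpha> ((i + 1) mod K)) = r ^ (2 * b i)"
    using assms(2) by (simp only: powr_add[symmetric] powr_diff[symmetric] powr_realpow)
  have rearr: "x * (h i r * y / (h ((i + 1) mod K) r * z)) = (x * y / z) * (h i r / h ((i + 1) mod K) r)" for x y z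
    by (simp add: divide_inverse mult_ac)
  show ?thesis
    unfolding exp_diff exp_u[OF assms] exp_u[OF lt assms(2)] toda_term_def rearr pw ..
qed

lemma radial_toda:
  assumes "i < K" "r > 0"
  shows "1 / 4 * (u'' i r + 1 / r * u' i r) =
         r powr (2 * real N / real K) *
           (exp (u i r - u ((i + 1) mod K) r) - exp (u ((i + K - 1) mod K) r - u i r))"
proof -
  have k: "(i + K - 1) mod K < K" "((i + K - 1) mod K + 1) mod K = i"
    using cyclic_pred_succ(2)[OF assms(1)] K_pos by auto
  have "1 / 4 * (u'' i r + 1 / r * u' i r) = toda_term i r - toda_term ((i + K - 1) mod K) r"
    using assms(2) by (simp add: u''_def u'_def field_simps power2_eq_square)
  thus ?thesis
    using toda_term_eq[OF assms] toda_term_eq[OF k(1) assms(2)] unfolding k(2) by (simp add: right_diff_distrib)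
qed

text \<open>
The upper bound for \<open>u\<^sub>i\<close> comes from the growth of the metric, the lower bound from the growth of its inverse. Any loss
\<open>\<epsilon>\<close> would do; \<open>\<epsilon> = 1\<close> suffices for the decay estimate.
\<close>

lemma u_sublinear:
  assumes i: "i < K"
  shows "eventually (\<lambda>r. \<bar>u i r\<bar> \<le> ln r) at_top"
proof -
  obtain R where R: "\<And>z. norm z \<ge> R \<Longrightarrow> norm (G z i i) \<le> norm z powr (- \<alpha> i - \<alpha> i + 1)"
    using growth_G[OF i i, of 1] unfolding eventually_at_infinity by auto
  obtain S where S: "\<And>z. norm z \<ge> S \<Longrightarrow> norm (B z i i) \<le> norm z powr (\<alpha> i + \<alpha> i + 1)"
    using growth_B[OF i i, of 1] unfolding eventually_at_infinity by auto
  have "\<bar>u i r\<bar> \<le> ln r" if r: "r \<ge> max 1 (max R S)" for r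
  proof -
    have r0: "r > 0" using r by simp
    have h: "G (of_real r) i i = of_real (h i r)" unfolding h_def by (rule G_pos(2)[OF i])
    have "G (of_real r) i i * B (of_real r) i i = 1"
      using fun_cong[OF fun_cong[OF sol.inv(2)], of "of_real r" i i] i by (simp add: mm_G_left ident_mat_def)
    hence "norm (of_real (h i r) * B (of_real r) i i) = 1" unfolding h by simp
    hence hB: "h i r * norm (B (of_real r) i i) = 1" using h_pos[OF i, of r] by (simp add: norm_mult)
    have "h i r \<le> r powr (- \<alpha> i - \<alpha> i + 1)"
      using R[of "of_real r"] r h h_pos[OF i, of r] by simp
    hence "ln (h i r) \<le> ln (r powr (- \<alpha> i - \<alpha> i + 1))" using h_pos[OF i, of r] by (intro ln_mono)
    hence 1: "u i r \<le> ln r" using r0 by (simp add: u_def ln_powr algebra_simps)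
    have "norm (B (of_real r) i i) = 1 / h i r" using hB h_pos[OF i, of r] by (simp add: field_simps)
    hence "1 / h i r \<le> r powr (\<alpha> i + \<alpha> i + 1)" using S[of "of_real r"] r by simp
    hence "ln (1 / h i r) \<le> ln (r powr (\<alpha> i + \<alpha> i + 1))" using h_pos[OF i, of r] by (intro ln_mono) simp_all
    hence 2: "- u i r \<le> ln r" using r0 h_pos[OF i, of r] by (simp add: u_def ln_powr ln_div algebra_simps)
    show ?thesis using 1 2 by simp
  qed
  thus ?thesis unfolding eventually_at_top_linorder by blast
qed

text \<open>
This exponent of the statement is also the exponent of \<open>e\<^sup>t\<close> in the Toda system written in the variable \<open>t = ln r\<close>: the
Laplacian contributes \<open>2\<close> and the coefficient \<open>2 N / K\<close>.
\<close>

definition "decay_exponent = 2 * (real K + real N) / real K"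

lemma decay_exponent_eq: "decay_exponent = 2 + 2 * real N / real K" and decay_exponent_pos: "decay_exponent > 0"
  using K_pos by (simp_all add: decay_exponent_def field_simps)

lemma decay_at_infinity:
  assumes prod: "\<And>r. r > 0 \<Longrightarrow> (\<Prod>i<K. h i r) = 1" and i: "i < K"
  shows "((\<lambda>t. exp (m * t) * u i (exp t)) \<longlongrightarrow> 0) at_top" and "((\<lambda>t. exp t * u' i (exp t)) \<longlongrightarrow> 0) at_top"
proof -
  define w where "w = (\<lambda>i t. u i (exp t))"
  define w' where "w' = (\<lambda>i t. exp t * u' i (exp t))"
  define w'' where "w'' = (\<lambda>i t. exp t * u' i (exp t) + exp t * (u'' i (exp t) * exp t))"
  have 1: "(w i has_real_derivative w' i t) (at t)" if "i < K" for i t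
    unfolding w_def w'_def
    using DERIV_chain2[OF u_derivative[OF that exp_gt_zero] DERIV_exp] by (simp add: mult.commute)
  have 2: "(w' i has_real_derivative w'' i t) (at t)" if "i < K" for i t
    unfolding w'_def w''_def
    using DERIV_mult[OF DERIV_exp DERIV_chain2[OF u'_derivative[OF that exp_gt_zero] DERIV_exp]]
    by (simp add: algebra_simps)
  have 3: "w'' i t = 4 * exp (decay_exponent * t) *
        (exp (w i t - w ((i + 1) mod K) t) - exp (w ((i + K - 1) mod K) t - w i t))" if i: "i < K" for i t
  proof -
    have "w'' i t = 4 * (exp t * exp t) * (1 / 4 * (u'' i (exp t) + 1 / exp t * u' i (exp t)))"
      by (simp add: w''_def field_simps)
    also have "\<dots> = 4 * (exp t * exp t * exp t powr (2 * real N / real K)) *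
        (exp (w i t - w ((i + 1) mod K) t) - exp (w ((i + K - 1) mod K) t - w i t))"
      unfolding radial_toda[OF i exp_gt_zero] w_def by (simp only: mult.assoc)
    also have "exp t * exp t * exp t powr (2 * real N / real K) = exp (decay_exponent * t)"
      by (simp add: powr_def decay_exponent_eq algebra_simps flip: exp_add)
    finally show ?thesis .
  qed
  have 4: "(\<Sum>i<K. w i t) = 0" for t
  proof -
    have "(\<Sum>i<K. w i t) = (\<Sum>i<K. ln (h i (exp t))) + (\<Sum>i<K. 2 * t * \<alpha> i)"
      by (simp add: w_def u_def sum.distrib mult_ac)
    also have "(\<Sum>i<K. ln (h i (exp t))) = ln (\<Prod>i<K. h i (exp t))"
      using h_pos[THEN less_imp_neq, THEN not_sym] by (intro ln_prod[symmetric]) auto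
    finally show ?thesis using prod sum_weights by (simp flip: sum_distrib_left)
  qed
  have 5: "eventually (\<lambda>t. \<bar>w i t\<bar> \<le> t) at_top" if "i < K" for i
    using eventually_compose_filterlim[OF u_sublinear[OF that] exp_at_top] by (simp add: w_def)
  show "((\<lambda>t. exp (m * t) * u i (exp t)) \<longlongrightarrow> 0) at_top"
    using toda_decay(1)[OF K_pos decay_exponent_pos 1 2 3 4 5 i] unfolding w_def .
  show "((\<lambda>t. exp t * u' i (exp t)) \<longlongrightarrow> 0) at_top"
    using toda_decay(2)[OF K_pos decay_exponent_pos 1 2 3 4 5 i] unfolding w'_def .
qed

lemma tendsto_exp_substitution:
  fixes f :: "real \<Rightarrow> real"
  assumes "((\<lambda>t. f (exp t)) \<longlongrightarrow> l) at_top"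
  shows "(f \<longlongrightarrow> l) at_top"
proof -
  have "((\<lambda>r. f (exp (ln r))) \<longlongrightarrow> l) at_top"
    using filterlim_compose[OF assms ln_at_top] .
  moreover have "eventually (\<lambda>r. f (exp (ln r)) = f r) at_top"
    using eventually_gt_at_top[of 0] by eventually_elim simp
  ultimately show ?thesis by (rule Lim_transform_eventually)
qed

lemma limits_at_infinity:
  assumes prod: "\<And>r. r > 0 \<Longrightarrow> (\<Prod>i<K. h i r) = 1"
  shows "\<And>i. i < K \<Longrightarrow> (u i \<longlongrightarrow> 0) at_top"
    and "\<And>i. i < K \<Longrightarrow> ((\<lambda>r. r * u' i r) \<longlongrightarrow> 0) at_top"
    and "((\<lambda>r. r powr decay_exponent * (\<Sum>i<K. (exp (u i r - u ((i + 1) mod K) r) - 1))) \<longlongrightarrow> 0) at_top"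
proof -
  show "(u i \<longlongrightarrow> 0) at_top" if "i < K" for i
    by (rule tendsto_exp_substitution) (use decay_at_infinity(1)[OF prod that, of 0] in simp)
  show "((\<lambda>r. r * u' i r) \<longlongrightarrow> 0) at_top" if "i < K" for i
    by (rule tendsto_exp_substitution) (rule decay_at_infinity(2)[OF prod that])
  have "((\<lambda>t. exp (decay_exponent * t) * (exp (u i (exp t) - u ((i + 1) mod K) (exp t)) - 1)) \<longlongrightarrow> 0) at_top"
    if i: "i < K" for i
  proof (rule exp_times_exp_minus_one_tendsto_zero[OF decay_exponent_pos])
    have lt: "(i + 1) mod K < K" using K_pos by simp
    show "((\<lambda>t. exp (decay_exponent * t) * (u i (exp t) - u ((i + 1) mod K) (exp t))) \<longlongrightarrow> 0) at_top"
      using tendsto_diff[OF decay_at_infinity(1)[OF prod i, of decay_exponent] decay_at_infinity(1)[OF prod lt, of decay_exponent]]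
      by (simp add: right_diff_distrib)
  qed
  hence "((\<lambda>t. \<Sum>i<K. exp (decay_exponent * t) * (exp (u i (exp t) - u ((i + 1) mod K) (exp t)) - 1)) \<longlongrightarrow> (\<Sum>i<K. 0)) at_top"
    by (intro tendsto_sum) auto
  hence "((\<lambda>t. exp t powr decay_exponent * (\<Sum>i<K. (exp (u i (exp t) - u ((i + 1) mod K) (exp t)) - 1))) \<longlongrightarrow> 0) at_top"
    by (simp add: powr_def sum_distrib_left)
  thus "((\<lambda>r. r powr decay_exponent * (\<Sum>i<K. (exp (u i r - u ((i + 1) mod K) r) - 1))) \<longlongrightarrow> 0) at_top"
    by (rule tendsto_exp_substitution)
qed

text \<open>
In terms of the metric, \<open>u\<^sub>i - 2 \<alpha>\<^sub>i ln r\<close> is \<open>ln h\<^sub>i\<close> with \<open>h\<^sub>i\<close> positive and smooth at the origin, and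
\<open>r\<^sup>2 r\<^bsup>2 N / K\<^esup> e\<^bsup>u\<^sub>i - u\<^sub>i\<^sub>+\<^sub>1\<^esup>\<close> is \<open>r\<^bsup>2 + 2 b i\<^esup> h\<^sub>i / h\<^sub>i\<^sub>+\<^sub>1\<close>, where the fractional powers have cancelled.
\<close>

lemma limits_at_zero:
  assumes i: "i < K"
  shows "Bfun (\<lambda>r. u i r - 2 * \<alpha> i * ln r) (at_right 0)"
    and "((\<lambda>r. r powr decay_exponent * (exp (u i r - u ((i + 1) mod K) r) - 1)) \<longlongrightarrow> 0) (at_right 0)"
    and "((\<lambda>r. r * u' i r) \<longlongrightarrow> 2 * \<alpha> i) (at_right 0)"
proof -
  have h_lim: "(h i \<longlongrightarrow> h i 0) (at_right 0)" if "i < K" for i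
    using continuous_h[OF that, of 0] unfolding isCont_def by (rule filterlim_mono) (auto simp: at_le)
  have a_lim: "(a i \<longlongrightarrow> a i 0) (at_right 0)"
    using continuous_a[OF i, of 0] unfolding isCont_def by (rule filterlim_mono) (auto simp: at_le)
  have id_lim: "((\<lambda>r::real. r) \<longlongrightarrow> 0) (at_right 0)" by (rule tendsto_ident_at)
  have pos: "eventually (\<lambda>r::real. 0 < r) (at_right 0)" by (simp add: eventually_at_filter)
  have "((\<lambda>r. ln (h i r)) \<longlongrightarrow> ln (h i 0)) (at_right 0)"
    using h_lim[OF i] h_pos[OF i, of 0] by (intro tendsto_ln) auto
  hence "eventually (\<lambda>r. dist (ln (h i r)) (ln (h i 0)) < 1) (at_right 0)" by (rule tendstoD) simp
  hence "eventually (\<lambda>r. norm (u i r - 2 * \<alpha> i * ln r) \<le> \<bar>ln (h i 0)\<bar> + 1) (at_right 0)"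
    by eventually_elim (auto simp: u_def dist_real_def)
  thus "Bfun (\<lambda>r. u i r - 2 * \<alpha> i * ln r) (at_right 0)" by (rule BfunI)
  have lt: "(i + 1) mod K < K" using K_pos by simp
  have "((\<lambda>r. r\<^sup>2 * (r ^ (2 * b i) * (h i r / h ((i + 1) mod K) r)) - r powr decay_exponent) \<longlongrightarrow>
      0\<^sup>2 * (0 ^ (2 * b i) * (h i 0 / h ((i + 1) mod K) 0)) - 0) (at_right 0)"
  proof (intro tendsto_intros id_lim h_lim i lt)
    show "h ((i + 1) mod K) 0 \<noteq> 0" using h_pos[OF lt, of 0] by simp
    show "((\<lambda>r. r powr decay_exponent) \<longlongrightarrow> 0) (at_right 0)" using decay_exponent_pos by real_asymp
  qed
  moreover have "eventually (\<lambda>r. r\<^sup>2 * (r ^ (2 * b i) * (h i r / h ((i + 1) mod K) r)) - r powr decay_exponent =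
      r powr decay_exponent * (exp (u i r - u ((i + 1) mod K) r) - 1)) (at_right 0)"
    using pos
  proof eventually_elim
    case (elim r)
    have "r\<^sup>2 * toda_term i r = r powr decay_exponent * exp (u i r - u ((i + 1) mod K) r)"
      using elim unfolding toda_term_eq[OF i elim] decay_exponent_eq by (simp add: powr_add)
    thus ?case by (simp add: toda_term_def right_diff_distrib)
  qed
  ultimately show "((\<lambda>r. r powr decay_exponent * (exp (u i r - u ((i + 1) mod K) r) - 1)) \<longlongrightarrow> 0) (at_right 0)"
    by (auto intro: Lim_transform_eventually)
  have "((\<lambda>r. 2 * (r * a i r) + 2 * \<alpha> i) \<longlongrightarrow> 2 * (0 * a i 0) + 2 * \<alpha> i) (at_right 0)"
    by (intro tendsto_intros id_lim a_lim)
  moreover have "eventually (\<lambda>r. 2 * (r * a i r) + 2 * \<alpha> i = r * u' i r) (at_right 0)"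
    using pos by eventually_elim (simp add: u'_def field_simps)
  ultimately show "((\<lambda>r. r * u' i r) \<longlongrightarrow> 2 * \<alpha> i) (at_right 0)"
    by (auto intro: Lim_transform_eventually)
qed

end

theorem proposition3p10:
  fixes K N :: nat and b :: "nat \<Rightarrow> nat" and \<alpha> :: "nat \<Rightarrow> real"
    and H :: "complex \<Rightarrow> complex Matrix.mat"
  assumes "K \<ge> 2" and "N \<ge> 1" and "coprime K N"
    and "(\<Sum>i<K. b i) = N"
    and "\<forall>i<K. real (b i) - real N / real K = \<alpha> i - \<alpha> ((i + 1) mod K)"
    and "(\<Sum>i<K. \<alpha> i) = 0"
    and "harmonic_metric K (filt_sum K \<alpha>) (higgs_field K b) H"
    and "\<forall>z. Determinant.det (H z) = 1"
  shows "\<exists>u u' u'' :: nat \<Rightarrow> real \<Rightarrow> real.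
    (\<forall>z. z \<noteq> 0 \<longrightarrow>
       H z = mat_diag K (\<lambda>i. complex_of_real (norm z powr (- 2 * \<alpha> i) * exp (u i (norm z))))) \<and>
    (\<forall>i<K. \<forall>r>0.
       (u i has_real_derivative u' i r) (at r) \<and>
       (u' i has_real_derivative u'' i r) (at r) \<and>
       1 / 4 * (u'' i r + 1 / r * u' i r) =
         r powr (2 * real N / real K) *
           (exp (u i r - u ((i + 1) mod K) r) - exp (u ((i + K - 1) mod K) r - u i r))) \<and>
    (\<forall>i<K. (u i \<longlongrightarrow> 0) at_top) \<and>
    (\<forall>i<K. Bfun (\<lambda>r. u i r - 2 * \<alpha> i * ln r) (at_right 0)) \<and>
    (\<forall>i<K. ((\<lambda>r. r powr (2 * (real K + real N) / real K) *
              (exp (u i r - u ((i + 1) mod K) r) - 1)) \<longlongrightarrow> 0) (at_right 0)) \<and>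
    (\<forall>i<K. ((\<lambda>r. r * u' i r) \<longlongrightarrow> 2 * \<alpha> i) (at_right 0)) \<and>
    ((\<lambda>r. r powr (2 * (real K + real N) / real K) *
        (\<Sum>i<K. (exp (u i r - u ((i + 1) mod K) r) - 1))) \<longlongrightarrow> 0) at_top \<and>
    (\<forall>i<K. ((\<lambda>r. r * u' i r) \<longlongrightarrow> 0) at_top)"
proof -
  interpret harmonic_higgs K N b \<alpha> H
    by unfold_locales (use assms in auto)
  obtain A \<Psi> where "higgs_solution K N b \<alpha> G B A \<Psi>" using higgs_solution_exists by blast
  then interpret S: higgs_solution K N b \<alpha> G B A \<Psi> .
  have H_diag: "H z = mat_diag K (\<lambda>i. complex_of_real (S.h i (norm z)))" for z
  proof (rule eq_matI)
    fix i j assume "i < dim_row (mat_diag K (\<lambda>i. complex_of_real (S.h i (norm z))))"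
      "j < dim_col (mat_diag K (\<lambda>i. complex_of_real (S.h i (norm z))))"
    hence ij: "i < K" "j < K" by (auto simp: mat_diag_def)
    have entry: "H z $$ (i, j) = G z i j" using ij by (simp add: G_def entries_def)
    show "H z $$ (i, j) = mat_diag K (\<lambda>i. complex_of_real (S.h i (norm z))) $$ (i, j)"
    proof (cases "i = j")
      case True
      define c where "c = (if z = 0 then 1 else z / of_real (norm z))"
      have c: "norm c = 1" "c * of_real (norm z) = z" by (auto simp: c_def norm_divide)
      have "G z i i = G (of_real (norm z)) i i"
        using S.G_radial[OF c(1), of "of_real (norm z)" i] unfolding c(2) .
      also have "\<dots> = of_real (S.h i (norm z))" unfolding S.h_def by (rule S.G_pos(2)[OF ij(1)])
      finally show ?thesis using ij True entry by (simp add: mat_diag_def)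
    next
      case False
      thus ?thesis using S.G_diagonal[OF ij False] ij entry by (simp add: mat_diag_def)
    qed
  qed (simp_all add: carrier_matD[OF H_carrier] mat_diag_def)
  have prod: "(\<Prod>i<K. S.h i r) = 1" if "r > 0" for r
  proof -
    have H_r: "H (of_real r) = mat_diag K (\<lambda>i. complex_of_real (S.h i r))" using H_diag[of "of_real r"] that by simp
    have "upper_triangular (H (of_real r))"
      unfolding H_r upper_triangular_def by (auto simp: mat_diag_def)
    hence "Determinant.det (H (of_real r)) = prod_list (diag_mat (H (of_real r)))"
      by (rule det_upper_triangular[OF _ H_carrier])
    also have "\<dots> = (\<Prod>i = 0..<K. H (of_real r) $$ (i, i))"
      using carrier_matD[OF H_carrier] by (simp add: prod_list_diag_prod)
    also have "\<dots> = (\<Prod>i<K. of_real (S.h i r))"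
      unfolding H_r by (intro prod.cong) (auto simp: mat_diag_def)
    finally have "complex_of_real (\<Prod>i<K. S.h i r) = of_real 1" using det_H by simp
    thus ?thesis unfolding of_real_eq_iff .
  qed
  have H_u: "H z = mat_diag K (\<lambda>i. complex_of_real (norm z powr (- 2 * \<alpha> i) * exp (S.u i (norm z))))"
    if "z \<noteq> 0" for z
    unfolding H_diag[of z]
    using that by (intro eq_matI) (auto simp: mat_diag_def S.exp_u powr_minus field_simps)
  show ?thesis
    by (intro exI[of _ S.u] exI[of _ S.u'] exI[of _ S.u''] conjI allI impI;
        (rule H_u S.u_derivative S.u'_derivative S.radial_toda
          S.limits_at_infinity[OF prod, unfolded S.decay_exponent_def]
          S.limits_at_zero[unfolded S.decay_exponent_def]; assumption))
qed

end
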